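(* Let $G$ be a (word-)hyperbolic group and let $E$ be a complete normed $\mathbb{Z}G$-module, where the integral group ring $\mathbb{Z}G$ is a normed ring via the $\ell^1$-norm. Then in every degree the images of the two comparison maps into $\ell^1$-homology coincide: $$\operatorname{im}\Bigl(H_\ast(G,E)\to H_\ast^{(1)}(G,E)\Bigr)=\operatorname{im}\Bigl(H_\ast^{(1,1)}(G,E)\to H_\ast^{(1)}(G,E)\Bigr).$$
   Context: **Normed rings and modules.** A normed ring is a unital ring $R$ with a real-valued function $|\cdot|_R$ such that, for $x,y\in R$ and $n\in\mathbb{Z}$: $|x|_R=0\Leftrightarrow x=0$; $|x+y|_R\le|x|_R+|y|_R$; $|xy|_R\le|x|_R|y|_R$; $|nx|_R=|n||x|_R$ (with $|n|$ the usual absolute value). A normed left $R$-module is a left $R$-module $M$ with a real-valued function $\|\cdot\|$ such that, for $u,v\in M$, $r\in R$, $n\in\mathbb{Z}$: $\|u\|=0\Leftrightarrow u=0$; $\|u+v\|\le\|u\|+\|v\|$; $\|ru\|\le|r|_R\|u\|$; $\|nu\|=|n|\|u\|$. Normed right modules are defined similarly. It is complete if it is complete for the metric $\|u-v\|$. A homomorphism $\phi$ of normed modules is bounded if $\|\phi(m)\|\le c\|m\|$ for some $c\ge 0$ and all $m$. The group ring $\mathbb{Z}G$ is a normed ring with the $\ell^1$-norm $|\sum a_g g|=\sum|a_g|$. **Completed tensor product.** For a normed right $R$-module $E_1$ and a normed left $R$-module $E_2$, the projective tensor product $E_1\widehat\otimes_R E_2$ is the complete normed $\mathbb{Z}$-module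 with a $\mathbb{Z}$-homomorphism $p:E_1\otimes_R E_2\to E_1\widehat\otimes_R E_2$, unique up to isometric isomorphism, such that for every complete normed $\mathbb{Z}$-module $V$ and every $\mathbb{Z}$-homomorphism $\phi:E_1\otimes_R E_2\to V$ with bounded associated bilinear map $\tilde\phi(e,f)=\phi(e\otimes f)$ (i.e. $\|\tilde\phi\|:=\inf\{c\ge0: \|\tilde\phi(e,f)\|\le c\|e\|\|f\|\ \forall e,f\}<\infty$) there is a unique bounded $\bar\phi:E_1\widehat\otimes_R E_2\to V$ with $\phi=\bar\phi\circ p$, and $\|\bar\phi\|=\|\tilde\phi\|$. Left $\mathbb{Z}G$-modules are viewed as right modules via $m\cdot g=g^{-1}m$ when needed to form tensor products. **Chain complexes.** $C_n(G)$ is the free abelian group with basis $G^{n+1}$, with differential $d(g_0,\dots,g_n)=\sum_i(-1)^i(g_0,\dots,\widehat{g_i},\dots,g_n)$ and diagonal $G$-action. Fix a word metric on the finitely generated group $G$. $C_n^{(1)}(G)$ is $C_n(G)$ with the $\ell^1$-norm $\|\sum a_{\bar g}\,\bar g\|_1=\sum|a_{\bar g}|$. $C_n^{(1,1)}(G)$ is $C_n(G)$ with the Sobolev norm $\|\sum a_{\bar g}\,\bar g\|_{1,1}=\sum|a_{\bar g}|(1+\operatorname{diam}(\bar g))$, where $\operatorname{diam}(g_0,\dots,g_n)$ is the diameter of $\{g_0,\dots,g_n\}$ in the word metric (different word metrics give equivalent Sobolev norms). The differentials are bounded for both norms. **Homology.** $H_n(G,E)$ is the $n$-th homology of $C_\ast(G)\otimes_{\mathbb{Z}G}E$.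 The $\ell^1$-homology $H^{(1)}_n(G,E)$ is the $n$-th homology of $C^{(1)}_\ast(G)\widehat\otimes_{\mathbb{Z}G}E$. The Sobolev homology $H^{(1,1)}_n(G,E)$ is the $n$-th homology of $C^{(1,1)}_\ast(G)\widehat\otimes_{\mathbb{Z}G}E$. The comparison maps $H_\ast(G,E)\to H^{(1)}_\ast(G,E)$ and $H_\ast^{(1,1)}(G,E)\to H^{(1)}_\ast(G,E)$ are induced by the canonical map $p:C_\ast(G)\otimes_{\mathbb{Z}G}E\to C_\ast^{(1)}(G)\widehat\otimes_{\mathbb{Z}G}E$ and by the norm-nonincreasing identity $C_\ast^{(1,1)}(G)\to C_\ast^{(1)}(G)$, respectively. *)

theory Defs
  imports Complex_Main "HOL-Algebra.Free_Abelian_Groups" "HOL-Algebra.Generated_Groups" "HOL-Algebra.Ring"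
begin

text \<open>
  Abelian groups are commutative groups in the sense of HOL-Algebra, written multiplicatively, and
  the free abelian group on a set is \<^const>\<open>free_Abelian_group\<close>.
  The types \<open>'g\<close>, \<open>'e\<close>, \<dots> are only ambient types: the objects are the carriers.
\<close>

section \<open>Normed abelian groups, rings and modules\<close>

locale Z_seminormed = comm_group M for M (structure) +
  fixes s :: "'a \<Rightarrow> real"
  assumes triangle: "\<lbrakk>x \<in> carrier M; y \<in> carrier M\<rbrakk> \<Longrightarrow> s (x \<otimes> y) \<le> s x + s y"
    and homogeneous: "x \<in> carrier M \<Longrightarrow> s (x [^] (n::int)) = \<bar>real_of_int n\<bar> * s x"

locale Z_normed = Z_seminormed +
  assumes definite: "x \<in> carrier M \<Longrightarrow> s x = 0 \<longleftrightarrow> x = \<one>"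

definition cauchy_seqs :: "('a, 'x) monoid_scheme \<Rightarrow> ('a \<Rightarrow> real) \<Rightarrow> (nat \<Rightarrow> 'a) set" where
  "cauchy_seqs M s = {X. range X \<subseteq> carrier M \<and>
     (\<forall>\<epsilon>>0. \<exists>N. \<forall>m\<ge>N. \<forall>n\<ge>N. s (X m \<otimes>\<^bsub>M\<^esub> inv\<^bsub>M\<^esub> X n) < \<epsilon>)}"

definition norm_complete :: "('a, 'x) monoid_scheme \<Rightarrow> ('a \<Rightarrow> real) \<Rightarrow> bool" where
  "norm_complete M s \<longleftrightarrow>
     (\<forall>X\<in>cauchy_seqs M s. \<exists>x\<in>carrier M. (\<lambda>n. s (X n \<otimes>\<^bsub>M\<^esub> inv\<^bsub>M\<^esub> x)) \<longlonglongrightarrow> 0)"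

locale complete_Z_normed = Z_normed +
  assumes complete: "norm_complete M s"

locale normed_ring = ring R for R (structure) +
  fixes rnorm :: "'r \<Rightarrow> real"
  assumes ring_definite: "x \<in> carrier R \<Longrightarrow> rnorm x = 0 \<longleftrightarrow> x = \<zero>"
    and ring_triangle: "\<lbrakk>x \<in> carrier R; y \<in> carrier R\<rbrakk> \<Longrightarrow> rnorm (x \<oplus> y) \<le> rnorm x + rnorm y"
    and ring_submult: "\<lbrakk>x \<in> carrier R; y \<in> carrier R\<rbrakk> \<Longrightarrow> rnorm (x \<otimes> y) \<le> rnorm x * rnorm y"
    and ring_homogeneous: "x \<in> carrier R \<Longrightarrow> rnorm ([(n::int)] \<cdot> x) = \<bar>real_of_int n\<bar> * rnorm x"

text \<open>The modules of the HOL-Algebra locale \<open>module\<close> are restricted to commutative rings.\<close>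

locale left_module = R?: ring R + M?: comm_group M for R and M +
  fixes act :: "'r \<Rightarrow> 'm \<Rightarrow> 'm"
  assumes act_closed: "\<lbrakk>r \<in> carrier R; u \<in> carrier M\<rbrakk> \<Longrightarrow> act r u \<in> carrier M"
    and act_mult_distrib: "\<lbrakk>r \<in> carrier R; u \<in> carrier M; v \<in> carrier M\<rbrakk> \<Longrightarrow>
          act r (u \<otimes>\<^bsub>M\<^esub> v) = act r u \<otimes>\<^bsub>M\<^esub> act r v"
    and act_add_distrib: "\<lbrakk>r \<in> carrier R; t \<in> carrier R; u \<in> carrier M\<rbrakk> \<Longrightarrow>
          act (r \<oplus>\<^bsub>R\<^esub> t) u = act r u \<otimes>\<^bsub>M\<^esub> act t u"
    and act_assoc: "\<lbrakk>r \<in> carrier R; t \<in> carrier R; u \<in> carrier M\<rbrakk> \<Longrightarrow>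
          act (r \<otimes>\<^bsub>R\<^esub> t) u = act r (act t u)"
    and act_one: "u \<in> carrier M \<Longrightarrow> act \<one>\<^bsub>R\<^esub> u = u"

locale right_module = R?: ring R + M?: comm_group M for R and M +
  fixes ract :: "'m \<Rightarrow> 'r \<Rightarrow> 'm"
  assumes ract_closed: "\<lbrakk>r \<in> carrier R; u \<in> carrier M\<rbrakk> \<Longrightarrow> ract u r \<in> carrier M"
    and ract_mult_distrib: "\<lbrakk>r \<in> carrier R; u \<in> carrier M; v \<in> carrier M\<rbrakk> \<Longrightarrow>
          ract (u \<otimes>\<^bsub>M\<^esub> v) r = ract u r \<otimes>\<^bsub>M\<^esub> ract v r"
    and ract_add_distrib: "\<lbrakk>r \<in> carrier R; t \<in> carrier R; u \<in> carrier M\<rbrakk> \<Longrightarrow>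
          ract u (r \<oplus>\<^bsub>R\<^esub> t) = ract u r \<otimes>\<^bsub>M\<^esub> ract u t"
    and ract_assoc: "\<lbrakk>r \<in> carrier R; t \<in> carrier R; u \<in> carrier M\<rbrakk> \<Longrightarrow>
          ract u (r \<otimes>\<^bsub>R\<^esub> t) = ract (ract u r) t"
    and ract_one: "u \<in> carrier M \<Longrightarrow> ract u \<one>\<^bsub>R\<^esub> = u"

locale normed_left_module =
  normed_ring R rnorm + left_module R M act + Z_normed M mnorm for R rnorm M act mnorm +
  assumes act_norm: "\<lbrakk>r \<in> carrier R; u \<in> carrier M\<rbrakk> \<Longrightarrow> mnorm (act r u) \<le> rnorm r * mnorm u"

locale normed_right_module =
  normed_ring R rnorm + right_module R M ract + Z_normed M mnorm for R rnorm M ract mnorm +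
  assumes ract_norm: "\<lbrakk>r \<in> carrier R; u \<in> carrier M\<rbrakk> \<Longrightarrow> mnorm (ract u r) \<le> mnorm u * rnorm r"

locale complete_normed_left_module =
  normed_left_module R rnorm M act mnorm + complete_Z_normed M mnorm for R rnorm M act mnorm

text \<open>The infima below are over a nonempty set exactly when the map in question is bounded.\<close>

definition bounded_map :: "('a, 'x) monoid_scheme \<Rightarrow> ('a \<Rightarrow> real) \<Rightarrow> ('b \<Rightarrow> real) \<Rightarrow> ('a \<Rightarrow> 'b) \<Rightarrow> bool" where
  "bounded_map M s t f \<longleftrightarrow> (\<exists>c\<ge>0. \<forall>x\<in>carrier M. t (f x) \<le> c * s x)"

definition op_norm :: "('a, 'x) monoid_scheme \<Rightarrow> ('a \<Rightarrow> real) \<Rightarrow> ('b \<Rightarrow> real) \<Rightarrow> ('a \<Rightarrow> 'b) \<Rightarrow> real" where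
  "op_norm M s t f = Inf {c. c \<ge> 0 \<and> (\<forall>x\<in>carrier M. t (f x) \<le> c * s x)}"

section \<open>Maps induced on quotients\<close>

text \<open>
  If \<open>f\<close> maps cosets of some subgroup into cosets of \<open>N\<close>, then \<open>quotient_map G N f\<close> is the map
  induced by \<open>f\<close> from the corresponding quotient to \<open>G Mod N\<close>.
\<close>

definition quotient_map :: "('b, 'x) monoid_scheme \<Rightarrow> 'b set \<Rightarrow> ('a \<Rightarrow> 'b) \<Rightarrow> 'a set \<Rightarrow> 'b set" where
  "quotient_map G N f = (\<lambda>A. the_elem ((\<lambda>a. N #>\<^bsub>G\<^esub> f a) ` A))"

section \<open>Completion with respect to a seminorm\<close>

definition cauchy_group :: "('a, 'x) monoid_scheme \<Rightarrow> ('a \<Rightarrow> real) \<Rightarrow> (nat \<Rightarrow> 'a) monoid" where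
  "cauchy_group M s = \<lparr>carrier = cauchy_seqs M s, mult = (\<lambda>X Y n. X n \<otimes>\<^bsub>M\<^esub> Y n), one = (\<lambda>n. \<one>\<^bsub>M\<^esub>)\<rparr>"

definition null_seqs :: "('a, 'x) monoid_scheme \<Rightarrow> ('a \<Rightarrow> real) \<Rightarrow> (nat \<Rightarrow> 'a) set" where
  "null_seqs M s = {X \<in> cauchy_seqs M s. (\<lambda>n. s (X n)) \<longlonglongrightarrow> 0}"

definition completion :: "('a, 'x) monoid_scheme \<Rightarrow> ('a \<Rightarrow> real) \<Rightarrow> (nat \<Rightarrow> 'a) set monoid" where
  "completion M s = cauchy_group M s Mod null_seqs M s"

definition completion_class :: "('a, 'x) monoid_scheme \<Rightarrow> ('a \<Rightarrow> real) \<Rightarrow> (nat \<Rightarrow> 'a) \<Rightarrow> (nat \<Rightarrow> 'a) set" where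
  "completion_class M s X = null_seqs M s #>\<^bsub>cauchy_group M s\<^esub> X"

definition completion_norm :: "('a \<Rightarrow> real) \<Rightarrow> (nat \<Rightarrow> 'a) set \<Rightarrow> real" where
  "completion_norm s A = the_elem ((\<lambda>X. lim (\<lambda>n. s (X n))) ` A)"

definition completion_map ::
    "('b, 'x) monoid_scheme \<Rightarrow> ('b \<Rightarrow> real) \<Rightarrow> ('a \<Rightarrow> 'b) \<Rightarrow> (nat \<Rightarrow> 'a) set \<Rightarrow> (nat \<Rightarrow> 'b) set" where
  "completion_map M s f = quotient_map (cauchy_group M s) (null_seqs M s) (\<lambda>X n. f (X n))"

section \<open>Tensor products\<close>

definition tensor_relations ::
    "('r, 'x) ring_scheme \<Rightarrow> ('m, 'y) monoid_scheme \<Rightarrow> ('m \<Rightarrow> 'r \<Rightarrow> 'm) \<Rightarrow>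
     ('n, 'z) monoid_scheme \<Rightarrow> ('r \<Rightarrow> 'n \<Rightarrow> 'n) \<Rightarrow> (('m \<times> 'n) \<Rightarrow>\<^sub>0 int) set" where
  "tensor_relations R M ract N act =
     {frag_of (u \<otimes>\<^bsub>M\<^esub> u', v) - frag_of (u, v) - frag_of (u', v) |u u' v.
        u \<in> carrier M \<and> u' \<in> carrier M \<and> v \<in> carrier N} \<union>
     {frag_of (u, v \<otimes>\<^bsub>N\<^esub> v') - frag_of (u, v) - frag_of (u, v') |u v v'.
        u \<in> carrier M \<and> v \<in> carrier N \<and> v' \<in> carrier N} \<union>
     {frag_of (ract u r, v) - frag_of (u, act r v) |u r v.
        u \<in> carrier M \<and> r \<in> carrier R \<and> v \<in> carrier N}"

definition tensor_kernel ::
    "('r, 'x) ring_scheme \<Rightarrow> ('m, 'y) monoid_scheme \<Rightarrow> ('m \<Rightarrow> 'r \<Rightarrow> 'm) \<Rightarrow>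
     ('n, 'z) monoid_scheme \<Rightarrow> ('r \<Rightarrow> 'n \<Rightarrow> 'n) \<Rightarrow> (('m \<times> 'n) \<Rightarrow>\<^sub>0 int) set" where
  "tensor_kernel R M ract N act =
     generate (free_Abelian_group (carrier M \<times> carrier N)) (tensor_relations R M ract N act)"

definition tensor ::
    "('r, 'x) ring_scheme \<Rightarrow> ('m, 'y) monoid_scheme \<Rightarrow> ('m \<Rightarrow> 'r \<Rightarrow> 'm) \<Rightarrow>
     ('n, 'z) monoid_scheme \<Rightarrow> ('r \<Rightarrow> 'n \<Rightarrow> 'n) \<Rightarrow> (('m \<times> 'n) \<Rightarrow>\<^sub>0 int) set monoid" where
  "tensor R M ract N act =
     free_Abelian_group (carrier M \<times> carrier N) Mod tensor_kernel R M ract N act"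

definition pure_tensor ::
    "('r, 'x) ring_scheme \<Rightarrow> ('m, 'y) monoid_scheme \<Rightarrow> ('m \<Rightarrow> 'r \<Rightarrow> 'm) \<Rightarrow>
     ('n, 'z) monoid_scheme \<Rightarrow> ('r \<Rightarrow> 'n \<Rightarrow> 'n) \<Rightarrow> 'm \<Rightarrow> 'n \<Rightarrow> (('m \<times> 'n) \<Rightarrow>\<^sub>0 int) set" where
  "pure_tensor R M ract N act u v =
     tensor_kernel R M ract N act #>\<^bsub>free_Abelian_group (carrier M \<times> carrier N)\<^esub> frag_of (u, v)"

text \<open>The map \<open>f \<otimes> g\<close>; the parameters describe the target of the map.\<close>

definition tensor_map ::
    "('r, 'x) ring_scheme \<Rightarrow> ('m, 'y) monoid_scheme \<Rightarrow> ('m \<Rightarrow> 'r \<Rightarrow> 'm) \<Rightarrow>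
     ('n, 'z) monoid_scheme \<Rightarrow> ('r \<Rightarrow> 'n \<Rightarrow> 'n) \<Rightarrow> ('k \<Rightarrow> 'm) \<Rightarrow> ('l \<Rightarrow> 'n) \<Rightarrow>
     (('k \<times> 'l) \<Rightarrow>\<^sub>0 int) set \<Rightarrow> (('m \<times> 'n) \<Rightarrow>\<^sub>0 int) set" where
  "tensor_map R M ract N act f g =
     quotient_map (free_Abelian_group (carrier M \<times> carrier N)) (tensor_kernel R M ract N act)
       (frag_extend (\<lambda>(u, v). frag_of (f u, g v)))"

section \<open>Projective tensor products\<close>

text \<open>
  The universal property. The test objects \<open>V\<close> live in an arbitrary type \<open>'v\<close>, to be read as
  universally quantified; see \<open>projective_tensor_universal\<close> below.
\<close>

definition is_projective_tensor ::
    "'v itself \<Rightarrow> ('r, 'x) ring_scheme \<Rightarrow> ('m, 'y) monoid_scheme \<Rightarrow> ('m \<Rightarrow> 'r \<Rightarrow> 'm) \<Rightarrow> ('m \<Rightarrow> real) \<Rightarrow>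
     ('n, 'z) monoid_scheme \<Rightarrow> ('r \<Rightarrow> 'n \<Rightarrow> 'n) \<Rightarrow> ('n \<Rightarrow> real) \<Rightarrow>
     't monoid \<Rightarrow> ('t \<Rightarrow> real) \<Rightarrow> ((('m \<times> 'n) \<Rightarrow>\<^sub>0 int) set \<Rightarrow> 't) \<Rightarrow> bool" where
  "is_projective_tensor TY R M ract mn N act nn T tn p \<longleftrightarrow>
     complete_Z_normed T tn \<and> p \<in> hom (tensor R M ract N act) T \<and>
     (\<forall>(V :: 'v monoid) vn \<phi>.
        complete_Z_normed V vn \<longrightarrow> \<phi> \<in> hom (tensor R M ract N act) V \<longrightarrow>
        (let C = {c. c \<ge> 0 \<and> (\<forall>u\<in>carrier M. \<forall>v\<in>carrier N.
                       vn (\<phi> (pure_tensor R M ract N act u v)) \<le> c * mn u * nn v)}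
         in C \<noteq> {} \<longrightarrow>
          (\<exists>\<psi>\<in>hom T V. bounded_map T tn vn \<psi> \<and>
             (\<forall>x\<in>carrier (tensor R M ract N act). \<phi> x = \<psi> (p x)) \<and> op_norm T tn vn \<psi> = Inf C \<and>
             (\<forall>\<psi>'\<in>hom T V. bounded_map T tn vn \<psi>' \<and>
                (\<forall>x\<in>carrier (tensor R M ract N act). \<phi> x = \<psi>' (p x)) \<longrightarrow>
                (\<forall>y\<in>carrier T. \<psi>' y = \<psi> y)))))"

text \<open>
  A model: the completion of the algebraic tensor product with respect to the largest seminorm
  \<open>s\<close> with \<open>s (u \<otimes> v) \<le> \<parallel>u\<parallel> \<parallel>v\<parallel>\<close>. The seminorms are homogeneous over the
  integers, as required of normed modules; in particular they vanish on torsion elements.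
\<close>

definition projective_seminorm ::
    "('r, 'x) ring_scheme \<Rightarrow> ('m, 'y) monoid_scheme \<Rightarrow> ('m \<Rightarrow> 'r \<Rightarrow> 'm) \<Rightarrow> ('m \<Rightarrow> real) \<Rightarrow>
     ('n, 'z) monoid_scheme \<Rightarrow> ('r \<Rightarrow> 'n \<Rightarrow> 'n) \<Rightarrow> ('n \<Rightarrow> real) \<Rightarrow>
     (('m \<times> 'n) \<Rightarrow>\<^sub>0 int) set \<Rightarrow> real" where
  "projective_seminorm R M ract mn N act nn x =
     (SUP s\<in>{s. Z_seminormed (tensor R M ract N act) s \<and>
        (\<forall>u\<in>carrier M. \<forall>v\<in>carrier N. s (pure_tensor R M ract N act u v) \<le> mn u * nn v)}. s x)"

definition projective_tensor ::
    "('r, 'x) ring_scheme \<Rightarrow> ('m, 'y) monoid_scheme \<Rightarrow> ('m \<Rightarrow> 'r \<Rightarrow> 'm) \<Rightarrow> ('m \<Rightarrow> real) \<Rightarrow>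
     ('n, 'z) monoid_scheme \<Rightarrow> ('r \<Rightarrow> 'n \<Rightarrow> 'n) \<Rightarrow> ('n \<Rightarrow> real) \<Rightarrow>
     (nat \<Rightarrow> (('m \<times> 'n) \<Rightarrow>\<^sub>0 int) set) set monoid" where
  "projective_tensor R M ract mn N act nn =
     completion (tensor R M ract N act) (projective_seminorm R M ract mn N act nn)"

definition projective_norm ::
    "('r, 'x) ring_scheme \<Rightarrow> ('m, 'y) monoid_scheme \<Rightarrow> ('m \<Rightarrow> 'r \<Rightarrow> 'm) \<Rightarrow> ('m \<Rightarrow> real) \<Rightarrow>
     ('n, 'z) monoid_scheme \<Rightarrow> ('r \<Rightarrow> 'n \<Rightarrow> 'n) \<Rightarrow> ('n \<Rightarrow> real) \<Rightarrow>
     (nat \<Rightarrow> (('m \<times> 'n) \<Rightarrow>\<^sub>0 int) set) set \<Rightarrow> real" where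
  "projective_norm R M ract mn N act nn =
     completion_norm (projective_seminorm R M ract mn N act nn)"

definition projective_can ::
    "('r, 'x) ring_scheme \<Rightarrow> ('m, 'y) monoid_scheme \<Rightarrow> ('m \<Rightarrow> 'r \<Rightarrow> 'm) \<Rightarrow> ('m \<Rightarrow> real) \<Rightarrow>
     ('n, 'z) monoid_scheme \<Rightarrow> ('r \<Rightarrow> 'n \<Rightarrow> 'n) \<Rightarrow> ('n \<Rightarrow> real) \<Rightarrow>
     (('m \<times> 'n) \<Rightarrow>\<^sub>0 int) set \<Rightarrow> (nat \<Rightarrow> (('m \<times> 'n) \<Rightarrow>\<^sub>0 int) set) set" where
  "projective_can R M ract mn N act nn x =
     completion_class (tensor R M ract N act) (projective_seminorm R M ract mn N act nn) (\<lambda>_. x)"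

text \<open>
  The continuous extension of \<open>f \<otimes> g\<close> for bounded module homomorphisms \<open>f\<close> and \<open>g\<close>;
  the parameters describe the target of the map.
\<close>

definition projective_map ::
    "('r, 'x) ring_scheme \<Rightarrow> ('m, 'y) monoid_scheme \<Rightarrow> ('m \<Rightarrow> 'r \<Rightarrow> 'm) \<Rightarrow> ('m \<Rightarrow> real) \<Rightarrow>
     ('n, 'z) monoid_scheme \<Rightarrow> ('r \<Rightarrow> 'n \<Rightarrow> 'n) \<Rightarrow> ('n \<Rightarrow> real) \<Rightarrow> ('k \<Rightarrow> 'm) \<Rightarrow> ('l \<Rightarrow> 'n) \<Rightarrow>
     (nat \<Rightarrow> (('k \<times> 'l) \<Rightarrow>\<^sub>0 int) set) set \<Rightarrow> (nat \<Rightarrow> (('m \<times> 'n) \<Rightarrow>\<^sub>0 int) set) set" where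
  "projective_map R M ract mn N act nn f g =
     completion_map (tensor R M ract N act) (projective_seminorm R M ract mn N act nn)
       (tensor_map R M ract N act f g)"

section \<open>Homology of chain complexes\<close>

text \<open>
  A chain complex is a family of abelian groups \<open>A n\<close> (\<open>n \<ge> 0\<close>) with \<open>d n\<close> mapping \<open>A n\<close> to
  \<open>A (n - 1)\<close> for \<open>n > 0\<close>; the value \<open>d 0\<close> is irrelevant, every chain of degree \<open>0\<close> being a cycle.
\<close>

definition cycles :: "(nat \<Rightarrow> 'a monoid) \<Rightarrow> (nat \<Rightarrow> 'a \<Rightarrow> 'a) \<Rightarrow> nat \<Rightarrow> 'a set" where
  "cycles A d n = (case n of 0 \<Rightarrow> carrier (A 0) | Suc m \<Rightarrow> kernel (A n) (A m) (d n))"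

definition boundaries :: "(nat \<Rightarrow> 'a monoid) \<Rightarrow> (nat \<Rightarrow> 'a \<Rightarrow> 'a) \<Rightarrow> nat \<Rightarrow> 'a set" where
  "boundaries A d n = d (Suc n) ` carrier (A (Suc n))"

definition homology :: "(nat \<Rightarrow> 'a monoid) \<Rightarrow> (nat \<Rightarrow> 'a \<Rightarrow> 'a) \<Rightarrow> nat \<Rightarrow> 'a set monoid" where
  "homology A d n = (A n)\<lparr>carrier := cycles A d n\<rparr> Mod boundaries A d n"

text \<open>The map induced in homology by a chain map \<open>f\<close> to the complex \<open>(A, d)\<close>.\<close>

definition homology_map ::
    "(nat \<Rightarrow> 'b monoid) \<Rightarrow> (nat \<Rightarrow> 'b \<Rightarrow> 'b) \<Rightarrow> (nat \<Rightarrow> 'a \<Rightarrow> 'b) \<Rightarrow> nat \<Rightarrow> 'a set \<Rightarrow> 'b set" where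
  "homology_map A d f n =
     quotient_map ((A n)\<lparr>carrier := cycles A d n\<rparr>) (boundaries A d n) (f n)"

section \<open>Word metrics and hyperbolic groups\<close>

definition finite_generating_set :: "('g, 'x) monoid_scheme \<Rightarrow> 'g set \<Rightarrow> bool" where
  "finite_generating_set G S \<longleftrightarrow> finite S \<and> S \<subseteq> carrier G \<and> generate G S = carrier G"

definition word_length :: "('g, 'x) monoid_scheme \<Rightarrow> 'g set \<Rightarrow> 'g \<Rightarrow> nat" where
  "word_length G S g = (LEAST n. \<exists>w. length w = n \<and> set w \<subseteq> S \<union> (\<lambda>s. inv\<^bsub>G\<^esub> s) ` S \<and>
                                      foldr (\<lambda>a b. a \<otimes>\<^bsub>G\<^esub> b) w \<one>\<^bsub>G\<^esub> = g)"

definition word_dist :: "('g, 'x) monoid_scheme \<Rightarrow> 'g set \<Rightarrow> 'g \<Rightarrow> 'g \<Rightarrow> real" where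
  "word_dist G S g h = real (word_length G S (inv\<^bsub>G\<^esub> g \<otimes>\<^bsub>G\<^esub> h))"

definition gromov_product :: "('a \<Rightarrow> 'a \<Rightarrow> real) \<Rightarrow> 'a \<Rightarrow> 'a \<Rightarrow> 'a \<Rightarrow> real" where
  "gromov_product d w x y = (d w x + d w y - d x y) / 2"

definition gromov_hyperbolic :: "'a set \<Rightarrow> ('a \<Rightarrow> 'a \<Rightarrow> real) \<Rightarrow> bool" where
  "gromov_hyperbolic X d \<longleftrightarrow> (\<exists>\<delta>. \<forall>w\<in>X. \<forall>x\<in>X. \<forall>y\<in>X. \<forall>z\<in>X.
     gromov_product d w x z \<ge> min (gromov_product d w x y) (gromov_product d w y z) - \<delta>)"

definition hyperbolic_group :: "('g, 'x) monoid_scheme \<Rightarrow> bool" where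
  "hyperbolic_group G \<longleftrightarrow> group G \<and>
     (\<exists>S. finite_generating_set G S \<and> gromov_hyperbolic (carrier G) (word_dist G S))"

section \<open>The integral group ring and the standard complex\<close>

definition bilinear_extend :: "('a \<Rightarrow> 'b \<Rightarrow> 'c) \<Rightarrow> ('a \<Rightarrow>\<^sub>0 int) \<Rightarrow> ('b \<Rightarrow>\<^sub>0 int) \<Rightarrow> ('c \<Rightarrow>\<^sub>0 int)" where
  "bilinear_extend b x y = frag_extend (\<lambda>g. frag_extend (\<lambda>h. frag_of (b g h)) y) x"

definition group_ring :: "('g, 'x) monoid_scheme \<Rightarrow> ('g \<Rightarrow>\<^sub>0 int) ring" where
  "group_ring G = \<lparr>carrier = carrier (free_Abelian_group (carrier G)),
     mult = bilinear_extend (\<lambda>g h. g \<otimes>\<^bsub>G\<^esub> h), one = frag_of \<one>\<^bsub>G\<^esub>, zero = 0, add = (+)\<rparr>"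

definition l1_norm :: "('a \<Rightarrow>\<^sub>0 int) \<Rightarrow> real" where
  "l1_norm c = (\<Sum>x\<in>Poly_Mapping.keys c. \<bar>real_of_int (Poly_Mapping.lookup c x)\<bar>)"

definition antipode :: "('g, 'x) monoid_scheme \<Rightarrow> ('g \<Rightarrow>\<^sub>0 int) \<Rightarrow> ('g \<Rightarrow>\<^sub>0 int)" where
  "antipode G = frag_extend (\<lambda>g. frag_of (inv\<^bsub>G\<^esub> g))"

text \<open>The tuple \<open>(g\<^sub>0, \<dots>, g\<^sub>n)\<close> is a list of length \<open>n + 1\<close>.\<close>

definition chain_group :: "('g, 'x) monoid_scheme \<Rightarrow> nat \<Rightarrow> ('g list \<Rightarrow>\<^sub>0 int) monoid" where
  "chain_group G n = free_Abelian_group {\<sigma>. length \<sigma> = Suc n \<and> set \<sigma> \<subseteq> carrier G}"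

definition chain_boundary :: "('g list \<Rightarrow>\<^sub>0 int) \<Rightarrow> ('g list \<Rightarrow>\<^sub>0 int)" where
  "chain_boundary =
     frag_extend (\<lambda>\<sigma>. \<Sum>i<length \<sigma>. frag_cmul ((-1) ^ i) (frag_of (take i \<sigma> @ drop (Suc i) \<sigma>)))"

definition chain_act :: "('g, 'x) monoid_scheme \<Rightarrow> ('g \<Rightarrow>\<^sub>0 int) \<Rightarrow> ('g list \<Rightarrow>\<^sub>0 int) \<Rightarrow> ('g list \<Rightarrow>\<^sub>0 int)" where
  "chain_act G = bilinear_extend (\<lambda>g. map (\<lambda>h. g \<otimes>\<^bsub>G\<^esub> h))"

definition chain_ract :: "('g, 'x) monoid_scheme \<Rightarrow> ('g list \<Rightarrow>\<^sub>0 int) \<Rightarrow> ('g \<Rightarrow>\<^sub>0 int) \<Rightarrow> ('g list \<Rightarrow>\<^sub>0 int)" where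
  "chain_ract G c r = chain_act G (antipode G r) c"

definition tuple_diam :: "('g, 'x) monoid_scheme \<Rightarrow> 'g set \<Rightarrow> 'g list \<Rightarrow> real" where
  "tuple_diam G S \<sigma> = Max ((\<lambda>(g, h). word_dist G S g h) ` (set \<sigma> \<times> set \<sigma>))"

definition sobolev_norm :: "('g, 'x) monoid_scheme \<Rightarrow> 'g set \<Rightarrow> ('g list \<Rightarrow>\<^sub>0 int) \<Rightarrow> real" where
  "sobolev_norm G S c =
     (\<Sum>\<sigma>\<in>Poly_Mapping.keys c. \<bar>real_of_int (Poly_Mapping.lookup c \<sigma>)\<bar> * (1 + tuple_diam G S \<sigma>))"

section \<open>The homology groups and the comparison maps\<close>

definition coeff_chains ::
    "('g, 'x) monoid_scheme \<Rightarrow> ('e, 'y) monoid_scheme \<Rightarrow> (('g \<Rightarrow>\<^sub>0 int) \<Rightarrow> 'e \<Rightarrow> 'e) \<Rightarrow> nat \<Rightarrow>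
     ((('g list \<Rightarrow>\<^sub>0 int) \<times> 'e) \<Rightarrow>\<^sub>0 int) set monoid" where
  "coeff_chains G E act n = tensor (group_ring G) (chain_group G n) (chain_ract G) E act"

definition coeff_boundary ::
    "('g, 'x) monoid_scheme \<Rightarrow> ('e, 'y) monoid_scheme \<Rightarrow> (('g \<Rightarrow>\<^sub>0 int) \<Rightarrow> 'e \<Rightarrow> 'e) \<Rightarrow> nat \<Rightarrow>
     ((('g list \<Rightarrow>\<^sub>0 int) \<times> 'e) \<Rightarrow>\<^sub>0 int) set \<Rightarrow> ((('g list \<Rightarrow>\<^sub>0 int) \<times> 'e) \<Rightarrow>\<^sub>0 int) set" where
  "coeff_boundary G E act n =
     tensor_map (group_ring G) (chain_group G (n - 1)) (chain_ract G) E act chain_boundary id"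

definition group_homology ::
    "('g, 'x) monoid_scheme \<Rightarrow> ('e, 'y) monoid_scheme \<Rightarrow> (('g \<Rightarrow>\<^sub>0 int) \<Rightarrow> 'e \<Rightarrow> 'e) \<Rightarrow> nat \<Rightarrow>
     ((('g list \<Rightarrow>\<^sub>0 int) \<times> 'e) \<Rightarrow>\<^sub>0 int) set set monoid" where
  "group_homology G E act = homology (coeff_chains G E act) (coeff_boundary G E act)"

text \<open>
  In the following definitions \<open>cn\<close> is the norm on the chain groups \<open>chain_group G n\<close>,
  either \<^const>\<open>l1_norm\<close> or \<^term>\<open>sobolev_norm G S\<close>.
\<close>

definition hat_chains ::
    "('g, 'x) monoid_scheme \<Rightarrow> (('g list \<Rightarrow>\<^sub>0 int) \<Rightarrow> real) \<Rightarrow>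
     ('e, 'y) monoid_scheme \<Rightarrow> (('g \<Rightarrow>\<^sub>0 int) \<Rightarrow> 'e \<Rightarrow> 'e) \<Rightarrow> ('e \<Rightarrow> real) \<Rightarrow> nat \<Rightarrow>
     (nat \<Rightarrow> ((('g list \<Rightarrow>\<^sub>0 int) \<times> 'e) \<Rightarrow>\<^sub>0 int) set) set monoid" where
  "hat_chains G cn E act en n =
     projective_tensor (group_ring G) (chain_group G n) (chain_ract G) cn E act en"

definition hat_boundary ::
    "('g, 'x) monoid_scheme \<Rightarrow> (('g list \<Rightarrow>\<^sub>0 int) \<Rightarrow> real) \<Rightarrow>
     ('e, 'y) monoid_scheme \<Rightarrow> (('g \<Rightarrow>\<^sub>0 int) \<Rightarrow> 'e \<Rightarrow> 'e) \<Rightarrow> ('e \<Rightarrow> real) \<Rightarrow> nat \<Rightarrow>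
     (nat \<Rightarrow> ((('g list \<Rightarrow>\<^sub>0 int) \<times> 'e) \<Rightarrow>\<^sub>0 int) set) set \<Rightarrow>
     (nat \<Rightarrow> ((('g list \<Rightarrow>\<^sub>0 int) \<times> 'e) \<Rightarrow>\<^sub>0 int) set) set" where
  "hat_boundary G cn E act en n =
     projective_map (group_ring G) (chain_group G (n - 1)) (chain_ract G) cn E act en
       chain_boundary id"

definition l1_homology ::
    "('g, 'x) monoid_scheme \<Rightarrow>
     ('e, 'y) monoid_scheme \<Rightarrow> (('g \<Rightarrow>\<^sub>0 int) \<Rightarrow> 'e \<Rightarrow> 'e) \<Rightarrow> ('e \<Rightarrow> real) \<Rightarrow> nat \<Rightarrow>
     (nat \<Rightarrow> ((('g list \<Rightarrow>\<^sub>0 int) \<times> 'e) \<Rightarrow>\<^sub>0 int) set) set set monoid" where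
  "l1_homology G E act en = homology (hat_chains G l1_norm E act en) (hat_boundary G l1_norm E act en)"

definition sobolev_homology ::
    "('g, 'x) monoid_scheme \<Rightarrow> 'g set \<Rightarrow>
     ('e, 'y) monoid_scheme \<Rightarrow> (('g \<Rightarrow>\<^sub>0 int) \<Rightarrow> 'e \<Rightarrow> 'e) \<Rightarrow> ('e \<Rightarrow> real) \<Rightarrow> nat \<Rightarrow>
     (nat \<Rightarrow> ((('g list \<Rightarrow>\<^sub>0 int) \<times> 'e) \<Rightarrow>\<^sub>0 int) set) set set monoid" where
  "sobolev_homology G S E act en =
     homology (hat_chains G (sobolev_norm G S) E act en) (hat_boundary G (sobolev_norm G S) E act en)"

definition comparison_map ::
    "('g, 'x) monoid_scheme \<Rightarrow>
     ('e, 'y) monoid_scheme \<Rightarrow> (('g \<Rightarrow>\<^sub>0 int) \<Rightarrow> 'e \<Rightarrow> 'e) \<Rightarrow> ('e \<Rightarrow> real) \<Rightarrow> nat \<Rightarrow>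
     ((('g list \<Rightarrow>\<^sub>0 int) \<times> 'e) \<Rightarrow>\<^sub>0 int) set set \<Rightarrow>
     (nat \<Rightarrow> ((('g list \<Rightarrow>\<^sub>0 int) \<times> 'e) \<Rightarrow>\<^sub>0 int) set) set set" where
  "comparison_map G E act en =
     homology_map (hat_chains G l1_norm E act en) (hat_boundary G l1_norm E act en)
       (\<lambda>n. projective_can (group_ring G) (chain_group G n) (chain_ract G) l1_norm E act en)"

text \<open>
  As the Sobolev norm dominates the \<open>\<ell>\<^sup>1\<close>-norm, this map does not depend on the word
  metric except through its domain.
\<close>

definition sobolev_comparison_map ::
    "('g, 'x) monoid_scheme \<Rightarrow>
     ('e, 'y) monoid_scheme \<Rightarrow> (('g \<Rightarrow>\<^sub>0 int) \<Rightarrow> 'e \<Rightarrow> 'e) \<Rightarrow> ('e \<Rightarrow> real) \<Rightarrow> nat \<Rightarrow>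
     (nat \<Rightarrow> ((('g list \<Rightarrow>\<^sub>0 int) \<times> 'e) \<Rightarrow>\<^sub>0 int) set) set set \<Rightarrow>
     (nat \<Rightarrow> ((('g list \<Rightarrow>\<^sub>0 int) \<times> 'e) \<Rightarrow>\<^sub>0 int) set) set set" where
  "sobolev_comparison_map G E act en =
     homology_map (hat_chains G l1_norm E act en) (hat_boundary G l1_norm E act en)
       (\<lambda>n. projective_map (group_ring G) (chain_group G n) (chain_ract G) l1_norm E act en id id)"

end

theory Submission
  imports Defs
begin

text \<open>
  Every class coming from ordinary homology visibly comes from Sobolev homology. For the converse
  one deforms a Sobolev cycle into a chain of finite type. By induction on the degree one builds an
  equivariant chain map \<open>f\<close> that replaces each tuple \<open>\<sigma>\<close> by a chain of tuples of uniformly bounded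
  diameter whose \<open>\<ell>\<^sup>1\<close>-norm is at most \<open>C (1 + diam \<sigma>)\<close>: edges become geodesic paths, and in higher
  degrees one fills the cycle \<open>f (\<partial> \<sigma>)\<close>. All vertices of that cycle lie on geodesics between the
  points of \<open>\<sigma>\<close>, so they are arranged along a tree by Gromov's approximation; cutting the cycle
  along the nodes of the tree gives pieces of bounded diameter, which are coned off at linear cost.
  The homotopy from \<open>f\<close> to the identity is a cone construction without diameter control, which is
  all that the \<open>\<ell>\<^sup>1\<close>-norm needs.

  Applied to a Cauchy sequence representing a Sobolev cycle, \<open>f\<close> lands in finitely many copies of
  the complete module \<open>E\<close>. Its limit is therefore an algebraic cycle, and the homotopy shows that it
  is homologous to the given one in \<open>\<ell>\<^sup>1\<close>-homology. The word metric used for \<open>f\<close> may be the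
  one that is known to be hyperbolic, because all word metrics are bi-Lipschitz equivalent.
\<close>

section \<open>Chains and cones\<close>

text \<open>Two demands on \<open>f\<close> pull against each other. The Sobolev weight is linear in
  the diameter, so \<open>f\<close> is bounded into the l1 norm only if fillings have linear cost;
  and the image must consist of finitely many tuples up to translation, so fillings must have
  bounded diameter. A cone meets the first demand and not the second; the tree meets both. A Sobolev
  cycle is only a Cauchy sequence \<open>X\<close> of chains whose boundaries tend to zero, so with
  d the boundary the homotopy gives fX = X + d(hX) + h(dX) with an error h(dX). As \<open>h\<close>
  is bounded only from the Sobolev norm to the l1 norm, the error dies because dX tends to zero in
  the Sobolev norm. Chains form a free right module over the group ring, with basis the tuples
  starting at the unit. Hence the algebraic tensor product is a direct sum of copies of
  \<open>E\<close>, and its coordinates are bounded for the projective seminorm. This gives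
  completeness on finitely many coordinates, and definiteness of the seminorm before completion: a
  limit whose boundary has seminorm zero is an honest cycle.\<close>

lemma frag_extend_frag_extend:
  "frag_extend f (frag_extend g c) = frag_extend (\<lambda>x. frag_extend f (g x)) c"
  by (simp add: frag_extend_def[of g] frag_extend_def[of "\<lambda>x. frag_extend f (g x)"]
      frag_extend_sum o_def frag_extend_cmul)

lemma frag_extend_fun_diff:
  "frag_extend (\<lambda>x. f x - g x) c = frag_extend f c - frag_extend g c"
  by (simp add: frag_extend_def frag_cmul_distrib2 sum_subtractf poly_mapping_eqI
      lookup_minus right_diff_distrib lookup_sum)

lemma frag_extend_fun_add:
  "frag_extend (\<lambda>x. f x + g x) c = frag_extend f c + frag_extend g c"
  by (simp add: frag_extend_def frag_cmul_distrib2 sum.distrib)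

lemma frag_extend_frag_of [simp]: "frag_extend frag_of c = c"
  by (rule frag_expansion[symmetric])

text \<open>A common form of the two chain norms: the weight 1 gives the l1 norm, and a weight equal
  to one plus the diameter gives the Sobolev norm on chains of nonempty tuples.\<close>

definition weighted_norm :: "('a \<Rightarrow> real) \<Rightarrow> ('a \<Rightarrow>\<^sub>0 int) \<Rightarrow> real" where
  "weighted_norm w c = (\<Sum>x\<in>Poly_Mapping.keys c. \<bar>real_of_int (Poly_Mapping.lookup c x)\<bar> * w x)"

lemma l1_norm_eq_weighted: "l1_norm = weighted_norm (\<lambda>_. 1)"
  by (simp add: fun_eq_iff l1_norm_def weighted_norm_def)

lemma weighted_norm_superset:
  assumes "finite F" "Poly_Mapping.keys c \<subseteq> F"
  shows "weighted_norm w c = (\<Sum>x\<in>F. \<bar>real_of_int (Poly_Mapping.lookup c x)\<bar> * w x)"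
  unfolding weighted_norm_def using assms
  by (intro sum.mono_neutral_left) (auto simp: in_keys_iff)

lemma weighted_norm_0 [simp]: "weighted_norm w 0 = 0"
  by (simp add: weighted_norm_def)

lemma weighted_norm_frag_of [simp]: "weighted_norm w (frag_of x) = w x"
  by (simp add: weighted_norm_def)

lemma weighted_norm_cmul: "weighted_norm w (frag_cmul k c) = \<bar>real_of_int k\<bar> * weighted_norm w c"
  by (subst weighted_norm_superset[OF finite_keys keys_cmul])
     (simp add: weighted_norm_def sum_distrib_left abs_mult mult.assoc)

lemma weighted_norm_minus [simp]: "weighted_norm w (- c) = weighted_norm w c"
  by (simp add: weighted_norm_def)

lemma weighted_norm_nonneg: "(\<And>x. x \<in> Poly_Mapping.keys c \<Longrightarrow> 0 \<le> w x) \<Longrightarrow> 0 \<le> weighted_norm w c"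
  by (simp add: weighted_norm_def sum_nonneg)

lemma weighted_norm_mono:
  "(\<And>x. x \<in> Poly_Mapping.keys c \<Longrightarrow> w x \<le> v x) \<Longrightarrow> weighted_norm w c \<le> weighted_norm v c"
  by (auto simp: weighted_norm_def intro!: sum_mono mult_left_mono)

lemma weighted_norm_scale: "weighted_norm (\<lambda>x. K * w x) c = K * weighted_norm w c"
  by (simp add: weighted_norm_def sum_distrib_left mult_ac)

lemma weighted_norm_add_le:
  assumes "\<And>x. x \<in> Poly_Mapping.keys a \<union> Poly_Mapping.keys b \<Longrightarrow> 0 \<le> w x"
  shows "weighted_norm w (a + b) \<le> weighted_norm w a + weighted_norm w b"
proof -
  let ?F = "Poly_Mapping.keys a \<union> Poly_Mapping.keys b"
  have "weighted_norm w (a + b) = (\<Sum>x\<in>?F. \<bar>real_of_int (Poly_Mapping.lookup (a + b) x)\<bar> * w x)"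
    by (intro weighted_norm_superset keys_add) auto
  also have "\<dots> \<le> (\<Sum>x\<in>?F. \<bar>real_of_int (Poly_Mapping.lookup a x)\<bar> * w x
                        + \<bar>real_of_int (Poly_Mapping.lookup b x)\<bar> * w x)"
    using assms by (intro sum_mono) (auto simp: lookup_add distrib_right[symmetric] intro!: mult_right_mono)
  also have "\<dots> = weighted_norm w a + weighted_norm w b"
    by (simp add: sum.distrib weighted_norm_superset[of ?F a] weighted_norm_superset[of ?F b])
  finally show ?thesis .
qed

lemma weighted_norm_sum_le:
  assumes "\<And>x. 0 \<le> w x"
  shows "weighted_norm w (sum f I) \<le> (\<Sum>i\<in>I. weighted_norm w (f i))"
proof (induction I rule: infinite_finite_induct)
  case (insert i I)
  then show ?case using weighted_norm_add_le[of "f i" "sum f I" w] assms by simp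
qed auto

text \<open>By the triangle inequality a weighted l1 norm is controlled on basis elements, so the
  norm of a linear map of chains can be estimated on single tuples.\<close>

lemma weighted_norm_extend_le:
  assumes "\<And>x. 0 \<le> w x" and "\<And>x. x \<in> Poly_Mapping.keys c \<Longrightarrow> weighted_norm w (f x) \<le> v x"
  shows "weighted_norm w (frag_extend f c) \<le> weighted_norm v c"
proof -
  have "weighted_norm w (frag_extend f c)
      \<le> (\<Sum>i\<in>Poly_Mapping.keys c. weighted_norm w (frag_cmul (Poly_Mapping.lookup c i) (f i)))"
    unfolding frag_extend_def by (rule weighted_norm_sum_le[OF assms(1)])
  also have "\<dots> \<le> weighted_norm v c"
    unfolding weighted_norm_cmul weighted_norm_def[of v]
    by (intro sum_mono mult_left_mono assms(2)) auto
  finally show ?thesis .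
qed

lemma l1_norm_extend_le:
  assumes "\<And>x. x \<in> Poly_Mapping.keys c \<Longrightarrow> l1_norm (f x) \<le> v x"
  shows "l1_norm (frag_extend f c) \<le> weighted_norm v c"
  using assms unfolding l1_norm_eq_weighted by (intro weighted_norm_extend_le) auto

lemma l1_norm_extend_le_const:
  assumes "\<And>x. x \<in> Poly_Mapping.keys c \<Longrightarrow> l1_norm (f x) \<le> K"
  shows "l1_norm (frag_extend f c) \<le> K * l1_norm c"
  using l1_norm_extend_le[of c f "\<lambda>_. K * 1"] assms
  by (simp add: weighted_norm_scale[of K "\<lambda>_. 1", simplified] l1_norm_eq_weighted)

lemma l1_norm_add_le: "l1_norm (a + b) \<le> l1_norm a + l1_norm b"
  unfolding l1_norm_eq_weighted by (rule weighted_norm_add_le) simp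

lemma l1_norm_diff_le: "l1_norm (a - b) \<le> l1_norm a + l1_norm b"
  using l1_norm_add_le[of a "- b"] by (simp add: l1_norm_eq_weighted)

lemma l1_norm_frag_of [simp]: "l1_norm (frag_of x) = 1"
  by (simp add: l1_norm_eq_weighted)

lemma l1_norm_0 [simp]: "l1_norm 0 = 0"
  by (simp add: l1_norm_eq_weighted)

lemma l1_norm_nonneg: "0 \<le> l1_norm c"
  by (simp add: l1_norm_eq_weighted weighted_norm_nonneg)

section \<open>Cones over chains of tuples and the boundary operator\<close>

definition chain_cone :: "'a \<Rightarrow> ('a list \<Rightarrow>\<^sub>0 int) \<Rightarrow> ('a list \<Rightarrow>\<^sub>0 int)" where
  "chain_cone x = frag_extend (\<lambda>\<sigma>. frag_of (x # \<sigma>))"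

lemma chain_cone_0 [simp]: "chain_cone x 0 = 0"
  and chain_cone_frag_of [simp]: "chain_cone x (frag_of \<sigma>) = frag_of (x # \<sigma>)"
  and chain_cone_diff: "chain_cone x (a - b) = chain_cone x a - chain_cone x b"
  by (simp_all add: chain_cone_def frag_extend_diff)

lemma chain_boundary_0 [simp]: "chain_boundary 0 = 0"
  and chain_boundary_diff: "chain_boundary (a - b) = chain_boundary a - chain_boundary b"
  and chain_boundary_add: "chain_boundary (a + b) = chain_boundary a + chain_boundary b"
  and chain_boundary_minus: "chain_boundary (- a) = - chain_boundary a"
  by (simp_all add: chain_boundary_def frag_extend_diff frag_extend_add frag_extend_minus)

lemma chain_boundary_eq_extend: "chain_boundary = frag_extend (\<lambda>\<sigma>. chain_boundary (frag_of \<sigma>))"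
  by (simp add: chain_boundary_def)

lemma chain_boundary_extend:
  "chain_boundary (frag_extend f c) = frag_extend (\<lambda>\<sigma>. chain_boundary (f \<sigma>)) c"
  by (simp add: chain_boundary_def frag_extend_frag_extend)

lemma chain_cone_extend: "chain_cone x (frag_extend f c) = frag_extend (\<lambda>\<sigma>. chain_cone x (f \<sigma>)) c"
  by (simp add: chain_cone_def frag_extend_frag_extend)

lemma extend_chain_boundary:
  "frag_extend f (chain_boundary c) = frag_extend (\<lambda>\<sigma>. frag_extend f (chain_boundary (frag_of \<sigma>))) c"
  by (subst chain_boundary_eq_extend) (simp add: frag_extend_frag_extend)

lemma chain_boundary_Nil [simp]: "chain_boundary (frag_of []) = 0"
  by (simp add: chain_boundary_def)

text \<open>Omitting the first vertex gives \<open>\<sigma>\<close>; every other face is a cone over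
  a face of \<open>\<sigma>\<close>, with its sign flipped by the shift of index. This recursion
  replaces the alternating sum in later boundary computations.\<close>

lemma chain_boundary_Cons:
  "chain_boundary (frag_of (x # \<sigma>)) = frag_of \<sigma> - chain_cone x (chain_boundary (frag_of \<sigma>))"
proof -
  have "chain_cone x (chain_boundary (frag_of \<sigma>)) =
      (\<Sum>i<length \<sigma>. frag_cmul ((-1) ^ i) (frag_of (x # take i \<sigma> @ drop (Suc i) \<sigma>)))"
    by (simp add: chain_boundary_def chain_cone_def frag_extend_sum o_def frag_extend_cmul)
  moreover have "chain_boundary (frag_of (x # \<sigma>)) = frag_of \<sigma> +
      (\<Sum>i<length \<sigma>. - frag_cmul ((-1) ^ i) (frag_of (x # take i \<sigma> @ drop (Suc i) \<sigma>)))"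
    unfolding chain_boundary_def frag_extend_of length_Cons sum.lessThan_Suc_shift by simp
  ultimately show ?thesis
    by (simp only: sum_negf diff_conv_add_uminus)
qed

text \<open>The face of a one-vertex tuple is the empty tuple, so \<open>chain_boundary\<close>
  contains the augmentation. The cone is therefore a contraction in every degree, including the
  lowest, and each chain with zero boundary is the boundary of its cone.\<close>

lemma chain_boundary_chain_cone: "chain_boundary (chain_cone x c) = c - chain_cone x (chain_boundary c)"
proof -
  have "chain_boundary (chain_cone x c) =
      frag_extend (\<lambda>\<sigma>. frag_of \<sigma> - chain_cone x (chain_boundary (frag_of \<sigma>))) c"
    by (subst chain_cone_def) (simp add: chain_boundary_extend chain_boundary_Cons)
  also have "\<dots> = c - chain_cone x (chain_boundary c)"
    by (subst (2) chain_boundary_eq_extend) (simp add: frag_extend_fun_diff chain_cone_extend)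
  finally show ?thesis .
qed

text \<open>Induction on the tuple avoids the double sum: with d the boundary, the recursion and the
  cone formula turn dd(x # \<open>\<sigma>\<close>) into the cone over
  dd(\<open>\<sigma>\<close>).\<close>

lemma chain_boundary_boundary [simp]: "chain_boundary (chain_boundary c) = 0"
proof -
  have "chain_boundary (chain_boundary (frag_of \<sigma>)) = 0" for \<sigma> :: "'a list"
    by (induction \<sigma>) (simp_all add: chain_boundary_Cons chain_boundary_diff chain_boundary_chain_cone)
  then show ?thesis
    by (subst (2) chain_boundary_eq_extend) (simp add: chain_boundary_extend frag_extend_eq_0)
qed

lemma keys_chain_cone: "Poly_Mapping.keys (chain_cone x c) \<subseteq> (#) x ` Poly_Mapping.keys c"
  using keys_frag_extend[of "\<lambda>\<sigma>. frag_of (x # \<sigma>)" c] by (auto simp: chain_cone_def)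

lemma keys_chain_boundary_frag_of:
  assumes "\<eta> \<in> Poly_Mapping.keys (chain_boundary (frag_of \<sigma>))"
  shows "length \<sigma> = Suc (length \<eta>)" "set \<eta> \<subseteq> set \<sigma>"
proof -
  have "\<exists>i<length \<sigma>. \<eta> = take i \<sigma> @ drop (Suc i) \<sigma>"
    using subsetD[OF keys_sum assms[unfolded chain_boundary_def frag_extend_of]] by auto
  then show "length \<sigma> = Suc (length \<eta>)" "set \<eta> \<subseteq> set \<sigma>"
    by (auto dest: in_set_takeD in_set_dropD)
qed

lemma l1_norm_chain_cone_le: "l1_norm (chain_cone x c) \<le> l1_norm c"
  using l1_norm_extend_le_const[of c "\<lambda>\<sigma>. frag_of (x # \<sigma>)" 1] by (simp add: chain_cone_def)

lemma l1_norm_chain_boundary_frag_of: "l1_norm (chain_boundary (frag_of \<sigma>)) \<le> length \<sigma>"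
proof (induction \<sigma>)
  case (Cons x \<sigma>)
  have "l1_norm (chain_boundary (frag_of (x # \<sigma>)))
      \<le> 1 + l1_norm (chain_cone x (chain_boundary (frag_of \<sigma>)))"
    using l1_norm_diff_le[of "frag_of \<sigma>"] by (simp add: chain_boundary_Cons)
  then show ?case using l1_norm_chain_cone_le[of x "chain_boundary (frag_of \<sigma>)"] Cons by simp
qed simp

section \<open>Restriction of chains to sets of tuples, and fillings along a tree\<close>

definition frag_restrict :: "'a set \<Rightarrow> ('a \<Rightarrow>\<^sub>0 int) \<Rightarrow> ('a \<Rightarrow>\<^sub>0 int)" where
  "frag_restrict A = frag_extend (\<lambda>x. if x \<in> A then frag_of x else 0)"

lemma frag_extend_restrict:
  "frag_extend f (frag_restrict A c) = frag_extend (\<lambda>x. if x \<in> A then f x else 0) c"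
  unfolding frag_restrict_def frag_extend_frag_extend by (rule frag_extend_eq) simp

lemma lookup_frag_restrict:
  "Poly_Mapping.lookup (frag_restrict A c) x = (if x \<in> A then Poly_Mapping.lookup c x else 0)"
proof -
  have "Poly_Mapping.lookup (frag_restrict A c) x =
      (\<Sum>i\<in>Poly_Mapping.keys c. if i = x then if x \<in> A then Poly_Mapping.lookup c x else 0 else 0)"
    unfolding frag_restrict_def frag_extend_def lookup_sum
    by (intro sum.cong) auto
  then show ?thesis by (simp add: in_keys_iff)
qed

lemma keys_frag_restrict [simp]: "Poly_Mapping.keys (frag_restrict A c) = Poly_Mapping.keys c \<inter> A"
  by (auto simp: in_keys_iff lookup_frag_restrict split: if_splits)

lemma frag_restrict_extend: "frag_restrict A (frag_extend f c) = frag_extend (\<lambda>x. frag_restrict A (f x)) c"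
  by (simp add: frag_restrict_def frag_extend_frag_extend)

lemma frag_restrict_0 [simp]: "frag_restrict A 0 = 0"
  by (simp add: frag_restrict_def)

lemma frag_restrict_restrict: "frag_restrict A (frag_restrict B c) = frag_restrict (A \<inter> B) c"
  by (rule poly_mapping_eqI) (simp add: lookup_frag_restrict)

lemma frag_restrict_cong:
  "(\<And>x. x \<in> Poly_Mapping.keys c \<Longrightarrow> x \<in> A \<longleftrightarrow> x \<in> B) \<Longrightarrow> frag_restrict A c = frag_restrict B c"
  by (rule poly_mapping_eqI) (auto simp: lookup_frag_restrict in_keys_iff)

lemma frag_restrict_eq_self: "Poly_Mapping.keys c \<subseteq> A \<Longrightarrow> frag_restrict A c = c"
  by (rule poly_mapping_eqI) (auto simp: lookup_frag_restrict in_keys_iff)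

lemma frag_restrict_eq_0: "Poly_Mapping.keys c \<inter> A = {} \<Longrightarrow> frag_restrict A c = 0"
  by (metis keys_eq_empty keys_frag_restrict)

lemma l1_norm_restrict_le: "l1_norm (frag_restrict A c) \<le> l1_norm c"
  using l1_norm_extend_le_const[of c "\<lambda>x. if x \<in> A then frag_of x else 0" 1]
  by (simp add: frag_restrict_def)

lemma frag_eq_sum_restrict:
  "c = (\<Sum>u\<in>\<alpha> ` Poly_Mapping.keys c. frag_restrict (\<alpha> -` {u}) c)"
proof (rule poly_mapping_eqI)
  fix x
  have "(\<Sum>u\<in>\<alpha> ` Poly_Mapping.keys c. Poly_Mapping.lookup (frag_restrict (\<alpha> -` {u}) c) x)
      = (\<Sum>u\<in>\<alpha> ` Poly_Mapping.keys c. if u = \<alpha> x then Poly_Mapping.lookup c x else 0)"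
    by (intro sum.cong) (auto simp: lookup_frag_restrict)
  also have "\<dots> = Poly_Mapping.lookup c x"
    by (auto simp: in_keys_iff)
  finally show "Poly_Mapping.lookup c x =
      Poly_Mapping.lookup (\<Sum>u\<in>\<alpha> ` Poly_Mapping.keys c. frag_restrict (\<alpha> -` {u}) c) x"
    by (simp add: lookup_sum)
qed

text \<open>
  Here \<open>\<alpha>\<close> assigns to a tuple a node of a rooted tree with parent map \<open>par\<close>. Each tuple is coned off
  at the centre of its node. A face at another node than its tuple leaves the difference of two cones,
  which is the boundary of a double cone up to a term that vanishes by \<open>tree_jump_cycle\<close>.
\<close>

definition tree_jump :: "('a list \<Rightarrow> 'v) \<Rightarrow> ('a list \<Rightarrow>\<^sub>0 int) \<Rightarrow> ('a list \<Rightarrow>\<^sub>0 int)" where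
  "tree_jump \<alpha> = frag_extend (\<lambda>\<tau>. frag_restrict {\<eta>. \<alpha> \<eta> \<noteq> \<alpha> \<tau>} (chain_boundary (frag_of \<tau>)))"

definition tree_filling ::
    "('a list \<Rightarrow> 'v) \<Rightarrow> ('v \<Rightarrow> 'v) \<Rightarrow> ('v \<Rightarrow> 'a) \<Rightarrow> ('a list \<Rightarrow>\<^sub>0 int) \<Rightarrow> ('a list \<Rightarrow>\<^sub>0 int)" where
  "tree_filling \<alpha> par ctr z = frag_extend (\<lambda>\<tau>. frag_of (ctr (\<alpha> \<tau>) # \<tau>)) z -
     frag_extend (\<lambda>\<eta>. frag_of (ctr (par (\<alpha> \<eta>)) # ctr (\<alpha> \<eta>) # \<eta>)) (tree_jump \<alpha> z)"

lemma keys_tree_jump: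
  "\<eta> \<in> Poly_Mapping.keys (tree_jump \<alpha> z) \<Longrightarrow>
   \<exists>\<tau>\<in>Poly_Mapping.keys z. \<eta> \<in> Poly_Mapping.keys (chain_boundary (frag_of \<tau>)) \<and> \<alpha> \<eta> \<noteq> \<alpha> \<tau>"
  unfolding tree_jump_def using keys_frag_extend by fastforce

context
  fixes \<alpha> :: "'a list \<Rightarrow> 'v" and par :: "'v \<Rightarrow> 'v" and lev :: "'v \<Rightarrow> nat"
    and z :: "'a list \<Rightarrow>\<^sub>0 int"
  assumes cycle: "chain_boundary z = 0"
    and faces: "\<And>\<tau> \<eta>. \<tau> \<in> Poly_Mapping.keys z \<Longrightarrow> \<eta> \<in> Poly_Mapping.keys (chain_boundary (frag_of \<tau>)) \<Longrightarrow>
      \<alpha> \<eta> \<noteq> \<alpha> \<tau> \<Longrightarrow> par (\<alpha> \<eta>) = \<alpha> \<tau> \<and> lev (\<alpha> \<tau>) < lev (\<alpha> \<eta>)"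
    and lev_par: "\<And>v. lev (par v) \<le> lev v"
begin

text \<open>The tuples below \<open>u\<close> form a chain whose boundary is, up to sign, the part of the jumps at \<open>u\<close>.\<close>

lemma tree_jump_cycle: "chain_boundary (frag_restrict (\<alpha> -` {u}) (tree_jump \<alpha> z)) = 0"
proof -
  \<comment> \<open>The tuples in the subtree rooted at \<open>u\<close>, since \<open>par\<close>
    moves towards the root.\<close>
  define D where "D = {\<tau>. \<exists>j. (par ^^ j) (\<alpha> \<tau>) = u}"
  have lev_pow: "lev ((par ^^ j) v) \<le> lev v" for j v
    by (induction j) (auto intro: order_trans[OF lev_par])
  \<comment> \<open>A face stays at the node of its tuple or moves to a child. So all faces of a
    tuple in the subtree remain there, and from outside the subtree is entered only by a jump to its
    root \<open>u\<close>.\<close>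
  have step: "frag_restrict D (chain_boundary (frag_of \<tau>)) =
      (if \<tau> \<in> D then chain_boundary (frag_of \<tau>) else 0) +
      frag_restrict (\<alpha> -` {u}) (frag_restrict {\<eta>. \<alpha> \<eta> \<noteq> \<alpha> \<tau>} (chain_boundary (frag_of \<tau>)))"
    if \<tau>: "\<tau> \<in> Poly_Mapping.keys z" for \<tau>
  proof (cases "\<tau> \<in> D")
    case True
    then obtain j where j: "(par ^^ j) (\<alpha> \<tau>) = u" by (auto simp: D_def)
    have sub: "\<eta> \<in> D" if "\<eta> \<in> Poly_Mapping.keys (chain_boundary (frag_of \<tau>))" for \<eta>
    proof (cases "\<alpha> \<eta> = \<alpha> \<tau>")
      case False
      then have "(par ^^ Suc j) (\<alpha> \<eta>) = u"
        using faces[OF \<tau> that] j by (simp add: funpow_swap1)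
      then show ?thesis unfolding D_def by blast
    qed (use True in \<open>simp add: D_def\<close>)
    \<comment> \<open>The level of \<open>u\<close> is at most that of
      \<open>\<alpha> \<tau>\<close>, which is strictly below that of
      \<open>\<alpha> \<eta>\<close>; so a jump that starts inside the subtree never lands at
      \<open>u\<close>.\<close>
    have "\<alpha> \<eta> \<noteq> u" if "\<eta> \<in> Poly_Mapping.keys (chain_boundary (frag_of \<tau>))" "\<alpha> \<eta> \<noteq> \<alpha> \<tau>" for \<eta>
      using faces[OF \<tau> that] lev_pow[of j "\<alpha> \<tau>"] j by auto
    then have "frag_restrict (\<alpha> -` {u}) (frag_restrict {\<eta>. \<alpha> \<eta> \<noteq> \<alpha> \<tau>} (chain_boundary (frag_of \<tau>))) = 0"
      by (intro frag_restrict_eq_0) auto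
    moreover have "frag_restrict D (chain_boundary (frag_of \<tau>)) = chain_boundary (frag_of \<tau>)"
      using sub by (intro frag_restrict_eq_self subsetI)
    ultimately show ?thesis using True by simp
  next
    case False
    have "\<eta> \<in> D \<longleftrightarrow> \<eta> \<in> \<alpha> -` {u} \<inter> {\<eta>. \<alpha> \<eta> \<noteq> \<alpha> \<tau>}"
      if \<eta>: "\<eta> \<in> Poly_Mapping.keys (chain_boundary (frag_of \<tau>))" for \<eta>
    proof
      assume "\<eta> \<in> D"
      then obtain j where j: "(par ^^ j) (\<alpha> \<eta>) = u" by (auto simp: D_def)
      have ne: "\<alpha> \<eta> \<noteq> \<alpha> \<tau>" using False \<open>\<eta> \<in> D\<close> by (auto simp: D_def)
      then have par: "par (\<alpha> \<eta>) = \<alpha> \<tau>" using faces[OF \<tau> \<eta>] by simp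
      have "j = 0"
      proof (rule ccontr)
        assume "j \<noteq> 0"
        then obtain i where "j = Suc i" by (cases j) auto
        with j par have "(par ^^ i) (\<alpha> \<tau>) = u" by (simp add: funpow_swap1)
        with False show False by (auto simp: D_def)
      qed
      with j ne show "\<eta> \<in> \<alpha> -` {u} \<inter> {\<eta>. \<alpha> \<eta> \<noteq> \<alpha> \<tau>}" by simp
    next
      assume "\<eta> \<in> \<alpha> -` {u} \<inter> {\<eta>. \<alpha> \<eta> \<noteq> \<alpha> \<tau>}"
      then have "(par ^^ 0) (\<alpha> \<eta>) = u" by simp
      then show "\<eta> \<in> D" unfolding D_def by blast
    qed
    from frag_restrict_cong[OF this] show ?thesis using False by (simp add: frag_restrict_restrict)
  qed
  have "0 = frag_restrict D (chain_boundary z)" by (simp add: cycle)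
  also have "\<dots> = frag_extend (\<lambda>\<tau>. frag_restrict D (chain_boundary (frag_of \<tau>))) z"
    by (subst chain_boundary_eq_extend) (simp add: frag_restrict_extend)
  also have "\<dots> = frag_extend (\<lambda>\<tau>. (if \<tau> \<in> D then chain_boundary (frag_of \<tau>) else 0) +
      frag_restrict (\<alpha> -` {u}) (frag_restrict {\<eta>. \<alpha> \<eta> \<noteq> \<alpha> \<tau>} (chain_boundary (frag_of \<tau>)))) z"
    by (rule frag_extend_eq) (rule step)
  also have "\<dots> = chain_boundary (frag_restrict D z) + frag_restrict (\<alpha> -` {u}) (tree_jump \<alpha> z)"
    by (subst chain_boundary_eq_extend)
       (simp add: frag_extend_fun_add frag_extend_restrict tree_jump_def frag_restrict_extend)
  finally have "frag_restrict (\<alpha> -` {u}) (tree_jump \<alpha> z) = - chain_boundary (frag_restrict D z)"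
    by (simp add: eq_neg_iff_add_eq_0 add.commute)
  then show ?thesis by (simp add: chain_boundary_minus)
qed

text \<open>Coning each tuple at its own centre has boundary \<open>z\<close> minus the cones over
  its faces. Cones whose faces use their own centre add up to a cone over the boundary of
  \<open>z\<close>, hence to zero; each jump leaves the difference of the cone at the parent
  (\<open>J\<close>) and the cone at the child (\<open>K\<close>). A double cone over the jump has
  boundary \<open>K - J\<close> plus the double cone \<open>Q\<close> over the boundary of the jump,
  and the terms \<open>Q\<close> cancel node by node because the jumps at one node form a
  cycle.\<close>

theorem chain_boundary_tree_filling: "chain_boundary (tree_filling \<alpha> par ctr z) = z"
proof -
  let ?e = "tree_jump \<alpha> z"
  define K where "K \<eta> = frag_of (ctr (\<alpha> \<eta>) # \<eta>)" for \<eta>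
  define J where "J \<eta> = frag_of (ctr (par (\<alpha> \<eta>)) # \<eta>)" for \<eta>
  define Q where "Q u \<eta> = chain_cone (ctr (par u)) (chain_cone (ctr u) (chain_boundary (frag_of \<eta>)))" for u \<eta>
  \<comment> \<open>Every face is moved from the centre of its tuple to the centre of its own node.
    A correction arises only at jumps, where the node of the tuple is the parent of the node of the
    face.\<close>
  have cone_K: "chain_cone (ctr (\<alpha> \<tau>)) (chain_boundary (frag_of \<tau>)) =
      frag_extend K (chain_boundary (frag_of \<tau>)) +
      frag_extend (\<lambda>\<eta>. J \<eta> - K \<eta>) (frag_restrict {\<eta>. \<alpha> \<eta> \<noteq> \<alpha> \<tau>} (chain_boundary (frag_of \<tau>)))"
    if \<tau>: "\<tau> \<in> Poly_Mapping.keys z" for \<tau>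
    unfolding frag_extend_restrict frag_extend_fun_add[symmetric] chain_cone_def
    using faces[OF \<tau>] by (intro frag_extend_eq) (auto simp: K_def J_def)
  have "frag_extend (\<lambda>\<tau>. chain_cone (ctr (\<alpha> \<tau>)) (chain_boundary (frag_of \<tau>))) z =
      frag_extend K (chain_boundary z) + frag_extend (\<lambda>\<eta>. J \<eta> - K \<eta>) ?e"
    unfolding extend_chain_boundary[of K z] tree_jump_def frag_extend_frag_extend
      frag_extend_fun_add[symmetric]
    by (rule frag_extend_eq) (rule cone_K)
  then have 1: "chain_boundary (frag_extend K z) = z - frag_extend (\<lambda>\<eta>. J \<eta> - K \<eta>) ?e"
    by (simp add: cycle K_def chain_boundary_extend chain_boundary_Cons frag_extend_fun_diff)
  \<comment> \<open>The two cone points in \<open>Q\<close> depend only on the node. Grouping the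
    jumps by node therefore makes them constant, so the boundary can be taken of a whole group,
    where it vanishes.\<close>
  have "frag_extend (\<lambda>\<eta>. Q (\<alpha> \<eta>) \<eta>) ?e =
      frag_extend (\<lambda>\<eta>. Q (\<alpha> \<eta>) \<eta>) (\<Sum>u\<in>\<alpha> ` Poly_Mapping.keys ?e. frag_restrict (\<alpha> -` {u}) ?e)"
    using frag_eq_sum_restrict[of ?e \<alpha>] by simp
  also have "\<dots> = (\<Sum>u\<in>\<alpha> ` Poly_Mapping.keys ?e. frag_extend (Q u) (frag_restrict (\<alpha> -` {u}) ?e))"
    unfolding frag_extend_sum[OF finite_imageI[OF finite_keys]] o_def
    by (intro sum.cong refl frag_extend_eq) auto
  also have "\<dots> = (\<Sum>u\<in>\<alpha> ` Poly_Mapping.keys ?e. chain_cone (ctr (par u)) (chain_cone (ctr u)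
      (chain_boundary (frag_restrict (\<alpha> -` {u}) ?e))))"
    unfolding Q_def chain_cone_extend[symmetric] by (simp flip: chain_boundary_eq_extend)
  also have "\<dots> = 0" by (simp add: tree_jump_cycle)
  finally have "frag_extend (\<lambda>\<eta>. Q (\<alpha> \<eta>) \<eta>) ?e = 0" .
  moreover have "chain_boundary (frag_of (ctr (par (\<alpha> \<eta>)) # ctr (\<alpha> \<eta>) # \<eta>)) =
      (K \<eta> - J \<eta>) + Q (\<alpha> \<eta>) \<eta>" for \<eta>
    by (simp add: chain_boundary_Cons K_def J_def Q_def chain_cone_diff)
  ultimately have "chain_boundary (frag_extend (\<lambda>\<eta>. frag_of (ctr (par (\<alpha> \<eta>)) # ctr (\<alpha> \<eta>) # \<eta>)) ?e) =
      frag_extend (\<lambda>\<eta>. K \<eta> - J \<eta>) ?e"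
    by (simp add: chain_boundary_extend frag_extend_fun_add)
  with 1 show ?thesis
    by (simp add: tree_filling_def chain_boundary_diff K_def[symmetric] frag_extend_fun_diff)
qed

end

text \<open>A tuple contributes one cone, and at most one double cone for each of its
  \<open>k\<close> faces.\<close>

lemma l1_norm_tree_filling:
  assumes "\<And>\<tau>. \<tau> \<in> Poly_Mapping.keys z \<Longrightarrow> length \<tau> = k"
  shows "l1_norm (tree_filling \<alpha> par ctr z) \<le> (1 + k) * l1_norm z"
proof -
  have "l1_norm (tree_jump \<alpha> z) \<le> k * l1_norm z"
    unfolding tree_jump_def
    by (intro l1_norm_extend_le_const order_trans[OF l1_norm_restrict_le]
        order_trans[OF l1_norm_chain_boundary_frag_of]) (simp add: assms)
  moreover have "l1_norm (frag_extend (\<lambda>\<tau>. frag_of (ctr (\<alpha> \<tau>) # \<tau>)) z) \<le> 1 * l1_norm z"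
    by (rule l1_norm_extend_le_const) simp
  moreover have "l1_norm (frag_extend (\<lambda>\<eta>. frag_of (ctr (par (\<alpha> \<eta>)) # ctr (\<alpha> \<eta>) # \<eta>)) (tree_jump \<alpha> z))
      \<le> 1 * l1_norm (tree_jump \<alpha> z)"
    by (rule l1_norm_extend_le_const) simp
  ultimately have "l1_norm (tree_filling \<alpha> par ctr z) \<le> 1 * l1_norm z + k * l1_norm z"
    unfolding tree_filling_def
    by (smt (verit, ccfv_threshold) l1_norm_diff_le)
  then show ?thesis by (simp only: distrib_right)
qed

section \<open>Linear fillings in Gromov hyperbolic spaces\<close>

locale gromov_space =
  fixes X :: "'a set" and d :: "'a \<Rightarrow> 'a \<Rightarrow> real" and \<delta> :: real
  assumes dist_self: "x \<in> X \<Longrightarrow> d x x = 0"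
    and dist_sym: "\<lbrakk>x \<in> X; y \<in> X\<rbrakk> \<Longrightarrow> d x y = d y x"
    and dist_triangle: "\<lbrakk>x \<in> X; y \<in> X; z \<in> X\<rbrakk> \<Longrightarrow> d x z \<le> d x y + d y z"
    and delta_nonneg: "0 \<le> \<delta>"
    and hyperbolic: "\<lbrakk>w \<in> X; x \<in> X; y \<in> X; z \<in> X\<rbrakk> \<Longrightarrow>
      min (gromov_product d w x y) (gromov_product d w y z) - \<delta> \<le> gromov_product d w x z"
begin

lemma dist_nonneg: "\<lbrakk>x \<in> X; y \<in> X\<rbrakk> \<Longrightarrow> 0 \<le> d x y"
  using dist_triangle[of x y x] dist_self[of x] dist_sym[of x y] by simp

lemma gromov_product_sym:
  "\<lbrakk>x \<in> X; y \<in> X\<rbrakk> \<Longrightarrow> gromov_product d w x y = gromov_product d w y x"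
  by (simp add: gromov_product_def dist_sym[of x y])

lemma gromov_product_add:
  "\<lbrakk>p \<in> X; x \<in> X; y \<in> X\<rbrakk> \<Longrightarrow> gromov_product d p x y + gromov_product d y p x = d p y"
  by (simp add: gromov_product_def dist_sym[of y p] dist_sym[of y x] field_simps)

text \<open>A Gromov product at most zero says that \<open>d a y + d y b\<close> does not exceed
  \<open>d a b\<close>, so \<open>y\<close> lies on a geodesic from \<open>a\<close> to
  \<open>b\<close> in the metric sense, which suits the discrete word metric. The hull depends only
  on the vertices of \<open>\<sigma>\<close>, so hulls of faces lie inside it and fillings of faces
  can be reused.\<close>

definition geodesic_hull :: "'a list \<Rightarrow> 'a set" where
  "geodesic_hull \<sigma> = {y \<in> X. \<exists>a\<in>set \<sigma>. \<exists>b\<in>set \<sigma>. gromov_product d y a b \<le> 0}"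

lemma geodesic_hull_mono: "set \<sigma> \<subseteq> set \<tau> \<Longrightarrow> geodesic_hull \<sigma> \<subseteq> geodesic_hull \<tau>"
  by (auto simp: geodesic_hull_def)

text \<open>Thin triangles: hyperbolicity seen from \<open>y\<close> bounds the product of
  \<open>p\<close> with one of the endpoints \<open>a\<close>, \<open>b\<close> by \<delta>.
  Exchanging the base point \<open>y\<close> for \<open>p\<close> turns this into the stated lower
  bound, so \<open>y\<close> is close to a geodesic from \<open>p\<close> to that endpoint.\<close>

lemma geodesic_hull_branch:
  assumes "p \<in> X" "set \<sigma> \<subseteq> X" "y \<in> geodesic_hull \<sigma>"
  shows "\<exists>a\<in>set \<sigma>. d p y - \<delta> \<le> gromov_product d p y a"
proof -
  obtain a b where ab: "y \<in> X" "a \<in> set \<sigma>" "b \<in> set \<sigma>" "gromov_product d y a b \<le> 0"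
    using assms by (auto simp: geodesic_hull_def)
  then have X: "a \<in> X" "b \<in> X" using assms by auto
  have "gromov_product d y a p \<le> \<delta> \<or> gromov_product d y p b \<le> \<delta>"
    using hyperbolic[of y a p b] X ab assms by (auto simp: min_def split: if_splits)
  then obtain c where c: "c \<in> set \<sigma>" "c \<in> X" "gromov_product d y p c \<le> \<delta>"
    using ab X gromov_product_sym[of a p y] assms(1) by auto
  then have "d p y - \<delta> \<le> gromov_product d p y c"
    using gromov_product_add[of p c y] gromov_product_sym[of c y p] ab assms by simp
  with c show ?thesis by blast
qed

lemma gromov_product_min3:
  assumes "w \<in> X" "x \<in> X" "y \<in> X" "z \<in> X" "v \<in> X"
    and "c \<le> gromov_product d w x y" "c \<le> gromov_product d w y z" "c \<le> gromov_product d w z v"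
  shows "c - 2 * \<delta> \<le> gromov_product d w x v"
  using hyperbolic[of w x y z] hyperbolic[of w x z v] delta_nonneg assms
  by (auto simp: min_def split: if_splits)

section \<open>The tree approximating the vertices of a tuple, seen from a base point\<close>

context
  fixes \<sigma> :: "'a list" and p :: 'a and R :: real
  assumes p: "p \<in> X" and \<sigma>: "set \<sigma> \<subseteq> X" and R: "0 \<le> R"
begin

definition branch :: "'a \<Rightarrow> 'a" where
  "branch y = (SOME a. a \<in> set \<sigma> \<and> d p y - \<delta> \<le> gromov_product d p y a)"

lemma branch:
  assumes "y \<in> geodesic_hull \<sigma>"
  shows "branch y \<in> set \<sigma>" "branch y \<in> X" "d p y - \<delta> \<le> gromov_product d p y (branch y)"
proof -
  have "\<exists>a. a \<in> set \<sigma> \<and> d p y - \<delta> \<le> gromov_product d p y a"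
    using geodesic_hull_branch[OF p \<sigma> assms] by blast
  from someI_ex[OF this]
  show "branch y \<in> set \<sigma>" "branch y \<in> X" "d p y - \<delta> \<le> gromov_product d p y (branch y)"
    using \<sigma> by (auto simp: branch_def)
qed

text \<open>
  Geodesics from \<open>p\<close> to \<open>a\<close> and \<open>b\<close> stay close up to distance \<open>gromov_product d p a b\<close>, so the classes
  generated by \<open>fellow l\<close> are the branches at distance \<open>l\<close> from \<open>p\<close> of the tree approximating \<open>\<sigma>\<close>.
\<close>

definition fellow :: "real \<Rightarrow> ('a \<times> 'a) set" where
  "fellow l = {(a, b). a \<in> set \<sigma> \<and> b \<in> set \<sigma> \<and> l \<le> gromov_product d p a b}"

lemma fellow_sym: "(a, b) \<in> fellow l \<Longrightarrow> (b, a) \<in> fellow l"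
  using \<sigma> gromov_product_sym[of a b p] by (simp add: fellow_def subset_eq)

lemma fellow_class_eq:
  assumes "(a, b) \<in> fellow l"
  shows "(fellow l)\<^sup>* `` {a} = (fellow l)\<^sup>* `` {b}"
  using assms fellow_sym[OF assms] by (auto intro: converse_rtrancl_into_rtrancl)

lemma fellow_mono: "l \<le> l' \<Longrightarrow> fellow l' \<subseteq> fellow l"
  by (auto simp: fellow_def)

lemma finite_fellow: "finite (fellow l)"
  by (rule finite_subset[of _ "set \<sigma> \<times> set \<sigma>"]) (auto simp: fellow_def)

lemma card_fellow: "card (fellow l) \<le> length \<sigma> ^ 2"
proof -
  have "card (fellow l) \<le> card (set \<sigma> \<times> set \<sigma>)"
    by (rule card_mono) (auto simp: fellow_def)
  also have "\<dots> \<le> length \<sigma> ^ 2"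
    by (simp add: power2_eq_square mult_mono card_length)
  finally show ?thesis .
qed

text \<open>Hyperbolicity makes \<open>fellow\<close> transitive only up to \<delta>, while a tree
  needs true equivalence classes; this bounds the price of the transitive closure. In a finite
  relation a related pair is joined by at most as many steps as the relation has elements, and each
  step costs one \<delta>. The total depends only on the length of \<open>\<sigma>\<close>.\<close>

lemma fellow_class_product:
  assumes "(a, b) \<in> (fellow l)\<^sup>*" "a \<in> set \<sigma>" "y \<in> X" "l \<le> gromov_product d p y a"
  shows "l - real (length \<sigma> ^ 2) * \<delta> \<le> gromov_product d p y b"
proof -
  have *: "l - real n * \<delta> \<le> gromov_product d p y b \<and> b \<in> set \<sigma>" if "(a, b) \<in> fellow l ^^ n" for n b
    using that
  proof (induction n arbitrary: b)
    case (Suc n)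
    then obtain c where c: "(a, c) \<in> fellow l ^^ n" "(c, b) \<in> fellow l" by auto
    have *: "l - real n * \<delta> \<le> gromov_product d p y c" "c \<in> set \<sigma>"
      using Suc.IH[OF c(1)] by auto
    have b: "b \<in> set \<sigma>" "l \<le> gromov_product d p c b" using c(2) by (auto simp: fellow_def)
    have "min (gromov_product d p y c) (gromov_product d p c b) - \<delta> \<le> gromov_product d p y b"
      using hyperbolic[of p y c b] p \<sigma> b * assms by auto
    moreover have "l - real n * \<delta> \<le> min (gromov_product d p y c) (gromov_product d p c b)"
      using * b delta_nonneg by (auto simp: min_def intro: order_trans[of _ l])
    ultimately have "l - real n * \<delta> - \<delta> \<le> gromov_product d p y b" by linarith
    then show ?case using b by (simp add: algebra_simps)
  qed (use assms in auto)
  obtain n where n: "n \<le> card (fellow l)" "(a, b) \<in> fellow l ^^ n"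
    using assms(1) rtrancl_finite_eq_relpow[OF finite_fellow, of l] by auto
  have "real n * \<delta> \<le> real (length \<sigma> ^ 2) * \<delta>"
    using n(1) card_fellow[of l] delta_nonneg by (intro mult_right_mono) (auto simp only: of_nat_le_iff)
  with *[OF n(2)] show ?thesis by linarith
qed

text \<open>The error \<open>3 * \<delta> + R\<close> is what is lost in comparing the branches of
  two vertices of one small tuple. The length exceeds \<open>R\<close>, so that a face lies at most
  one level above its tuple; the summand 1 also makes it positive.\<close>

definition step_len :: real where "step_len = 3 * \<delta> + R + 1"

text \<open>The vertex nearest to \<open>p\<close> decides, so that passing to a face can only raise
  the level.\<close>

definition level :: "'a list \<Rightarrow> nat" where
  "level \<tau> = nat \<lfloor>Min (d p ` set \<tau>) / step_len\<rfloor>"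

text \<open>
  The branch of a tuple is taken one level below the tuple: there it does not depend on the chosen
  vertex of the tuple.
\<close>

definition level_class :: "nat \<Rightarrow> 'a set \<Rightarrow> 'a set" where
  "level_class l A = (fellow (real l * step_len - step_len))\<^sup>* `` A"

definition node :: "'a list \<Rightarrow> nat \<times> 'a set" where
  "node \<tau> = (level \<tau>, level_class (level \<tau>) {branch (hd \<tau>)})"

text \<open>Thresholds of \<open>fellow\<close> decrease with the level, so a class generates the
  class one level down that contains it. At level 0 the truncated subtraction keeps the level at 0,
  so levels decrease only weakly along \<open>parent\<close>.\<close>

definition parent :: "nat \<times> 'a set \<Rightarrow> nat \<times> 'a set" where
  "parent u = (fst u - 1, level_class (fst u - 1) (snd u))"

definition small :: "'a list \<Rightarrow> bool" where
  "small \<tau> \<longleftrightarrow> \<tau> \<noteq> [] \<and> set \<tau> \<subseteq> geodesic_hull \<sigma> \<and> (\<forall>x\<in>set \<tau>. \<forall>y\<in>set \<tau>. d x y \<le> R)"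

lemma geodesic_hull_X: "geodesic_hull \<sigma> \<subseteq> X" by (auto simp: geodesic_hull_def)

lemma step_len: "0 < step_len" "3 * \<delta> + R \<le> step_len" "\<delta> \<le> step_len" "R < step_len"
  using delta_nonneg R by (auto simp: step_len_def)

lemma level_le:
  assumes "small \<tau>" "y \<in> set \<tau>"
  shows "real (level \<tau>) * step_len \<le> d p y" "d p y \<le> (real (level \<tau>) + 1) * step_len + R"
proof -
  let ?m = "Min (d p ` set \<tau>)"
  have sub: "set \<tau> \<subseteq> X" using assms geodesic_hull_X by (auto simp: small_def)
  have "?m \<in> d p ` set \<tau>" using assms by (intro Min_in) (auto simp: small_def)
  then obtain x where x: "x \<in> set \<tau>" "?m = d p x" by auto
  have m0: "0 \<le> ?m / step_len" using x dist_nonneg[of p x] p sub step_len by auto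
  have l: "real (level \<tau>) = of_int \<lfloor>?m / step_len\<rfloor>"
    using m0 by (simp add: level_def)
  have "real (level \<tau>) * step_len \<le> ?m"
    using l step_len(1) by (simp add: pos_le_divide_eq[symmetric])
  also have "?m \<le> d p y" using assms by auto
  finally show "real (level \<tau>) * step_len \<le> d p y" .
  have "?m / step_len \<le> real (level \<tau>) + 1" using l by linarith
  then have "?m \<le> (real (level \<tau>) + 1) * step_len" using step_len(1) by (simp add: pos_divide_le_eq)
  moreover have "d p y \<le> d p x + d x y" using dist_triangle p sub x assms by auto
  moreover have "d x y \<le> R" using x assms by (auto simp: small_def)
  ultimately show "d p y \<le> (real (level \<tau>) + 1) * step_len + R" using x by simp
qed

text \<open>The branch of one vertex, this vertex, the other vertex and its branch form a chain of
  four points. Consecutive Gromov products are at least the level distance minus \<delta> and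
  \<open>R\<close>; joining the three links loses another \<open>2 * \<delta>\<close>, which is
  still within one \<open>step_len\<close>.\<close>

lemma node_eq:
  assumes "small \<tau>" "y \<in> set \<tau>"
  shows "node \<tau> = (level \<tau>, level_class (level \<tau>) {branch y})"
proof -
  let ?x = "hd \<tau>" and ?l = "real (level \<tau>) * step_len"
  have x: "?x \<in> set \<tau>" using assms by (auto simp: small_def)
  have h: "?x \<in> geodesic_hull \<sigma>" "y \<in> geodesic_hull \<sigma>" "d ?x y \<le> R" using x assms by (auto simp: small_def)
  have X: "?x \<in> X" "y \<in> X" using h geodesic_hull_X by auto
  note bx = branch[OF h(1)] and b = branch[OF h(2)]
  have "?l - \<delta> - R \<le> gromov_product d p (branch ?x) ?x"
    using bx level_le[OF assms(1) x] gromov_product_sym[of "branch ?x" ?x p] X R by simp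
  moreover have "?l - \<delta> - R \<le> gromov_product d p ?x y"
    using level_le[OF assms(1) x] level_le[OF assms] h R delta_nonneg
    by (simp add: gromov_product_def)
  moreover have "?l - \<delta> - R \<le> gromov_product d p y (branch y)"
    using b level_le[OF assms] R by simp
  ultimately have "?l - \<delta> - R - 2 * \<delta> \<le> gromov_product d p (branch ?x) (branch y)"
    using gromov_product_min3[OF p _ X] bx b by blast
  then have "(branch ?x, branch y) \<in> fellow (?l - step_len)"
    using bx b step_len by (auto simp: fellow_def)
  from fellow_class_eq[OF this] show ?thesis
    by (simp add: node_def level_class_def)
qed

text \<open>A vertex \<open>y\<close> of the face is a vertex of the tuple too, so both nodes can be
  computed from \<open>branch y\<close> and differ only through the level. As \<open>R\<close> is
  less than \<open>step_len\<close>, the level rises by at most one, and the node of the face is the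
  same or a child.\<close>

lemma node_face:
  assumes \<tau>: "small \<tau>" and \<eta>: "\<eta> \<noteq> []" "set \<eta> \<subseteq> set \<tau>" and ne: "node \<eta> \<noteq> node \<tau>"
  shows "parent (node \<eta>) = node \<tau> \<and> fst (node \<tau>) < fst (node \<eta>)"
proof -
  have sm: "small \<eta>" using \<tau> \<eta> by (auto simp: small_def)
  obtain y where y: "y \<in> set \<eta>" "y \<in> set \<tau>" using \<eta> by (cases \<eta>) auto
  note nodes = node_eq[OF sm y(1)] node_eq[OF \<tau> y(2)]
  have le: "level \<tau> \<le> level \<eta>"
    unfolding level_def using \<eta> step_len
    by (intro nat_mono floor_mono divide_right_mono Min_antimono image_mono) auto
  have "real (level \<eta>) * step_len \<le> (real (level \<tau>) + 1) * step_len + R"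
    using level_le[OF sm y(1)] level_le[OF \<tau> y(2)] by linarith
  also have "\<dots> < (real (level \<tau>) + 2) * step_len"
    using step_len by (simp add: algebra_simps)
  finally have "level \<eta> < level \<tau> + 2"
    using step_len(1) by (simp add: mult_less_cancel_right_pos)
  moreover have "level \<eta> \<noteq> level \<tau>" using ne nodes by auto
  ultimately have l: "level \<eta> = Suc (level \<tau>)" using le by simp
  have "level_class (level \<tau>) (level_class (Suc (level \<tau>)) {branch y}) = level_class (level \<tau>) {branch y}"
  proof -
    have "fellow (real (Suc (level \<tau>)) * step_len - step_len) \<subseteq> fellow (real (level \<tau>) * step_len - step_len)"
      using step_len by (intro fellow_mono) (simp add: algebra_simps)
    from rtrancl_mono[OF this] show ?thesis
      unfolding level_class_def by (auto intro: rtrancl_trans)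
  qed
  then show ?thesis using nodes l by (simp add: parent_def)
qed

text \<open>With l the distance of the level from \<open>p\<close>, points of one node are at most l
  + \<open>step_len\<close> + \<open>R\<close> from \<open>p\<close>, and their Gromov product is at
  least l - \<open>step_len\<close> - (\<open>length \<sigma> ^ 2\<close> + 1) * \<delta>. Their
  distance is the sum of the two distances from \<open>p\<close> minus twice the product, so l
  cancels.\<close>

definition node_diam :: real where
  "node_diam = 4 * step_len + 2 * R + 2 * (real (length \<sigma> ^ 2) + 1) * \<delta>"

lemma node_diam:
  assumes "small \<tau>" "small \<tau>'" "node \<tau> = node \<tau>'" "y \<in> set \<tau>" "y' \<in> set \<tau>'"
  shows "d y y' \<le> node_diam"
proof -
  let ?l = "real (level \<tau>) * step_len" and ?M = "real (length \<sigma> ^ 2)"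
  have l: "level \<tau>' = level \<tau>" using assms by (simp add: node_def)
  have h: "y \<in> geodesic_hull \<sigma>" "y' \<in> geodesic_hull \<sigma>" using assms by (auto simp: small_def)
  have X: "y \<in> X" "y' \<in> X" using h geodesic_hull_X by auto
  note b = branch[OF h(1)] and b' = branch[OF h(2)]
  have "branch y' \<in> level_class (level \<tau>) {branch y}"
    using node_eq[OF assms(1,4)] node_eq[OF assms(2,5)] assms(3) l
    by (auto simp: level_class_def)
  then have "(branch y, branch y') \<in> (fellow (?l - step_len))\<^sup>*"
    by (simp add: level_class_def)
  then have 1: "?l - step_len - ?M * \<delta> \<le> gromov_product d p y (branch y')"
    using level_le[OF assms(1,4)] b step_len X by (intro fellow_class_product) auto
  have "0 \<le> ?M * \<delta>" using delta_nonneg by simp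
  then have 2: "?l - step_len - ?M * \<delta> \<le> gromov_product d p (branch y') y'"
    using level_le(1)[OF assms(2,5)] b' step_len gromov_product_sym[of "branch y'" y' p] X l
    by (simp del: of_nat_power)
  have "?l - step_len - ?M * \<delta> - \<delta> \<le> gromov_product d p y y'"
    using hyperbolic[of p y "branch y'" y'] 1 2 p X b' by auto
  then show ?thesis
    using level_le(2)[OF assms(1,4)] level_le(2)[OF assms(2,5)] l
    by (simp add: gromov_product_def node_diam_def algebra_simps del: of_nat_power)
qed

text \<open>An actual vertex of a tuple at the node serves as centre, so cone points stay in the
  hull of \<open>\<sigma>\<close> and the filling can serve as input in the next degree.\<close>

definition centre :: "nat \<times> 'a set \<Rightarrow> 'a" where
  "centre u = (SOME y. \<exists>\<tau>. small \<tau> \<and> node \<tau> = u \<and> y \<in> set \<tau>)"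

lemma centre:
  assumes "small \<tau>"
  shows "\<exists>\<tau>'. small \<tau>' \<and> node \<tau>' = node \<tau> \<and> centre (node \<tau>) \<in> set \<tau>'"
proof -
  have "\<exists>y. \<exists>\<tau>'. small \<tau>' \<and> node \<tau>' = node \<tau> \<and> y \<in> set \<tau>'"
    using assms by (metis small_def list.set_intros(1) neq_Nil_conv)
  then show ?thesis unfolding centre_def by (rule someI_ex)
qed

lemma centre_geodesic_hull: "small \<tau> \<Longrightarrow> centre (node \<tau>) \<in> geodesic_hull \<sigma>"
  using centre by (auto simp: small_def)

lemma centre_dist: "\<lbrakk>small \<tau>; y \<in> set \<tau>\<rbrakk> \<Longrightarrow> d (centre (node \<tau>)) y \<le> node_diam"
  using centre node_diam by metis

lemma R_le_node_diam: "R \<le> node_diam"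
proof -
  have "0 \<le> (real (length \<sigma> ^ 2) + 1) * \<delta>" using delta_nonneg by simp
  then show ?thesis using R step_len unfolding node_diam_def by linarith
qed

text \<open>This is the linear filling with bounded pieces. The bound \<open>2 \<le> k\<close> keeps
  faces nonempty, so that they have nodes; the factor 2 in the diameter comes from tuples that
  contain the centres of two adjacent nodes.\<close>

lemma geodesic_hull_filling:
  assumes cyc: "chain_boundary z = 0" and k: "2 \<le> k"
    and z: "\<And>\<tau>. \<tau> \<in> Poly_Mapping.keys z \<Longrightarrow>
      length \<tau> = k \<and> set \<tau> \<subseteq> geodesic_hull \<sigma> \<and> (\<forall>x\<in>set \<tau>. \<forall>y\<in>set \<tau>. d x y \<le> R)"
  shows "\<exists>F. chain_boundary F = z \<and> l1_norm F \<le> (1 + real k) * l1_norm z \<and>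
    (\<forall>\<tau>\<in>Poly_Mapping.keys F. length \<tau> = Suc k \<and> set \<tau> \<subseteq> geodesic_hull \<sigma> \<and>
       (\<forall>x\<in>set \<tau>. \<forall>y\<in>set \<tau>. d x y \<le> 2 * node_diam))"
proof (intro exI conjI ballI)
  let ?F = "tree_filling node parent centre z"
  have small: "small \<tau>" if "\<tau> \<in> Poly_Mapping.keys z" for \<tau>
    using z[OF that] k by (auto simp: small_def)
  have face: "length \<tau> = Suc (length \<eta>) \<and> \<eta> \<noteq> [] \<and> set \<eta> \<subseteq> set \<tau>"
    if "\<tau> \<in> Poly_Mapping.keys z" "\<eta> \<in> Poly_Mapping.keys (chain_boundary (frag_of \<tau>))" for \<tau> \<eta>
    using keys_chain_boundary_frag_of[OF that(2)] z[OF that(1)] k by auto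
  have nf: "parent (node \<eta>) = node \<tau> \<and> fst (node \<tau>) < fst (node \<eta>)"
    if "\<tau> \<in> Poly_Mapping.keys z" "\<eta> \<in> Poly_Mapping.keys (chain_boundary (frag_of \<tau>))"
      "node \<eta> \<noteq> node \<tau>" for \<tau> \<eta>
    by (rule node_face[OF small[OF that(1)] _ _ that(3)]) (use face[OF that(1,2)] in auto)
  have "fst (parent u) \<le> fst u" for u by (simp add: parent_def)
  from chain_boundary_tree_filling[where \<alpha> = node and par = parent and lev = fst and ctr = centre, OF cyc nf this]
  show "chain_boundary ?F = z" .
  show "l1_norm ?F \<le> (1 + real k) * l1_norm z"
    by (rule l1_norm_tree_filling) (use z in blast)
  fix \<rho> assume "\<rho> \<in> Poly_Mapping.keys ?F"
  then have "(\<exists>\<tau>\<in>Poly_Mapping.keys z. \<rho> = centre (node \<tau>) # \<tau>) \<or>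
      (\<exists>\<eta>\<in>Poly_Mapping.keys (tree_jump node z). \<rho> = centre (parent (node \<eta>)) # centre (node \<eta>) # \<eta>)"
    unfolding tree_filling_def
    using keys_frag_extend[of "\<lambda>\<tau>. frag_of (centre (node \<tau>) # \<tau>)" z]
      keys_frag_extend[of "\<lambda>\<eta>. frag_of (centre (parent (node \<eta>)) # centre (node \<eta>) # \<eta>)" "tree_jump node z"]
    by (auto dest!: subsetD[OF keys_diff])
  then have "length \<rho> = Suc k \<and> set \<rho> \<subseteq> geodesic_hull \<sigma> \<and> (\<forall>x\<in>set \<rho>. \<forall>y\<in>set \<rho>. d x y \<le> 2 * node_diam)"
  proof (elim disjE bexE)
    fix \<tau> assume \<tau>: "\<tau> \<in> Poly_Mapping.keys z" "\<rho> = centre (node \<tau>) # \<tau>"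
    have sub: "set \<rho> \<subseteq> geodesic_hull \<sigma>" "length \<rho> = Suc k"
      using \<tau> z[OF \<tau>(1)] centre_geodesic_hull[OF small[OF \<tau>(1)]] by auto
    have 1: "d x y \<le> 2 * node_diam" if "x \<in> set \<rho>" "y \<in> set \<tau>" for x y
    proof -
      have "d x y \<le> node_diam"
        using that \<tau> centre_dist[OF small[OF \<tau>(1)]] z[OF \<tau>(1)] R_le_node_diam
        by (auto intro: order_trans[of _ R])
      then show ?thesis using R R_le_node_diam by linarith
    qed
    let ?a = "centre (node \<tau>)"
    have a: "?a \<in> set \<rho>" "?a \<in> X" using \<tau> sub geodesic_hull_X by auto
    have 2: "d ?a ?a \<le> 2 * node_diam"
      using dist_self[OF a(2)] R R_le_node_diam by simp
    have 3: "d ?a y = d y ?a" if "y \<in> set \<tau>" for y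
      using that a sub \<tau> geodesic_hull_X by (intro dist_sym) auto
    have "d x y \<le> 2 * node_diam" if "x \<in> set \<rho>" "y \<in> set \<rho>" for x y
      using that 1 1[of ?a] 2 3 a unfolding \<tau>(2) by auto
    with sub show ?thesis by blast
  next
    fix \<eta> assume \<eta>: "\<eta> \<in> Poly_Mapping.keys (tree_jump node z)"
      "\<rho> = centre (parent (node \<eta>)) # centre (node \<eta>) # \<eta>"
    obtain \<tau> where \<tau>: "\<tau> \<in> Poly_Mapping.keys z" "\<eta> \<in> Poly_Mapping.keys (chain_boundary (frag_of \<tau>))"
        "node \<eta> \<noteq> node \<tau>"
      using keys_tree_jump[OF \<eta>(1)] by auto
    note fc = face[OF \<tau>(1,2)] and s\<tau> = small[OF \<tau>(1)]
    have s\<eta>: "small \<eta>" using fc s\<tau> by (auto simp: small_def)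
    have par: "parent (node \<eta>) = node \<tau>"
      using node_face[OF s\<tau> _ _ \<tau>(3)] fc by blast
    let ?a = "centre (node \<tau>)" and ?b = "centre (node \<eta>)"
    have sub: "set \<rho> \<subseteq> geodesic_hull \<sigma>" "length \<rho> = Suc k"
      using \<eta> fc z[OF \<tau>(1)] centre_geodesic_hull[OF s\<tau>] centre_geodesic_hull[OF s\<eta>] par by auto
    have X: "?a \<in> X" "?b \<in> X" "set \<eta> \<subseteq> X"
      using centre_geodesic_hull[OF s\<tau>] centre_geodesic_hull[OF s\<eta>] sub \<eta> geodesic_hull_X by auto
    have a: "d ?a y \<le> node_diam" and b: "d ?b y \<le> node_diam" if "y \<in> set \<eta>" for y
      using centre_dist[OF s\<tau>, of y] centre_dist[OF s\<eta>, of y] fc that by auto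
    obtain y0 where y0: "y0 \<in> set \<eta>" using fc by (cases \<eta>) auto
    \<comment> \<open>The face \<open>\<eta>\<close> is near both centres: it sits at its own node,
      and its vertices belong to \<open>\<tau>\<close>, which sits at the parent.\<close>
    have ab: "d ?a ?b \<le> 2 * node_diam"
      using dist_triangle[of ?a y0 ?b] dist_sym[of y0 ?b] a[OF y0] b[OF y0] X y0 by auto
    have pos: "0 \<le> node_diam" using R_le_node_diam R by simp
    have e: "d x y \<le> 2 * node_diam" if "x \<in> set \<eta>" "y \<in> set \<eta>" for x y
    proof -
      have "d x y \<le> R" using s\<eta> that by (auto simp: small_def)
      then show ?thesis using pos R_le_node_diam by linarith
    qed
    have a': "d ?a y \<le> 2 * node_diam" "d y ?a \<le> 2 * node_diam"
      and b': "d ?b y \<le> 2 * node_diam" "d y ?b \<le> 2 * node_diam" if "y \<in> set \<eta>" for y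
      using a[OF that] b[OF that] pos X that dist_sym[of y ?a] dist_sym[of y ?b] by auto
    have "d ?a ?a \<le> 2 * node_diam" "d ?b ?b \<le> 2 * node_diam" "d ?b ?a \<le> 2 * node_diam"
      using dist_self[of ?a] dist_self[of ?b] dist_sym[of ?a ?b] ab pos X by auto
    then have "d x y \<le> 2 * node_diam" if "x \<in> set \<rho>" "y \<in> set \<rho>" for x y
      using that a' b' e ab unfolding \<eta>(2) par by auto
    with sub show ?thesis by blast
  qed
  then show "length \<rho> = Suc k" "set \<rho> \<subseteq> geodesic_hull \<sigma>"
    and "x \<in> set \<rho> \<Longrightarrow> y \<in> set \<rho> \<Longrightarrow> d x y \<le> 2 * node_diam" for x y
    by auto
qed

end

end

section \<open>Word metrics and the controlled chain map\<close>

definition translate :: "('g, 'x) monoid_scheme \<Rightarrow> 'g \<Rightarrow> ('g list \<Rightarrow>\<^sub>0 int) \<Rightarrow> ('g list \<Rightarrow>\<^sub>0 int)" where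
  "translate G g = frag_extend (\<lambda>\<sigma>. frag_of (map ((\<otimes>\<^bsub>G\<^esub>) g) \<sigma>))"

definition tuples :: "('g, 'x) monoid_scheme \<Rightarrow> nat \<Rightarrow> 'g list set" where
  "tuples G n = {\<sigma>. length \<sigma> = n \<and> set \<sigma> \<subseteq> carrier G}"

text \<open>The representative starting at the unit of the orbit of \<open>\<sigma>\<close>. The
  action on nonempty tuples is free, so an equivariant map can be prescribed arbitrarily on these
  representatives.\<close>

definition root_tuple :: "('g, 'x) monoid_scheme \<Rightarrow> 'g list \<Rightarrow> 'g list" where
  "root_tuple G \<sigma> = map ((\<otimes>\<^bsub>G\<^esub>) (inv\<^bsub>G\<^esub> hd \<sigma>)) \<sigma>"

lemma translate_simps [simp]:
  "translate G g 0 = 0" "translate G g (frag_of \<sigma>) = frag_of (map ((\<otimes>\<^bsub>G\<^esub>) g) \<sigma>)"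
  by (simp_all add: translate_def)

lemma translate_diff: "translate G g (a - b) = translate G g a - translate G g b"
  by (simp add: translate_def frag_extend_diff)

lemma translate_extend:
  "translate G g (frag_extend f c) = frag_extend (\<lambda>\<sigma>. translate G g (f \<sigma>)) c"
  by (simp add: translate_def frag_extend_frag_extend)

lemma extend_translate:
  "frag_extend f (translate G g c) = frag_extend (\<lambda>\<sigma>. f (map ((\<otimes>\<^bsub>G\<^esub>) g) \<sigma>)) c"
  by (simp add: translate_def frag_extend_frag_extend)

lemma translate_chain_cone: "translate G g (chain_cone x c) = chain_cone (g \<otimes>\<^bsub>G\<^esub> x) (translate G g c)"
  by (simp add: translate_def chain_cone_def frag_extend_frag_extend)

lemma chain_boundary_translate: "chain_boundary (translate G g c) = translate G g (chain_boundary c)"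
proof -
  have "chain_boundary (frag_of (map ((\<otimes>\<^bsub>G\<^esub>) g) \<sigma>)) = translate G g (chain_boundary (frag_of \<sigma>))" for \<sigma>
    by (induction \<sigma>) (simp_all add: chain_boundary_Cons translate_diff translate_chain_cone)
  then show ?thesis
    unfolding extend_chain_boundary[of _ c, folded translate_extend] translate_def[of G g]
    by (simp add: chain_boundary_extend flip: extend_chain_boundary)
qed

lemma keys_translate: "Poly_Mapping.keys (translate G g c) \<subseteq> map ((\<otimes>\<^bsub>G\<^esub>) g) ` Poly_Mapping.keys c"
  using keys_frag_extend[of "\<lambda>\<sigma>. frag_of (map ((\<otimes>\<^bsub>G\<^esub>) g) \<sigma>)" c] by (auto simp: translate_def)

lemma l1_norm_translate_le: "l1_norm (translate G g c) \<le> l1_norm c"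
  using l1_norm_extend_le_const[of c "\<lambda>\<sigma>. frag_of (map ((\<otimes>\<^bsub>G\<^esub>) g) \<sigma>)" 1] by (simp add: translate_def)

lemma tuples_map: "\<lbrakk>group G; g \<in> carrier G; \<sigma> \<in> tuples G n\<rbrakk> \<Longrightarrow> map ((\<otimes>\<^bsub>G\<^esub>) g) \<sigma> \<in> tuples G n"
  by (auto simp: tuples_def intro: group.is_monoid monoid.m_closed)

lemma tuples_face:
  "\<lbrakk>\<sigma> \<in> tuples G (Suc n); \<eta> \<in> Poly_Mapping.keys (chain_boundary (frag_of \<sigma>))\<rbrakk> \<Longrightarrow> \<eta> \<in> tuples G n"
  using keys_chain_boundary_frag_of[of \<eta> \<sigma>] by (auto simp: tuples_def)

lemma hd_tuples: "\<sigma> \<in> tuples G (Suc n) \<Longrightarrow> hd \<sigma> \<in> carrier G"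
  by (cases \<sigma>) (auto simp: tuples_def)

section \<open>Translations of tuples and products of words\<close>

context group
begin

lemma inv_mult_cancel:
  "\<lbrakk>g \<in> carrier G; y \<in> carrier G\<rbrakk> \<Longrightarrow> inv g \<otimes> (g \<otimes> y) = y"
  "\<lbrakk>g \<in> carrier G; y \<in> carrier G\<rbrakk> \<Longrightarrow> g \<otimes> (inv g \<otimes> y) = y"
  by (simp_all flip: m_assoc)

lemma map_mult_mult:
  "\<lbrakk>g \<in> carrier G; h \<in> carrier G; set \<sigma> \<subseteq> carrier G\<rbrakk> \<Longrightarrow>
   map ((\<otimes>) g) (map ((\<otimes>) h) \<sigma>) = map ((\<otimes>) (g \<otimes> h)) \<sigma>"
  by (auto simp: m_assoc)

lemma map_mult_one: "set \<sigma> \<subseteq> carrier G \<Longrightarrow> map ((\<otimes>) \<one>) \<sigma> = \<sigma>"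
  by (intro map_idI) auto

lemma translate_translate:
  assumes "g \<in> carrier G" "h \<in> carrier G" "\<And>\<sigma>. \<sigma> \<in> Poly_Mapping.keys c \<Longrightarrow> set \<sigma> \<subseteq> carrier G"
  shows "translate G g (translate G h c) = translate G (g \<otimes> h) c"
  unfolding translate_def[of G h] translate_extend translate_def[of G "g \<otimes> h"]
  using assms by (intro frag_extend_eq) (simp del: map_map add: map_mult_mult)

lemma root_tuple_in: "\<sigma> \<in> tuples G (Suc n) \<Longrightarrow> root_tuple G \<sigma> \<in> tuples G (Suc n)"
  unfolding root_tuple_def by (intro tuples_map inv_closed hd_tuples) (auto intro: is_group)

lemma map_root_tuple:
  assumes "\<sigma> \<in> tuples G (Suc n)"
  shows "map ((\<otimes>) (hd \<sigma>)) (root_tuple G \<sigma>) = \<sigma>"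
  using assms hd_tuples[OF assms] map_mult_mult[of "hd \<sigma>" "inv (hd \<sigma>)" \<sigma>]
  by (simp add: root_tuple_def tuples_def map_mult_one del: map_map)

lemma root_tuple_map:
  assumes "\<sigma> \<in> tuples G (Suc n)" "g \<in> carrier G"
  shows "root_tuple G (map ((\<otimes>) g) \<sigma>) = root_tuple G \<sigma>"
proof -
  have h: "hd (map ((\<otimes>) g) \<sigma>) = g \<otimes> hd \<sigma>"
    using assms by (intro hd_map) (auto simp: tuples_def)
  have "inv (g \<otimes> hd \<sigma>) \<otimes> g = inv (hd \<sigma>)"
    using assms hd_tuples[OF assms(1)] by (simp add: inv_mult_group m_assoc)
  then show ?thesis
    using assms hd_tuples[OF assms(1)] map_mult_mult[of "inv (g \<otimes> hd \<sigma>)" g \<sigma>]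
    by (simp add: root_tuple_def h tuples_def del: map_map)
qed

definition word_prod :: "'a list \<Rightarrow> 'a" where
  "word_prod w = foldr (\<otimes>) w \<one>"

lemma word_prod_simps [simp]: "word_prod [] = \<one>" "word_prod (a # w) = a \<otimes> word_prod w"
  by (simp_all add: word_prod_def)

lemma word_prod_closed [simp]: "set w \<subseteq> carrier G \<Longrightarrow> word_prod w \<in> carrier G"
  by (induction w) auto

lemma word_prod_append:
  "\<lbrakk>set u \<subseteq> carrier G; set v \<subseteq> carrier G\<rbrakk> \<Longrightarrow> word_prod (u @ v) = word_prod u \<otimes> word_prod v"
  by (induction u) (auto simp: m_assoc)

lemma word_prod_rev_inv:
  "set w \<subseteq> carrier G \<Longrightarrow> word_prod (rev (map (\<lambda>s. inv s) w)) = inv (word_prod w)"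
proof (induction w)
  case (Cons a w)
  then have "set (rev (map (\<lambda>s. inv s) w)) \<subseteq> carrier G" by auto
  with Cons show ?case by (simp add: word_prod_append inv_mult_group)
qed simp

end

section \<open>Word length, word metric and diameters of tuples\<close>

locale word_metric_group = group G for G (structure) +
  fixes S :: "'a set"
  assumes generating: "finite_generating_set G S"
begin

abbreviation "len \<equiv> word_length G S"
abbreviation "wd \<equiv> word_dist G S"
definition letters :: "'a set" where "letters = S \<union> (\<lambda>s. inv s) ` S"

lemma letters_closed: "letters \<subseteq> carrier G"
  using generating by (auto simp: finite_generating_set_def letters_def)

lemma word_closed: "set w \<subseteq> letters \<Longrightarrow> set w \<subseteq> carrier G"
  using letters_closed by (rule subset_trans[rotated])

lemma inv_letters: "s \<in> letters \<Longrightarrow> inv s \<in> letters"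
  using generating by (auto simp: finite_generating_set_def letters_def)

lemma word_exists:
  assumes "g \<in> carrier G" shows "\<exists>w. set w \<subseteq> letters \<and> word_prod w = g"
proof -
  have "g \<in> generate G S" using assms generating by (simp add: finite_generating_set_def)
  then show ?thesis
  proof induction
    case one show ?case by (intro exI[of _ "[]"]) simp
  next
    case (incl h)
    then have "h \<in> letters" by (simp add: letters_def)
    moreover from this have "h \<in> carrier G" using letters_closed by blast
    ultimately show ?case by (intro exI[of _ "[h]"]) simp
  next
    case (inv h)
    then have "inv h \<in> letters" by (simp add: letters_def)
    moreover from this have "inv h \<in> carrier G" using letters_closed by blast
    ultimately show ?case by (intro exI[of _ "[inv h]"]) simp
  next
    case (eng g h)
    obtain u where u: "set u \<subseteq> letters" "word_prod u = g" using eng.IH(1) by (elim exE conjE)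
    obtain v where v: "set v \<subseteq> letters" "word_prod v = h" using eng.IH(2) by (elim exE conjE)
    have "word_prod (u @ v) = g \<otimes> h"
      using word_prod_append[OF word_closed[OF u(1)] word_closed[OF v(1)]] by (simp only: u v)
    moreover have "set (u @ v) \<subseteq> letters" using u(1) v(1) by simp
    ultimately show ?case by (intro exI[of _ "u @ v"] conjI)
  qed
qed

lemma len_le: "set w \<subseteq> letters \<Longrightarrow> len (word_prod w) \<le> length w"
  unfolding word_length_def word_prod_def letters_def by (rule Least_le) auto

lemma geodesic_word:
  assumes "g \<in> carrier G"
  obtains w where "set w \<subseteq> letters" "word_prod w = g" "length w = len g"
proof -
  obtain w where w: "set w \<subseteq> letters" "word_prod w = g" using word_exists[OF assms] by (elim exE conjE)
  have "\<exists>n w. length w = n \<and> set w \<subseteq> S \<union> (\<lambda>s. inv s) ` S \<and> foldr (\<otimes>) w \<one> = g"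
    using w unfolding letters_def word_prod_def by (intro exI conjI) (rule refl)
  from LeastI_ex[OF this]
  have "\<exists>w. length w = len g \<and> set w \<subseteq> letters \<and> word_prod w = g"
    unfolding word_length_def letters_def word_prod_def .
  then show thesis using that by (elim exE conjE)
qed

lemma len_one [simp]: "len \<one> = 0"
  using len_le[of "[]"] by simp

lemma len_mult_le:
  assumes "g \<in> carrier G" "h \<in> carrier G"
  shows "len (g \<otimes> h) \<le> len g + len h"
proof -
  obtain u where u: "set u \<subseteq> letters" "word_prod u = g" "length u = len g"
    by (rule geodesic_word[OF assms(1)])
  obtain v where v: "set v \<subseteq> letters" "word_prod v = h" "length v = len h"
    by (rule geodesic_word[OF assms(2)])
  show ?thesis
    using u v len_le[of "u @ v"] word_closed[OF u(1)] word_closed[OF v(1)] by (simp add: word_prod_append)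
qed

lemma len_inv_le:
  assumes "g \<in> carrier G" shows "len (inv g) \<le> len g"
proof -
  obtain u where u: "set u \<subseteq> letters" "word_prod u = g" "length u = len g"
    by (rule geodesic_word[OF assms])
  have "inv s \<in> letters" if "s \<in> set u" for s
    using inv_letters[OF subsetD[OF u(1) that]] .
  then have "set (rev (map (\<lambda>s. inv s) u)) \<subseteq> letters" by auto
  from len_le[OF this] show ?thesis
    unfolding word_prod_rev_inv[OF word_closed[OF u(1)]] u(2) by (simp add: u(3))
qed

lemma len_inv: "g \<in> carrier G \<Longrightarrow> len (inv g) = len g"
  using len_inv_le[of g] len_inv_le[of "inv g"] by simp

lemma wd_self: "x \<in> carrier G \<Longrightarrow> wd x x = 0"
  by (simp add: word_dist_def)

lemma wd_nonneg: "0 \<le> wd x y"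
  by (simp add: word_dist_def)

lemma wd_sym: "\<lbrakk>x \<in> carrier G; y \<in> carrier G\<rbrakk> \<Longrightarrow> wd x y = wd y x"
  using len_inv[of "inv x \<otimes> y"] by (simp add: word_dist_def inv_mult_group)

lemma wd_triangle:
  assumes "x \<in> carrier G" "y \<in> carrier G" "z \<in> carrier G"
  shows "wd x z \<le> wd x y + wd y z"
proof -
  have "inv x \<otimes> z = (inv x \<otimes> y) \<otimes> (inv y \<otimes> z)"
    using assms by (simp add: m_assoc inv_mult_cancel)
  then show ?thesis
    using len_mult_le[of "inv x \<otimes> y" "inv y \<otimes> z"] assms by (simp add: word_dist_def)
qed

lemma wd_translate:
  assumes "g \<in> carrier G" "x \<in> carrier G" "y \<in> carrier G"
  shows "wd (g \<otimes> x) (g \<otimes> y) = wd x y"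
proof -
  have "inv (g \<otimes> x) \<otimes> (g \<otimes> y) = inv x \<otimes> y"
    using assms by (simp add: inv_mult_group m_assoc inv_mult_cancel)
  then show ?thesis using assms by (simp add: word_dist_def)
qed

text \<open>There are finitely many words of bounded length over a finite alphabet. This is the
  source of finite type: up to translation there are only finitely many tuples of given length and
  bounded diameter.\<close>

lemma finite_ball: "finite {g \<in> carrier G. len g \<le> n}"
proof (rule finite_subset)
  show "{g \<in> carrier G. len g \<le> n} \<subseteq> word_prod ` {w. set w \<subseteq> letters \<and> length w \<le> n}"
  proof
    fix g assume g: "g \<in> {g \<in> carrier G. len g \<le> n}"
    then have "g \<in> carrier G" by simp
    then obtain w where "set w \<subseteq> letters" "word_prod w = g" "length w = len g"
      by (rule geodesic_word)
    then show "g \<in> word_prod ` {w. set w \<subseteq> letters \<and> length w \<le> n}"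
      using g by (intro image_eqI[of _ _ w]) simp_all
  qed
  show "finite (word_prod ` {w. set w \<subseteq> letters \<and> length w \<le> n})"
    using generating by (intro finite_imageI finite_lists_length_le) (simp add: finite_generating_set_def letters_def)
qed

abbreviation "diam \<equiv> tuple_diam G S"

lemma wd_le_diam: "\<lbrakk>x \<in> set \<sigma>; y \<in> set \<sigma>\<rbrakk> \<Longrightarrow> wd x y \<le> diam \<sigma>"
  unfolding tuple_diam_def by (rule Max_ge) auto

lemma diam_leI:
  assumes "\<sigma> \<noteq> []" "\<And>x y. x \<in> set \<sigma> \<Longrightarrow> y \<in> set \<sigma> \<Longrightarrow> wd x y \<le> c"
  shows "diam \<sigma> \<le> c"
  unfolding tuple_diam_def using assms by (subst Max_le_iff) auto

lemma diam_nonneg: "\<sigma> \<noteq> [] \<Longrightarrow> 0 \<le> diam \<sigma>"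
  using wd_le_diam[of "hd \<sigma>" \<sigma> "hd \<sigma>"] wd_nonneg[of "hd \<sigma>" "hd \<sigma>"] by simp

lemma diam_mono: "\<lbrakk>\<eta> \<noteq> []; set \<eta> \<subseteq> set \<sigma>\<rbrakk> \<Longrightarrow> diam \<eta> \<le> diam \<sigma>"
  by (rule diam_leI) (auto intro: wd_le_diam)

lemma diam_translate:
  assumes "g \<in> carrier G" "set \<sigma> \<subseteq> carrier G"
  shows "diam (map ((\<otimes>) g) \<sigma>) = diam \<sigma>"
proof -
  have "(\<lambda>(x, y). wd x y) ` (set (map ((\<otimes>) g) \<sigma>) \<times> set (map ((\<otimes>) g) \<sigma>)) =
      (\<lambda>(x, y). wd (g \<otimes> x) (g \<otimes> y)) ` (set \<sigma> \<times> set \<sigma>)" by force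
  also have "\<dots> = (\<lambda>(x, y). wd x y) ` (set \<sigma> \<times> set \<sigma>)"
    using assms by (intro image_cong refl) (auto intro!: wd_translate)
  finally show ?thesis by (simp add: tuple_diam_def)
qed

primrec path_chain :: "'a \<Rightarrow> 'a list \<Rightarrow> ('a list \<Rightarrow>\<^sub>0 int)" where
  "path_chain x [] = 0"
| "path_chain x (s # w) = frag_of [x, x \<otimes> s] + path_chain (x \<otimes> s) w"

lemma chain_boundary_path_chain:
  "\<lbrakk>x \<in> carrier G; set w \<subseteq> carrier G\<rbrakk> \<Longrightarrow>
   chain_boundary (path_chain x w) = frag_of [x \<otimes> word_prod w] - frag_of [x]"
  by (induction w arbitrary: x) (auto simp: chain_boundary_add chain_boundary_Cons m_assoc)

lemma l1_norm_path_chain: "l1_norm (path_chain x w) \<le> length w"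
proof (induction w arbitrary: x)
  case (Cons s w)
  have "l1_norm (path_chain (x \<otimes> s) w) \<le> length w" by (rule Cons)
  then show ?case
    using l1_norm_add_le[of "frag_of [x, x \<otimes> s]" "path_chain (x \<otimes> s) w"] by simp
qed simp

lemma keys_path_chain:
  "\<lbrakk>x \<in> carrier G; set w \<subseteq> carrier G; \<tau> \<in> Poly_Mapping.keys (path_chain x w)\<rbrakk> \<Longrightarrow>
   \<exists>u s v. w = u @ s # v \<and> \<tau> = [x \<otimes> word_prod u, x \<otimes> word_prod u \<otimes> s]"
proof (induction w arbitrary: x)
  case (Cons s w)
  from Cons.prems consider "\<tau> = [x, x \<otimes> s]" | "\<tau> \<in> Poly_Mapping.keys (path_chain (x \<otimes> s) w)"
    using keys_add[of "frag_of [x, x \<otimes> s]" "path_chain (x \<otimes> s) w"] by auto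
  then show ?case
  proof cases
    case 1
    then show ?thesis using Cons.prems by (intro exI[of _ "[]"] exI[of _ s] exI[of _ w]) auto
  next
    case 2
    then obtain u t v where u: "w = u @ t # v"
        "\<tau> = [x \<otimes> s \<otimes> word_prod u, x \<otimes> s \<otimes> word_prod u \<otimes> t]"
      using Cons.IH[of "x \<otimes> s"] Cons.prems by auto
    then show ?thesis using Cons.prems
      by (intro exI[of _ "s # u"] exI[of _ t] exI[of _ v]) (auto simp: m_assoc)
  qed
qed simp

end

section \<open>Equivariant chain maps with tuples of bounded diameter\<close>

locale hyperbolic_word_group = word_metric_group +
  fixes \<delta> :: real
  assumes \<delta>: "0 \<le> \<delta>"
    and hyp: "\<lbrakk>w \<in> carrier G; x \<in> carrier G; y \<in> carrier G; z \<in> carrier G\<rbrakk> \<Longrightarrow>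
      min (gromov_product wd w x y) (gromov_product wd w y z) - \<delta> \<le> gromov_product wd w x z"
begin

sublocale gromov_space "carrier G" wd \<delta>
  using wd_self wd_sym wd_triangle \<delta> hyp by unfold_locales auto

lemma geodesic_hull_translate:
  assumes "g \<in> carrier G" "set \<sigma> \<subseteq> carrier G" "y \<in> geodesic_hull \<sigma>"
  shows "g \<otimes> y \<in> geodesic_hull (map ((\<otimes>) g) \<sigma>)"
proof -
  obtain a b where ab: "y \<in> carrier G" "a \<in> set \<sigma>" "b \<in> set \<sigma>" "gromov_product wd y a b \<le> 0"
    using assms by (auto simp: geodesic_hull_def)
  then have "gromov_product wd (g \<otimes> y) (g \<otimes> a) (g \<otimes> b) = gromov_product wd y a b"
    using assms wd_translate[OF assms(1)] by (simp add: gromov_product_def subset_eq)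
  then show ?thesis
    using ab assms unfolding geodesic_hull_def by (intro CollectI conjI bexI[of _ "g \<otimes> a"] bexI[of _ "g \<otimes> b"]) auto
qed

text \<open>Single tuples of \<open>c\<close> have size at most \<open>R\<close>, while all of them
  together may spread over the whole hull of \<open>\<sigma>\<close>. The hull condition is what
  lets the tree of \<open>\<sigma>\<close> organise them in the next degree.\<close>

definition controlled :: "nat \<Rightarrow> real \<Rightarrow> 'a list \<Rightarrow> ('a list \<Rightarrow>\<^sub>0 int) \<Rightarrow> bool" where
  "controlled n R \<sigma> c \<longleftrightarrow> (\<forall>\<tau>\<in>Poly_Mapping.keys c. length \<tau> = n \<and> set \<tau> \<subseteq> geodesic_hull \<sigma> \<and>
     (\<forall>x\<in>set \<tau>. \<forall>y\<in>set \<tau>. wd x y \<le> R))"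

lemma controlled_translate:
  assumes "g \<in> carrier G" "set \<sigma> \<subseteq> carrier G" "controlled n R \<sigma> c"
  shows "controlled n R (map ((\<otimes>) g) \<sigma>) (translate G g c)"
  unfolding controlled_def
proof
  fix \<rho> assume "\<rho> \<in> Poly_Mapping.keys (translate G g c)"
  then obtain \<tau> where \<tau>: "\<rho> = map ((\<otimes>) g) \<tau>" "\<tau> \<in> Poly_Mapping.keys c"
    using keys_translate by fast
  then have c: "length \<tau> = n" "set \<tau> \<subseteq> geodesic_hull \<sigma>" "\<And>x y. \<lbrakk>x \<in> set \<tau>; y \<in> set \<tau>\<rbrakk> \<Longrightarrow> wd x y \<le> R"
    using assms by (auto simp: controlled_def)
  have "set \<tau> \<subseteq> carrier G" using c(2) by (auto simp: geodesic_hull_def)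
  then show "length \<rho> = n \<and> set \<rho> \<subseteq> geodesic_hull (map ((\<otimes>) g) \<sigma>) \<and> (\<forall>x\<in>set \<rho>. \<forall>y\<in>set \<rho>. wd x y \<le> R)"
    using c \<tau> geodesic_hull_translate[OF assms(1,2)] wd_translate[OF assms(1)] by (auto simp: subset_eq)
qed

text \<open>The number \<open>n\<close> counts vertices, so the degree is \<open>n - 1\<close>. The
  constants are uniform over all tuples with \<open>n\<close> vertices.\<close>

definition controlled_map :: "nat \<Rightarrow> ('a list \<Rightarrow> ('a list \<Rightarrow>\<^sub>0 int)) \<Rightarrow> bool" where
  "controlled_map n f \<longleftrightarrow>
     (\<forall>\<sigma>\<in>tuples G n. \<forall>g\<in>carrier G. f (map ((\<otimes>) g) \<sigma>) = translate G g (f \<sigma>)) \<and>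
     (\<exists>R\<ge>0. \<exists>C\<ge>0. \<forall>\<sigma>\<in>tuples G n. controlled n R \<sigma> (f \<sigma>) \<and> l1_norm (f \<sigma>) \<le> C * (1 + diam \<sigma>))"

text \<open>A geodesic word from \<open>x\<close> to \<open>y\<close> gives a path of edges of
  length at most 1, as many as the distance, which the diameter bounds. Splitting the word at any
  place exhibits the vertex there as a point of the hull.\<close>

lemma edge_filling:
  assumes "\<sigma> \<in> tuples G 2"
  shows "\<exists>c. chain_boundary c = chain_boundary (frag_of \<sigma>) \<and> controlled 2 1 \<sigma> c \<and> l1_norm c \<le> 1 + diam \<sigma>"
proof -
  obtain x y where xy: "\<sigma> = [x, y]" "x \<in> carrier G" "y \<in> carrier G"
    using assms by (auto simp: tuples_def numeral_2_eq_2 length_Suc_conv)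
  obtain w where w: "set w \<subseteq> letters" "word_prod w = inv x \<otimes> y" "length w = len (inv x \<otimes> y)"
    by (rule geodesic_word[of "inv x \<otimes> y"]) (use xy in auto)
  have wG: "set w \<subseteq> carrier G" using word_closed[OF w(1)] .
  have xw: "x \<otimes> word_prod w = y" using xy w by (simp flip: m_assoc)
  have on_geodesic: "x \<otimes> word_prod u \<in> geodesic_hull \<sigma>" if "w = u @ v" for u v
  proof -
    let ?p = "x \<otimes> word_prod u"
    have uv: "set u \<subseteq> letters" "set v \<subseteq> letters" "set u \<subseteq> carrier G" "set v \<subseteq> carrier G"
      using w wG that by auto
    have "inv x \<otimes> ?p = word_prod u" using xy uv by (simp flip: m_assoc)
    then have 1: "wd x ?p \<le> length u" using len_le[OF uv(1)] by (simp add: word_dist_def)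
    have "inv ?p \<otimes> y = word_prod v"
      using xy(2) uv that by (simp add: word_prod_append inv_mult_group m_assoc inv_mult_cancel flip: xw)
    then have 2: "wd ?p y \<le> length v" using len_le[OF uv(2)] by (simp add: word_dist_def)
    \<comment> \<open>Here it matters that \<open>w\<close> is geodesic: the bounds for the two
      halves add up to exactly the distance, so the Gromov product at \<open>?p\<close> is at most
      0.\<close>
    have "wd x y = length u + length v" using w that by (simp add: word_dist_def)
    then have "gromov_product wd ?p x y \<le> 0"
      using 1 2 wd_sym[of x ?p] xy uv by (simp add: gromov_product_def)
    then show ?thesis using xy uv by (auto simp: geodesic_hull_def)
  qed
  show ?thesis
  proof (intro exI conjI)
    show "chain_boundary (path_chain x w) = chain_boundary (frag_of \<sigma>)"
      using chain_boundary_path_chain[OF xy(2) wG] xw xy by (simp add: chain_boundary_Cons)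
    have "real (length w) = wd x y" using w by (simp add: word_dist_def)
    also have "\<dots> \<le> diam \<sigma>" using xy by (intro wd_le_diam) auto
    finally show "l1_norm (path_chain x w) \<le> 1 + diam \<sigma>"
      using l1_norm_path_chain[of x w] by simp
    show "controlled 2 1 \<sigma> (path_chain x w)"
      unfolding controlled_def
    proof
      fix \<tau> assume "\<tau> \<in> Poly_Mapping.keys (path_chain x w)"
      then obtain u s v where \<tau>: "w = u @ s # v" "\<tau> = [x \<otimes> word_prod u, x \<otimes> word_prod u \<otimes> s]"
        using keys_path_chain[OF xy(2) wG] by blast
      have s: "set u \<subseteq> carrier G" "s \<in> carrier G" "s \<in> letters" using w wG \<tau> by auto
      let ?a = "x \<otimes> word_prod u" and ?b = "x \<otimes> word_prod u \<otimes> s"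
      have b: "?b = x \<otimes> word_prod (u @ [s])" using s xy by (simp add: word_prod_append m_assoc)
      have "?a \<in> geodesic_hull \<sigma>" "?b \<in> geodesic_hull \<sigma>"
        using on_geodesic[of u "s # v"] on_geodesic[of "u @ [s]" v] b \<tau> by auto
      moreover have G: "?a \<in> carrier G" "?b \<in> carrier G" using s xy by auto
      moreover have "inv ?a \<otimes> ?b = s" using G(1) s(2) by (rule inv_mult_cancel)
      then have "wd ?a ?b \<le> 1" using len_le[of "[s]"] s by (simp add: word_dist_def)
      ultimately show "length \<tau> = 2 \<and> set \<tau> \<subseteq> geodesic_hull \<sigma> \<and> (\<forall>x\<in>set \<tau>. \<forall>y\<in>set \<tau>. wd x y \<le> 1)"
        using \<tau> wd_self[OF G(1)] wd_self[OF G(2)] wd_sym[OF G] by auto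
    qed
  qed
qed

text \<open>Fillings are chosen for arbitrary tuples, but only those of root tuples are used and
  transported by translation. This forces equivariance, and translations preserve hulls, sizes and
  norms.\<close>

lemma controlled_map_extend:
  assumes n: "1 \<le> n" and f: "controlled_map n f"
    and cyc: "\<And>\<sigma>. \<sigma> \<in> tuples G (Suc n) \<Longrightarrow>
      chain_boundary (frag_extend f (chain_boundary (frag_of \<sigma>))) = 0"
    and fill: "\<exists>R\<ge>0. \<exists>C\<ge>0. \<forall>\<sigma>\<in>tuples G (Suc n). \<exists>c.
      chain_boundary c = frag_extend f (chain_boundary (frag_of \<sigma>)) \<and>
      controlled (Suc n) R \<sigma> c \<and> l1_norm c \<le> C * (1 + diam \<sigma>)"
  shows "\<exists>f'. controlled_map (Suc n) f' \<and>
    (\<forall>\<sigma>\<in>tuples G (Suc n). chain_boundary (f' \<sigma>) = frag_extend f (chain_boundary (frag_of \<sigma>)))"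
proof -
  obtain R C where R: "0 \<le> R" "0 \<le> C" and "\<forall>\<sigma>\<in>tuples G (Suc n). \<exists>c.
      chain_boundary c = frag_extend f (chain_boundary (frag_of \<sigma>)) \<and>
      controlled (Suc n) R \<sigma> c \<and> l1_norm c \<le> C * (1 + diam \<sigma>)"
    using fill by auto
  then obtain F where F: "\<And>\<sigma>. \<sigma> \<in> tuples G (Suc n) \<Longrightarrow>
      chain_boundary (F \<sigma>) = frag_extend f (chain_boundary (frag_of \<sigma>)) \<and>
      controlled (Suc n) R \<sigma> (F \<sigma>) \<and> l1_norm (F \<sigma>) \<le> C * (1 + diam \<sigma>)"
    by metis
  \<comment> \<open>A translate of \<open>\<sigma>\<close> has the same root tuple and a translated
    first vertex, so equivariance is built in.\<close>
  define f' where "f' \<sigma> = translate G (hd \<sigma>) (F (root_tuple G \<sigma>))" for \<sigma>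
  have equiv: "f \<eta> = translate G g (f \<rho>)" if "g \<in> carrier G" "\<rho> \<in> tuples G n" "\<eta> = map ((\<otimes>) g) \<rho>" for g \<rho> \<eta>
    using f that by (auto simp: controlled_map_def)
  have keysF: "set \<tau> \<subseteq> carrier G" if "\<sigma> \<in> tuples G (Suc n)" "\<tau> \<in> Poly_Mapping.keys (F \<sigma>)" for \<sigma> \<tau>
    using F[OF that(1)] that(2) by (auto simp: controlled_def geodesic_hull_def)
  show ?thesis
  proof (intro exI[of _ f'] conjI ballI)
    fix \<sigma> assume \<sigma>: "\<sigma> \<in> tuples G (Suc n)"
    let ?g = "hd \<sigma>" and ?\<rho> = "root_tuple G \<sigma>"
    have g: "?g \<in> carrier G" and \<rho>: "?\<rho> \<in> tuples G (Suc n)" "map ((\<otimes>) ?g) ?\<rho> = \<sigma>"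
      using hd_tuples[OF \<sigma>] root_tuple_in[OF \<sigma>] map_root_tuple[OF \<sigma>] by auto
    have "chain_boundary (f' \<sigma>) = translate G ?g (frag_extend f (chain_boundary (frag_of ?\<rho>)))"
      using F[OF \<rho>(1)] by (simp add: f'_def chain_boundary_translate)
    also have "\<dots> = frag_extend f (translate G ?g (chain_boundary (frag_of ?\<rho>)))"
      unfolding translate_extend extend_translate
      by (rule frag_extend_eq) (use equiv[OF g] tuples_face[OF \<rho>(1)] in auto)
    also have "translate G ?g (chain_boundary (frag_of ?\<rho>)) = chain_boundary (frag_of \<sigma>)"
      using \<rho>(2) by (simp flip: chain_boundary_translate)
    finally show "chain_boundary (f' \<sigma>) = frag_extend f (chain_boundary (frag_of \<sigma>))" .
  next
    have ctrl: "controlled (Suc n) R \<sigma> (f' \<sigma>) \<and> l1_norm (f' \<sigma>) \<le> C * (1 + diam \<sigma>)"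
      if \<sigma>: "\<sigma> \<in> tuples G (Suc n)" for \<sigma>
    proof -
      let ?g = "hd \<sigma>" and ?\<rho> = "root_tuple G \<sigma>"
      have g: "?g \<in> carrier G" and \<rho>: "?\<rho> \<in> tuples G (Suc n)" "map ((\<otimes>) ?g) ?\<rho> = \<sigma>"
        using hd_tuples[OF \<sigma>] root_tuple_in[OF \<sigma>] map_root_tuple[OF \<sigma>] by auto
      have \<rho>G: "set ?\<rho> \<subseteq> carrier G" using \<rho> by (simp add: tuples_def)
      show ?thesis
        using controlled_translate[OF g \<rho>G, of "Suc n" R "F ?\<rho>"] F[OF \<rho>(1)]
          l1_norm_translate_le[of G ?g "F ?\<rho>"] diam_translate[OF g \<rho>G] \<rho>(2)
        by (auto simp: f'_def)
    qed
    have "f' (map ((\<otimes>) g) \<sigma>) = translate G g (f' \<sigma>)" if \<sigma>: "\<sigma> \<in> tuples G (Suc n)" and g: "g \<in> carrier G" for g \<sigma>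
    proof -
      have "hd (map ((\<otimes>) g) \<sigma>) = g \<otimes> hd \<sigma>"
        using \<sigma> by (intro hd_map) (auto simp: tuples_def)
      then show ?thesis
        using root_tuple_map[OF \<sigma> g] translate_translate[OF g hd_tuples[OF \<sigma>]] keysF[OF root_tuple_in[OF \<sigma>]]
        by (simp add: f'_def)
    qed
    then show "controlled_map (Suc n) f'"
      using ctrl R unfolding controlled_map_def by blast
  qed
qed

text \<open>Edges need their own construction: for \<open>n = 1\<close> the cycle consists of
  one-vertex tuples, whose faces are empty and have no node in the tree. From \<open>n = 2\<close>
  on, the images of the faces of \<open>\<sigma>\<close> have their vertices in the hull of
  \<open>\<sigma>\<close>, and the tree filling applies.\<close>

lemma controlled_map_step:
  assumes n: "1 \<le> n" and f: "controlled_map n f"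
    and chain: "n = 1 \<Longrightarrow> \<forall>\<sigma>\<in>tuples G 1. f \<sigma> = frag_of \<sigma>"
    and prev: "\<And>\<sigma>. \<sigma> \<in> tuples G (Suc n) \<Longrightarrow>
      chain_boundary (frag_extend f (chain_boundary (frag_of \<sigma>))) = 0"
  shows "\<exists>f'. controlled_map (Suc n) f' \<and>
    (\<forall>\<sigma>\<in>tuples G (Suc n). chain_boundary (f' \<sigma>) = frag_extend f (chain_boundary (frag_of \<sigma>)))"
proof (rule controlled_map_extend[OF n f prev], assumption)
  show "\<exists>R\<ge>0. \<exists>C\<ge>0. \<forall>\<sigma>\<in>tuples G (Suc n). \<exists>c.
      chain_boundary c = frag_extend f (chain_boundary (frag_of \<sigma>)) \<and>
      controlled (Suc n) R \<sigma> c \<and> l1_norm c \<le> C * (1 + diam \<sigma>)"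
  proof (cases "n = 1")
    case True
    have "frag_extend f (chain_boundary (frag_of \<sigma>)) = chain_boundary (frag_of \<sigma>)"
      if "\<sigma> \<in> tuples G (Suc n)" for \<sigma>
    proof -
      have "frag_extend f (chain_boundary (frag_of \<sigma>)) = frag_extend frag_of (chain_boundary (frag_of \<sigma>))"
        by (rule frag_extend_eq) (use chain[OF True] tuples_face[OF that] True in simp)
      then show ?thesis by simp
    qed
    then show ?thesis using edge_filling True
      by (intro exI[of _ 1] conjI) (auto simp: numeral_2_eq_2)
  next
    case False
    then have n2: "2 \<le> n" using n by simp
    obtain R C where R: "0 \<le> R" "0 \<le> C"
        and fR: "\<And>\<sigma>. \<sigma> \<in> tuples G n \<Longrightarrow> controlled n R \<sigma> (f \<sigma>) \<and> l1_norm (f \<sigma>) \<le> C * (1 + diam \<sigma>)"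
      using f by (auto simp: controlled_map_def)
    \<comment> \<open>This is \<open>2 * node_diam \<sigma> R\<close> with
      \<open>length \<sigma> = Suc n\<close> inserted, hence independent of
      \<open>\<sigma>\<close>.\<close>
    define R' where "R' = 2 * (4 * (3 * \<delta> + R + 1) + 2 * R + 2 * (real (Suc n ^ 2) + 1) * \<delta>)"
    \<comment> \<open>The factor \<open>1 + n\<close> is the cost of the filling,
      \<open>Suc n\<close> the number of faces of \<open>\<sigma>\<close>, and \<open>C\<close> the
      bound on each face.\<close>
    define C' where "C' = (1 + real n) * (real (Suc n) * C)"
    have "\<exists>c. chain_boundary c = frag_extend f (chain_boundary (frag_of \<sigma>)) \<and>
      controlled (Suc n) R' \<sigma> c \<and> l1_norm c \<le> C' * (1 + diam \<sigma>)" if \<sigma>: "\<sigma> \<in> tuples G (Suc n)" for \<sigma>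
    proof -
      let ?z = "frag_extend f (chain_boundary (frag_of \<sigma>))"
      have \<sigma>G: "set \<sigma> \<subseteq> carrier G" "length \<sigma> = Suc n" using \<sigma> by (auto simp: tuples_def)
      have dnn: "0 \<le> diam \<sigma>" using \<sigma>G by (intro diam_nonneg) auto
      have face: "\<eta> \<in> tuples G n" "set \<eta> \<subseteq> set \<sigma>" "\<eta> \<noteq> []"
        if "\<eta> \<in> Poly_Mapping.keys (chain_boundary (frag_of \<sigma>))" for \<eta>
        using tuples_face[OF \<sigma> that] keys_chain_boundary_frag_of[OF that] n \<sigma>G by auto
      have z: "length \<tau> = n \<and> set \<tau> \<subseteq> geodesic_hull \<sigma> \<and> (\<forall>x\<in>set \<tau>. \<forall>y\<in>set \<tau>. wd x y \<le> R)"
        if \<tau>: "\<tau> \<in> Poly_Mapping.keys ?z" for \<tau>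
      proof -
        obtain \<eta> where \<eta>: "\<eta> \<in> Poly_Mapping.keys (chain_boundary (frag_of \<sigma>))" "\<tau> \<in> Poly_Mapping.keys (f \<eta>)"
          using \<tau> keys_frag_extend by fast
        then show ?thesis
          using fR[OF face(1)[OF \<eta>(1)]] geodesic_hull_mono[OF face(2)[OF \<eta>(1)]] by (force simp: controlled_def)
      qed
      obtain F where F: "chain_boundary F = ?z" "l1_norm F \<le> (1 + real n) * l1_norm ?z"
          "\<forall>\<tau>\<in>Poly_Mapping.keys F. length \<tau> = Suc n \<and> set \<tau> \<subseteq> geodesic_hull \<sigma> \<and>
             (\<forall>x\<in>set \<tau>. \<forall>y\<in>set \<tau>. wd x y \<le> 2 * node_diam \<sigma> R)"
        \<comment> \<open>The first vertex of \<open>\<sigma>\<close> is the base point of the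
          tree.\<close>
        using geodesic_hull_filling[OF hd_tuples[OF \<sigma>] \<sigma>G(1) R(1) prev[OF \<sigma>] n2 z] by blast
      have nd: "2 * node_diam \<sigma> R = R'"
        using \<sigma>G by (simp add: R'_def node_diam_def[OF hd_tuples[OF \<sigma>] \<sigma>G(1) R(1)]
          step_len_def[OF hd_tuples[OF \<sigma>] \<sigma>G(1) R(1)])
      have "l1_norm ?z \<le> (C * (1 + diam \<sigma>)) * l1_norm (chain_boundary (frag_of \<sigma>))"
      proof (rule l1_norm_extend_le_const)
        fix \<eta> assume "\<eta> \<in> Poly_Mapping.keys (chain_boundary (frag_of \<sigma>))"
        note \<eta> = face[OF this]
        have "l1_norm (f \<eta>) \<le> C * (1 + diam \<eta>)" using fR \<eta> by auto
        also have "\<dots> \<le> C * (1 + diam \<sigma>)" using diam_mono[OF \<eta>(3,2)] R by (intro mult_left_mono) auto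
        finally show "l1_norm (f \<eta>) \<le> C * (1 + diam \<sigma>)" .
      qed
      also have "\<dots> \<le> (C * (1 + diam \<sigma>)) * real (Suc n)"
        using l1_norm_chain_boundary_frag_of[of \<sigma>] \<sigma>G R dnn
        by (intro mult_left_mono mult_nonneg_nonneg) auto
      finally have "(1 + real n) * l1_norm ?z \<le> C' * (1 + diam \<sigma>)"
        unfolding C'_def using mult_left_mono[of "l1_norm ?z" _ "1 + real n"] by (simp add: mult_ac)
      then have "l1_norm F \<le> C' * (1 + diam \<sigma>)" using F(2) by (rule order_trans[rotated])
      moreover have "controlled (Suc n) R' \<sigma> F" using F(3) unfolding controlled_def nd .
      ultimately show ?thesis using F(1) by (intro exI[of _ F] conjI)
    qed
    moreover have "0 \<le> R'" "0 \<le> C'" using R \<delta> by (auto simp: R'_def C'_def)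
    ultimately show ?thesis by blast
  qed
qed

lemma controlled_map_1: "controlled_map 1 frag_of"
  unfolding controlled_map_def
proof (intro conjI ballI)
  show "\<exists>R\<ge>0. \<exists>C\<ge>0. \<forall>\<sigma>\<in>tuples G 1. controlled 1 R \<sigma> (frag_of \<sigma>) \<and>
      l1_norm (frag_of \<sigma> :: 'a list \<Rightarrow>\<^sub>0 int) \<le> C * (1 + diam \<sigma>)"
  proof (intro exI[where P = "\<lambda>R. 0 \<le> R \<and> (\<exists>C\<ge>0. Q R C)" and x = 0 for Q]
      exI[where P = "\<lambda>C. 0 \<le> C \<and> Q C" and x = 1 for Q] conjI ballI)
    fix \<sigma> assume "\<sigma> \<in> tuples G 1"
    then obtain x where x: "\<sigma> = [x]" "x \<in> carrier G"
      by (auto simp: tuples_def length_Suc_conv)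
    then show "controlled 1 0 \<sigma> (frag_of \<sigma>)"
      by (auto simp: controlled_def geodesic_hull_def gromov_product_def wd_self)
    show "l1_norm (frag_of \<sigma> :: 'a list \<Rightarrow>\<^sub>0 int) \<le> 1 * (1 + diam \<sigma>)" using diam_nonneg[of \<sigma>] x by simp
  qed auto
qed simp

text \<open>Dependent choice over the degree, where each map must be ready for the next filling:
  applied to boundaries it takes cycles as values. This property passes on because the boundary of
  the new map is the old map on the boundary, and the boundary squares to zero.\<close>

lemma exists_controlled_chain_map:
  "\<exists>f. f [] = frag_of [] \<and> (\<forall>n\<ge>1. controlled_map n f) \<and>
     (\<forall>n. \<forall>\<sigma>\<in>tuples G n. chain_boundary (f \<sigma>) = frag_extend f (chain_boundary (frag_of \<sigma>)))"
proof -
  \<comment> \<open>The map with index \<open>n\<close> acts on tuples with \<open>n + 1\<close>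
    vertices; it starts with the identity on vertices.\<close>
  define P where "P n f \<longleftrightarrow> controlled_map (Suc n) f \<and> (n = 0 \<longrightarrow> f = frag_of) \<and>
    (\<forall>\<sigma>\<in>tuples G (Suc (Suc n)). chain_boundary (frag_extend f (chain_boundary (frag_of \<sigma>))) = 0)" for n f
  define Q :: "nat \<Rightarrow> ('a list \<Rightarrow> ('a list \<Rightarrow>\<^sub>0 int)) \<Rightarrow> ('a list \<Rightarrow> ('a list \<Rightarrow>\<^sub>0 int)) \<Rightarrow> bool"
    where "Q n f f' \<longleftrightarrow> (\<forall>\<sigma>\<in>tuples G (Suc (Suc n)).
    chain_boundary (f' \<sigma>) = frag_extend f (chain_boundary (frag_of \<sigma>)))" for n f f'
  have "\<exists>F. \<forall>n. P n (F n) \<and> Q n (F n) (F (Suc n))"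
  proof (rule dependent_nat_choice)
    show "\<exists>f. P 0 f" using controlled_map_1 by (auto simp: P_def)
    fix f n assume f: "P n f"
    then obtain f' where f': "controlled_map (Suc (Suc n)) f'" "Q n f f'"
      using controlled_map_step[of "Suc n" f] by (auto simp: P_def Q_def)
    have "chain_boundary (frag_extend f' (chain_boundary (frag_of \<sigma>))) = 0"
      if \<sigma>: "\<sigma> \<in> tuples G (Suc (Suc (Suc n)))" for \<sigma>
    proof -
      have "chain_boundary (frag_extend f' (chain_boundary (frag_of \<sigma>))) =
          frag_extend f (chain_boundary (chain_boundary (frag_of \<sigma>)))"
        unfolding chain_boundary_extend extend_chain_boundary[of f "chain_boundary (frag_of \<sigma>)"]
        by (rule frag_extend_eq) (use f'(2) tuples_face[OF \<sigma>] in \<open>auto simp: Q_def\<close>)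
      then show ?thesis by simp
    qed
    then show "\<exists>f'. P (Suc n) f' \<and> Q n f f'" using f' by (auto simp: P_def)
  qed
  then obtain F where F: "\<And>n. P n (F n)" "\<And>n. Q n (F n) (F (Suc n))" by blast
  \<comment> \<open>The maps are glued by the length of the tuple. Fixing the empty tuple makes
    \<open>f\<close> compatible with the augmentation.\<close>
  define f where "f \<sigma> = (if \<sigma> = [] then frag_of [] else F (length \<sigma> - 1) \<sigma>)" for \<sigma>
  have f_eq: "f \<sigma> = F n \<sigma>" if "\<sigma> \<in> tuples G (Suc n)" for \<sigma> n
    using that by (auto simp: f_def tuples_def)
  show ?thesis
  proof (intro exI[of _ f] conjI allI impI ballI)
    show "f [] = frag_of []" by (simp add: f_def)
    fix n :: nat assume "1 \<le> n"
    then obtain m where m: "n = Suc m" by (cases n) auto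
    have "controlled_map n (F m)" using F(1)[of m] m by (simp add: P_def)
    then show "controlled_map n f"
      unfolding controlled_map_def m using f_eq[of _ m] tuples_map[OF is_group] by simp
  next
    fix n \<sigma> assume \<sigma>: "\<sigma> \<in> tuples G n"
    consider "n = 0" | "n = 1" | m where "n = Suc (Suc m)" by (metis One_nat_def not0_implies_Suc)
    then show "chain_boundary (f \<sigma>) = frag_extend f (chain_boundary (frag_of \<sigma>))"
    proof cases
      case 1 then show ?thesis using \<sigma> by (auto simp: tuples_def f_def)
    next
      case 2
      then obtain x where x: "\<sigma> = [x]" using \<sigma> by (auto simp: tuples_def length_Suc_conv)
      have "F 0 = frag_of" using F(1)[of 0] by (simp add: P_def)
      then show ?thesis by (simp add: x f_def chain_boundary_Cons)
    next
      case 3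
      then have "chain_boundary (f \<sigma>) = frag_extend (F m) (chain_boundary (frag_of \<sigma>))"
        using F(2)[of m] f_eq[of \<sigma> "Suc m"] \<sigma> by (simp add: Q_def)
      also have "\<dots> = frag_extend f (chain_boundary (frag_of \<sigma>))"
        by (rule frag_extend_eq) (use f_eq tuples_face \<sigma> 3 in metis)
      finally show ?thesis .
    qed
  qed
qed

end

section \<open>Equivariant maps on tuples, with vertices counted, and the homotopy by cones\<close>

definition equivariant :: "('g, 'x) monoid_scheme \<Rightarrow> nat \<Rightarrow> nat \<Rightarrow> ('g list \<Rightarrow> ('g list \<Rightarrow>\<^sub>0 int)) \<Rightarrow> bool" where
  "equivariant G m n \<phi> \<longleftrightarrow> (\<forall>\<sigma>\<in>tuples G m. Poly_Mapping.keys (\<phi> \<sigma>) \<subseteq> tuples G n \<and>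
     (\<forall>g\<in>carrier G. \<phi> (map ((\<otimes>\<^bsub>G\<^esub>) g) \<sigma>) = translate G g (\<phi> \<sigma>)))"

lemma equivariant_chain_boundary:
  assumes "group G"
  shows "equivariant G (Suc n) n (\<lambda>\<sigma>. chain_boundary (frag_of \<sigma>))"
  unfolding equivariant_def
proof (intro ballI conjI subsetI)
  fix \<sigma> g assume "\<sigma> \<in> tuples G (Suc n)" "g \<in> carrier G"
  show "chain_boundary (frag_of (map ((\<otimes>\<^bsub>G\<^esub>) g) \<sigma>)) = translate G g (chain_boundary (frag_of \<sigma>))"
    by (simp flip: chain_boundary_translate)
qed (rule tuples_face)

lemma equivariant_extend:
  assumes "equivariant G m n \<phi>" "equivariant G l m \<psi>"
  shows "equivariant G l n (\<lambda>\<sigma>. frag_extend \<phi> (\<psi> \<sigma>))"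
  unfolding equivariant_def
proof (intro ballI conjI)
  fix \<sigma> assume \<sigma>: "\<sigma> \<in> tuples G l"
  have \<psi>: "Poly_Mapping.keys (\<psi> \<sigma>) \<subseteq> tuples G m" using assms(2) \<sigma> by (simp add: equivariant_def)
  then show "Poly_Mapping.keys (frag_extend \<phi> (\<psi> \<sigma>)) \<subseteq> tuples G n"
    using keys_frag_extend[of \<phi> "\<psi> \<sigma>"] assms(1) unfolding equivariant_def by blast
  fix g assume g: "g \<in> carrier G"
  have "frag_extend \<phi> (\<psi> (map ((\<otimes>\<^bsub>G\<^esub>) g) \<sigma>)) = frag_extend \<phi> (translate G g (\<psi> \<sigma>))"
    using assms(2) \<sigma> g by (simp add: equivariant_def)
  also have "\<dots> = translate G g (frag_extend \<phi> (\<psi> \<sigma>))"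
    unfolding extend_translate translate_extend
    by (rule frag_extend_eq) (use assms(1) \<psi> g in \<open>auto simp: equivariant_def\<close>)
  finally show "frag_extend \<phi> (\<psi> (map ((\<otimes>\<^bsub>G\<^esub>) g) \<sigma>)) = translate G g (frag_extend \<phi> (\<psi> \<sigma>))" .
qed

lemma equivariant_diff:
  assumes "equivariant G m n \<phi>" "equivariant G m n \<psi>"
  shows "equivariant G m n (\<lambda>\<sigma>. \<phi> \<sigma> - \<psi> \<sigma>)"
  unfolding equivariant_def
proof (intro ballI conjI)
  fix \<sigma> assume \<sigma>: "\<sigma> \<in> tuples G m"
  show "Poly_Mapping.keys (\<phi> \<sigma> - \<psi> \<sigma>) \<subseteq> tuples G n"
    using assms \<sigma> by (intro subset_trans[OF keys_diff] Un_least) (simp_all add: equivariant_def)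
  fix g assume "g \<in> carrier G"
  then show "\<phi> (map ((\<otimes>\<^bsub>G\<^esub>) g) \<sigma>) - \<psi> (map ((\<otimes>\<^bsub>G\<^esub>) g) \<sigma>) = translate G g (\<phi> \<sigma> - \<psi> \<sigma>)"
    using assms \<sigma> by (simp add: equivariant_def translate_diff)
qed

lemma equivariant_frag_of: "equivariant G n n frag_of"
  by (simp add: equivariant_def)

lemma equivariant_cone:
  assumes "equivariant G (Suc m) n \<phi>"
  shows "equivariant G (Suc m) (Suc n) (\<lambda>\<sigma>. chain_cone (hd \<sigma>) (\<phi> \<sigma>))"
  unfolding equivariant_def
proof (intro ballI conjI)
  fix \<sigma> assume \<sigma>: "\<sigma> \<in> tuples G (Suc m)"
  then have "Poly_Mapping.keys (\<phi> \<sigma>) \<subseteq> tuples G n" using assms by (simp add: equivariant_def)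
  then show "Poly_Mapping.keys (chain_cone (hd \<sigma>) (\<phi> \<sigma>)) \<subseteq> tuples G (Suc n)"
    using keys_chain_cone[of "hd \<sigma>" "\<phi> \<sigma>"] hd_tuples[OF \<sigma>] by (fastforce simp: tuples_def)
  fix g assume g: "g \<in> carrier G"
  have "hd (map ((\<otimes>\<^bsub>G\<^esub>) g) \<sigma>) = g \<otimes>\<^bsub>G\<^esub> hd \<sigma>"
    using \<sigma> by (intro hd_map) (auto simp: tuples_def)
  then show "chain_cone (hd (map ((\<otimes>\<^bsub>G\<^esub>) g) \<sigma>)) (\<phi> (map ((\<otimes>\<^bsub>G\<^esub>) g) \<sigma>)) =
      translate G g (chain_cone (hd \<sigma>) (\<phi> \<sigma>))"
    using assms \<sigma> g by (simp add: equivariant_def translate_chain_cone)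
qed

text \<open>The usual recursive homotopy between two augmentation-preserving chain maps, here
  \<open>f\<close> and the identity. The first vertex of the tuple is the apex, an equivariant
  choice; the index is the number of vertices of the argument, so index 0 belongs to the empty
  tuple.\<close>

primrec cone_homotopy :: "('g list \<Rightarrow> ('g list \<Rightarrow>\<^sub>0 int)) \<Rightarrow> nat \<Rightarrow> 'g list \<Rightarrow> ('g list \<Rightarrow>\<^sub>0 int)" where
  "cone_homotopy f 0 = (\<lambda>\<sigma>. 0)"
| "cone_homotopy f (Suc n) = (\<lambda>\<sigma>. chain_cone (hd \<sigma>)
     (f \<sigma> - frag_of \<sigma> - frag_extend (cone_homotopy f n) (chain_boundary (frag_of \<sigma>))))"

lemma equivariant_cone_homotopy:
  assumes "group G" "\<And>n. 1 \<le> n \<Longrightarrow> equivariant G n n f"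
  shows "equivariant G n (Suc n) (cone_homotopy f n)"
proof (induction n)
  case 0 show ?case by (simp add: equivariant_def)
next
  case (Suc n)
  show ?case
    unfolding cone_homotopy.simps
    by (intro equivariant_cone equivariant_diff equivariant_frag_of
        equivariant_extend[OF Suc equivariant_chain_boundary] assms) simp
qed

text \<open>By the cone formula it suffices that the chain to be coned off, namely
  \<open>f \<sigma>\<close> minus \<open>\<sigma>\<close> minus the homotopy on the boundary, is a
  cycle. This follows from the identity one degree lower, since \<open>f\<close> commutes with the
  boundary.\<close>

lemma cone_homotopy:
  assumes nil: "f [] = frag_of []"
    and chain: "\<And>n \<sigma>. \<sigma> \<in> tuples G n \<Longrightarrow>
      chain_boundary (f \<sigma>) = frag_extend f (chain_boundary (frag_of \<sigma>))"
  shows "\<sigma> \<in> tuples G (Suc n) \<Longrightarrow> chain_boundary (cone_homotopy f (Suc n) \<sigma>) +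
    frag_extend (cone_homotopy f n) (chain_boundary (frag_of \<sigma>)) = f \<sigma> - frag_of \<sigma>"
proof (induction n arbitrary: \<sigma>)
  case 0
  then obtain x where x: "\<sigma> = [x]" by (auto simp: tuples_def length_Suc_conv)
  \<comment> \<open>Both boundaries are the empty tuple; this is where
    \<open>f [] = frag_of []\<close> enters.\<close>
  then have "chain_boundary (f \<sigma> - frag_of \<sigma>) = 0"
    using chain[OF 0] nil by (simp add: chain_boundary_diff chain_boundary_Cons)
  then show ?case by (simp add: chain_boundary_chain_cone frag_extend_eq_0)
next
  case (Suc n)
  let ?b = "chain_boundary (frag_of \<sigma>)" and ?h = "cone_homotopy f (Suc n)"
  have "chain_boundary (frag_extend ?h ?b) =
      frag_extend f ?b - ?b - frag_extend (cone_homotopy f n) (chain_boundary ?b)"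
  proof -
    have "chain_boundary (frag_extend ?h ?b) = frag_extend (\<lambda>\<eta>. f \<eta> - frag_of \<eta> -
        frag_extend (cone_homotopy f n) (chain_boundary (frag_of \<eta>))) ?b"
      unfolding chain_boundary_extend
    proof (rule frag_extend_eq)
      fix \<eta> assume "\<eta> \<in> Poly_Mapping.keys ?b"
      from Suc.IH[OF tuples_face[OF Suc.prems this]]
      show "chain_boundary (?h \<eta>) = f \<eta> - frag_of \<eta> -
          frag_extend (cone_homotopy f n) (chain_boundary (frag_of \<eta>))"
        by (simp only: eq_diff_eq)
    qed
    then show ?thesis
      by (simp only: frag_extend_fun_diff frag_extend_frag_of extend_chain_boundary[of _ ?b, symmetric])
  qed
  then have "chain_boundary (f \<sigma> - frag_of \<sigma> - frag_extend ?h ?b) = 0"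
    using chain[OF Suc.prems] by (simp only: chain_boundary_diff chain_boundary_boundary frag_extend_0)
      simp
  then show ?case
    unfolding cone_homotopy.simps(2)[of f "Suc n"] chain_boundary_chain_cone by (simp only: chain_cone_0) simp
qed

context word_metric_group
begin

text \<open>Coning does not increase the l1 norm, whatever the diameter of the resulting tuples. The
  linear bound thus propagates from \<open>f\<close> through the recursion.\<close>

lemma cone_homotopy_bound:
  assumes "\<And>n. 1 \<le> n \<Longrightarrow> \<exists>C\<ge>0. \<forall>\<sigma>\<in>tuples G n. l1_norm (f \<sigma>) \<le> C * (1 + diam \<sigma>)"
  shows "\<exists>C\<ge>0. \<forall>\<sigma>\<in>tuples G (Suc n). l1_norm (cone_homotopy f (Suc n) \<sigma>) \<le> C * (1 + diam \<sigma>)"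
proof (induction n)
  case 0
  obtain C where C: "0 \<le> C" "\<And>\<sigma>. \<sigma> \<in> tuples G (Suc 0) \<Longrightarrow> l1_norm (f \<sigma>) \<le> C * (1 + diam \<sigma>)"
    using assms[of "Suc 0"] by auto
  have "l1_norm (cone_homotopy f (Suc 0) \<sigma>) \<le> (C + 1) * (1 + diam \<sigma>)" if "\<sigma> \<in> tuples G (Suc 0)" for \<sigma>
  proof -
    have "0 \<le> diam \<sigma>" using that by (intro diam_nonneg) (auto simp: tuples_def)
    then show ?thesis
      using l1_norm_chain_cone_le[of "hd \<sigma>" "f \<sigma> - frag_of \<sigma>"] l1_norm_diff_le[of "f \<sigma>" "frag_of \<sigma>"]
        C(2)[OF that] by (simp add: frag_extend_eq_0 distrib_right)
  qed
  then show ?case using C(1) by (intro exI[of _ "C + 1"]) simp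
next
  case (Suc n)
  let ?h = "cone_homotopy f (Suc n)"
  obtain C where C: "0 \<le> C" "\<And>\<sigma>. \<sigma> \<in> tuples G (Suc (Suc n)) \<Longrightarrow> l1_norm (f \<sigma>) \<le> C * (1 + diam \<sigma>)"
    using assms[of "Suc (Suc n)"] by auto
  obtain D where D: "0 \<le> D" "\<And>\<sigma>. \<sigma> \<in> tuples G (Suc n) \<Longrightarrow> l1_norm (?h \<sigma>) \<le> D * (1 + diam \<sigma>)"
    using Suc by blast
  \<comment> \<open>The summands come from \<open>f \<sigma>\<close>, from \<open>\<sigma>\<close>
    itself and from the homotopy on the \<open>Suc (Suc n)\<close> faces.\<close>
  let ?K = "C + 1 + D * real (Suc (Suc n))"
  have "l1_norm (cone_homotopy f (Suc (Suc n)) \<sigma>) \<le> ?K * (1 + diam \<sigma>)"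
    if \<sigma>: "\<sigma> \<in> tuples G (Suc (Suc n))" for \<sigma>
  proof -
    let ?b = "chain_boundary (frag_of \<sigma>)"
    have nn: "0 \<le> diam \<sigma>" using \<sigma> by (intro diam_nonneg) (auto simp: tuples_def)
    have "l1_norm (frag_extend ?h ?b) \<le> (D * (1 + diam \<sigma>)) * l1_norm ?b"
    proof (rule l1_norm_extend_le_const)
      fix \<eta> assume \<eta>: "\<eta> \<in> Poly_Mapping.keys ?b"
      have "diam \<eta> \<le> diam \<sigma>"
        using keys_chain_boundary_frag_of[OF \<eta>] \<sigma> by (intro diam_mono) (auto simp: tuples_def)
      then have "D * (1 + diam \<eta>) \<le> D * (1 + diam \<sigma>)" using D by (intro mult_left_mono) auto
      with D(2)[OF tuples_face[OF \<sigma> \<eta>]] show "l1_norm (?h \<eta>) \<le> D * (1 + diam \<sigma>)" by linarith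
    qed
    also have "\<dots> \<le> (D * (1 + diam \<sigma>)) * real (Suc (Suc n))"
      using l1_norm_chain_boundary_frag_of[of \<sigma>] \<sigma> D nn
      by (intro mult_left_mono mult_nonneg_nonneg) (auto simp: tuples_def)
    finally have 1: "l1_norm (frag_extend ?h ?b) \<le> (D * (1 + diam \<sigma>)) * real (Suc (Suc n))" .
    have "l1_norm (cone_homotopy f (Suc (Suc n)) \<sigma>) \<le> l1_norm (f \<sigma> - frag_of \<sigma> - frag_extend ?h ?b)"
      unfolding cone_homotopy.simps(2)[of f "Suc n"] by (rule l1_norm_chain_cone_le)
    also have "\<dots> \<le> l1_norm (f \<sigma>) + 1 + l1_norm (frag_extend ?h ?b)"
      using l1_norm_diff_le[of "f \<sigma> - frag_of \<sigma>" "frag_extend ?h ?b"] l1_norm_diff_le[of "f \<sigma>" "frag_of \<sigma>"]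
      by simp
    also have "\<dots> \<le> C * (1 + diam \<sigma>) + (1 + diam \<sigma>) + (D * (1 + diam \<sigma>)) * real (Suc (Suc n))"
      using 1 C(2)[OF \<sigma>] nn by linarith
    also have "\<dots> = ?K * (1 + diam \<sigma>)" by (simp add: algebra_simps)
    finally show ?thesis .
  qed
  moreover have "0 \<le> ?K" using C D by simp
  ultimately show ?case by blast
qed

text \<open>The letters of \<open>S'\<close> have bounded length with respect to \<open>S\<close>,
  so rewriting a geodesic \<open>S'\<close>-word letter by letter lengthens it by at most a constant
  factor.\<close>

lemma diam_equivalent:
  assumes "finite_generating_set G S'"
  shows "\<exists>K\<ge>1. \<forall>\<sigma>. \<sigma> \<noteq> [] \<longrightarrow> set \<sigma> \<subseteq> carrier G \<longrightarrow> diam \<sigma> \<le> K * tuple_diam G S' \<sigma>"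
proof -
  interpret S': word_metric_group G S' by unfold_locales (rule assms)
  \<comment> \<open>Inserting 1 keeps the set nonempty if there are no letters, and the resulting
    \<open>1 \<le> K\<close> later absorbs the constant term of \<open>1 + diam\<close>.\<close>
  define K where "K = Max (insert 1 (len ` S'.letters))"
  have fin: "finite (insert 1 (len ` S'.letters))"
    using assms by (simp add: S'.letters_def finite_generating_set_def)
  have K: "1 \<le> K" "\<And>s. s \<in> S'.letters \<Longrightarrow> len s \<le> K"
    unfolding K_def using fin by (auto intro!: Max_ge)
  have word: "len (word_prod w) \<le> K * length w" if "set w \<subseteq> S'.letters" for w
    using that
  proof (induction w)
    case (Cons s w)
    then have "s \<in> carrier G" "word_prod w \<in> carrier G" "len s \<le> K"
      using S'.letters_closed S'.word_closed K by auto
    then show ?case using len_mult_le[of s "word_prod w"] Cons by simp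
  qed simp
  have dist: "wd x y \<le> real K * S'.wd x y" if "x \<in> carrier G" "y \<in> carrier G" for x y
  proof -
    have "inv x \<otimes> y \<in> carrier G" using that by simp
    then obtain w where "set w \<subseteq> S'.letters" "word_prod w = inv x \<otimes> y" "length w = S'.len (inv x \<otimes> y)"
      by (rule S'.geodesic_word)
    with word[of w] have "len (inv x \<otimes> y) \<le> K * S'.len (inv x \<otimes> y)" by simp
    then show ?thesis by (simp only: word_dist_def of_nat_le_iff flip: of_nat_mult)
  qed
  have "diam \<sigma> \<le> real K * S'.diam \<sigma>" if "\<sigma> \<noteq> []" "set \<sigma> \<subseteq> carrier G" for \<sigma>
  proof (rule diam_leI[OF that(1)])
    fix x y assume xy: "x \<in> set \<sigma>" "y \<in> set \<sigma>"
    have "wd x y \<le> real K * S'.wd x y" using dist xy that by blast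
    also have "\<dots> \<le> real K * S'.diam \<sigma>" using S'.wd_le_diam[OF xy] by (intro mult_left_mono) auto
    finally show "wd x y \<le> real K * S'.diam \<sigma>" .
  qed
  then show ?thesis using K(1) by (intro exI[of _ "real K"]) auto
qed

end

text \<open>This collects all that the analytic part takes from the geometry. The construction runs
  in the generating set witnessing hyperbolicity, and the bounds are transferred to the diameter of
  \<open>S\<close>; finite type is stated through root tuples, which makes no reference to a
  metric.\<close>

theorem hyperbolic_controlled_homotopy:
  assumes "hyperbolic_group G" and S: "finite_generating_set G S"
  obtains f h where
    "\<And>n. equivariant G (Suc n) (Suc n) (f n)" "\<And>n. equivariant G n (Suc n) (h n)"
    "\<And>n \<sigma>. \<sigma> \<in> tuples G (Suc n) \<Longrightarrow>
       chain_boundary (h (Suc n) \<sigma>) + frag_extend (h n) (chain_boundary (frag_of \<sigma>)) = f n \<sigma> - frag_of \<sigma>"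
    "\<And>n. \<exists>C\<ge>0. \<forall>\<sigma>\<in>tuples G (Suc n). l1_norm (f n \<sigma>) \<le> C * (1 + tuple_diam G S \<sigma>)"
    "\<And>n. \<exists>C\<ge>0. \<forall>\<sigma>\<in>tuples G (Suc n). l1_norm (h (Suc n) \<sigma>) \<le> C * (1 + tuple_diam G S \<sigma>)"
    "\<And>n. \<exists>B. finite B \<and> (\<forall>\<sigma>\<in>tuples G (Suc n). \<forall>\<tau>\<in>Poly_Mapping.keys (f n \<sigma>). root_tuple G \<tau> \<in> B)"
    "h 0 = (\<lambda>\<sigma>. 0)"
proof -
  obtain S' \<delta> where G: "group G" and S': "finite_generating_set G S'"
    and hyp: "\<forall>w\<in>carrier G. \<forall>x\<in>carrier G. \<forall>y\<in>carrier G. \<forall>z\<in>carrier G.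
      gromov_product (word_dist G S') w x z \<ge>
      min (gromov_product (word_dist G S') w x y) (gromov_product (word_dist G S') w y z) - \<delta>"
    using assms(1) unfolding hyperbolic_group_def gromov_hyperbolic_def by blast
  interpret group G by (rule G)
  interpret word_metric_group G S' by unfold_locales (rule S')
  \<comment> \<open>The definition of hyperbolicity allows a negative constant, hence the absolute
    value.\<close>
  interpret hyperbolic_word_group G S' "\<bar>\<delta>\<bar>"
  proof
    fix w x y z assume "w \<in> carrier G" "x \<in> carrier G" "y \<in> carrier G" "z \<in> carrier G"
    with hyp have "min (gromov_product wd w x y) (gromov_product wd w y z) - \<delta> \<le> gromov_product wd w x z"
      by blast
    then show "min (gromov_product wd w x y) (gromov_product wd w y z) - \<bar>\<delta>\<bar> \<le> gromov_product wd w x z"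
      by linarith
  qed simp
  interpret T: word_metric_group G S by unfold_locales (rule S)
  obtain K where K: "1 \<le> K" "\<And>\<sigma>. \<lbrakk>\<sigma> \<noteq> []; set \<sigma> \<subseteq> carrier G\<rbrakk> \<Longrightarrow> diam \<sigma> \<le> K * T.diam \<sigma>"
    using diam_equivalent[OF S] by blast
  have transfer: "\<exists>C\<ge>0. \<forall>\<sigma>\<in>tuples G (Suc n). l1_norm (\<phi> \<sigma>) \<le> C * (1 + T.diam \<sigma>)"
    if "\<exists>C\<ge>0. \<forall>\<sigma>\<in>tuples G (Suc n). l1_norm (\<phi> \<sigma>) \<le> C * (1 + diam \<sigma>)" for n and \<phi> :: "'a list \<Rightarrow> ('a list \<Rightarrow>\<^sub>0 int)"
  proof -
    obtain C where C: "0 \<le> C" "\<And>\<sigma>. \<sigma> \<in> tuples G (Suc n) \<Longrightarrow> l1_norm (\<phi> \<sigma>) \<le> C * (1 + diam \<sigma>)"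
      using \<open>\<exists>C\<ge>0. \<forall>\<sigma>\<in>tuples G (Suc n). l1_norm (\<phi> \<sigma>) \<le> C * (1 + diam \<sigma>)\<close> by blast
    have "l1_norm (\<phi> \<sigma>) \<le> (C * K) * (1 + T.diam \<sigma>)" if \<sigma>: "\<sigma> \<in> tuples G (Suc n)" for \<sigma>
    proof -
      have "1 + diam \<sigma> \<le> K * (1 + T.diam \<sigma>)"
      proof -
        have "diam \<sigma> \<le> K * T.diam \<sigma>" using \<sigma> by (intro K(2)) (auto simp: tuples_def)
        then show ?thesis using K(1) by (simp add: distrib_left)
      qed
      then have "C * (1 + diam \<sigma>) \<le> C * (K * (1 + T.diam \<sigma>))" by (intro mult_left_mono C)
      with C(2)[OF \<sigma>] show ?thesis by (simp add: mult.assoc)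
    qed
    moreover have "0 \<le> C * K" using C K by simp
    ultimately show ?thesis by blast
  qed
  obtain f where f: "f [] = frag_of []" "\<And>n. 1 \<le> n \<Longrightarrow> controlled_map n f"
      "\<And>n \<sigma>. \<sigma> \<in> tuples G n \<Longrightarrow> chain_boundary (f \<sigma>) = frag_extend f (chain_boundary (frag_of \<sigma>))"
    using exists_controlled_chain_map by blast
  have ctrl: "\<exists>R C. 0 \<le> R \<and> 0 \<le> C \<and> (\<forall>\<sigma>\<in>tuples G n. controlled n R \<sigma> (f \<sigma>) \<and> l1_norm (f \<sigma>) \<le> C * (1 + diam \<sigma>))"
    if "1 \<le> n" for n
    using f(2)[OF that] unfolding controlled_map_def by blast
  have fbound: "\<exists>C\<ge>0. \<forall>\<sigma>\<in>tuples G n. l1_norm (f \<sigma>) \<le> C * (1 + diam \<sigma>)" if "1 \<le> n" for n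
    using ctrl[OF that] by blast
  have feq: "equivariant G n n f" if "1 \<le> n" for n
    unfolding equivariant_def
  proof (intro ballI conjI subsetI)
    fix \<sigma> \<tau> assume "\<sigma> \<in> tuples G n" "\<tau> \<in> Poly_Mapping.keys (f \<sigma>)"
    then show "\<tau> \<in> tuples G n"
      using ctrl[OF that] by (fastforce simp: controlled_def tuples_def geodesic_hull_def)
  qed (use f(2)[OF that] in \<open>auto simp: controlled_map_def\<close>)
  show thesis
  proof (rule that[of "\<lambda>n. f" "cone_homotopy f"])
    fix n
    show "equivariant G (Suc n) (Suc n) f" by (rule feq) simp
    show "equivariant G n (Suc n) (cone_homotopy f n)" by (rule equivariant_cone_homotopy[OF G feq])
    show "\<exists>C\<ge>0. \<forall>\<sigma>\<in>tuples G (Suc n). l1_norm (f \<sigma>) \<le> C * (1 + tuple_diam G S \<sigma>)"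
      by (rule transfer, rule fbound) simp
    show "\<exists>C\<ge>0. \<forall>\<sigma>\<in>tuples G (Suc n). l1_norm (cone_homotopy f (Suc n) \<sigma>) \<le> C * (1 + tuple_diam G S \<sigma>)"
      by (rule transfer, rule cone_homotopy_bound, rule fbound)
    show "\<exists>B. finite B \<and> (\<forall>\<sigma>\<in>tuples G (Suc n). \<forall>\<tau>\<in>Poly_Mapping.keys (f \<sigma>). root_tuple G \<tau> \<in> B)"
    proof -
      obtain R where R: "\<And>\<sigma>. \<sigma> \<in> tuples G (Suc n) \<Longrightarrow> controlled (Suc n) R \<sigma> (f \<sigma>)"
        using ctrl[of "Suc n"] by auto
      \<comment> \<open>A root tuple starts at the unit, so its vertices have as length the
        distances from the first vertex of \<open>\<tau>\<close>, which are integers at most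
        \<open>R\<close>.\<close>
      define B where "B = {\<tau>. set \<tau> \<subseteq> {g \<in> carrier G. len g \<le> nat \<lfloor>R\<rfloor>} \<and> length \<tau> = Suc n}"
      have "root_tuple G \<tau> \<in> B" if \<sigma>: "\<sigma> \<in> tuples G (Suc n)" and \<tau>: "\<tau> \<in> Poly_Mapping.keys (f \<sigma>)" for \<sigma> \<tau>
      proof -
        have c: "length \<tau> = Suc n" "set \<tau> \<subseteq> carrier G" "\<And>x y. \<lbrakk>x \<in> set \<tau>; y \<in> set \<tau>\<rbrakk> \<Longrightarrow> wd x y \<le> R"
          using R[OF \<sigma>] \<tau> by (auto simp: controlled_def geodesic_hull_def)
        have hd: "hd \<tau> \<in> set \<tau>" using c(1) by (cases \<tau>) auto
        have "len (inv\<^bsub>G\<^esub> (hd \<tau>) \<otimes>\<^bsub>G\<^esub> x) \<le> nat \<lfloor>R\<rfloor>" if "x \<in> set \<tau>" for x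
          using c(3)[OF hd that] by (simp add: word_dist_def le_nat_floor)
        then show ?thesis using c hd by (auto simp: B_def root_tuple_def)
      qed
      moreover have "finite B" unfolding B_def by (intro finite_lists_length_eq finite_ball)
      ultimately show ?thesis by blast
    qed
    fix \<sigma> assume \<sigma>: "\<sigma> \<in> tuples G (Suc n)"
    show "chain_boundary (cone_homotopy f (Suc n) \<sigma>) +
      frag_extend (cone_homotopy f n) (chain_boundary (frag_of \<sigma>)) = f \<sigma> - frag_of \<sigma>"
      by (rule cone_homotopy[where G = G and f = f, OF f(1) _ \<sigma>]) (rule f(3))
  qed simp
qed

section \<open>Seminormed groups and completions\<close>

text \<open>\<open>quotient_map\<close> extracts the only element of an image, so it is determined
  once the image of the coset is a single coset: elements of \<open>K\<close> are sent into
  \<open>N\<close> and are absorbed there.\<close>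

lemma quotient_map_rcoset:
  assumes "subgroup N G'" "group G'" "K \<noteq> {}" "f a \<in> carrier G'"
    and "\<And>k. k \<in> K \<Longrightarrow> f k \<in> N \<and> f (k \<otimes>\<^bsub>G\<^esub> a) = f k \<otimes>\<^bsub>G'\<^esub> f a"
  shows "quotient_map G' N f (K #>\<^bsub>G\<^esub> a) = N #>\<^bsub>G'\<^esub> f a"
proof -
  interpret group G' by fact
  interpret N: subgroup N G' by fact
  have "N #>\<^bsub>G'\<^esub> f b = N #>\<^bsub>G'\<^esub> f a" if "b \<in> K #>\<^bsub>G\<^esub> a" for b
  proof -
    obtain k where k: "k \<in> K" "b = k \<otimes>\<^bsub>G\<^esub> a" using \<open>b \<in> K #>\<^bsub>G\<^esub> a\<close> by (auto simp: r_coset_def)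
    then have "N #>\<^bsub>G'\<^esub> f b = (N #>\<^bsub>G'\<^esub> f k) #>\<^bsub>G'\<^esub> f a"
      using assms(4,5) by (simp add: coset_mult_assoc N.subset)
    then show ?thesis using assms(5)[OF k(1)] by (simp add: coset_join2 N.subgroup_axioms)
  qed
  moreover have "K #>\<^bsub>G\<^esub> a \<noteq> {}" using assms(3) by (auto simp: r_coset_def)
  ultimately have "(\<lambda>b. N #>\<^bsub>G'\<^esub> f b) ` (K #>\<^bsub>G\<^esub> a) = {N #>\<^bsub>G'\<^esub> f a}" by auto
  then show ?thesis by (simp add: quotient_map_def)
qed

lemma (in comm_group) rcoset_eq_iff:
  assumes "subgroup N G" "a \<in> carrier G" "b \<in> carrier G"
  shows "N #> a = N #> b \<longleftrightarrow> a \<otimes> inv b \<in> N"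
proof -
  interpret N: subgroup N G by fact
  show ?thesis
    using assms N.rcos_module[OF is_group, of b a] repr_independence[of a N b] rcos_self[of a N] by blast
qed

lemma (in group) diff_cancel_right:
  assumes "x \<in> carrier G" "y \<in> carrier G" "a \<in> carrier G"
  shows "x \<otimes> inv a \<otimes> inv (y \<otimes> inv a) = x \<otimes> inv y"
proof -
  have "inv a \<otimes> (a \<otimes> inv y) = inv y" using assms by (simp flip: m_assoc)
  then show ?thesis using assms by (simp add: inv_mult_group m_assoc)
qed

section \<open>Cauchy sequences modulo null sequences\<close>

context Z_seminormed
begin

lemma seminorm_one [simp]: "s \<one> = 0"
  using homogeneous[of \<one> 0] by simp

lemma seminorm_inv [simp]: "x \<in> carrier M \<Longrightarrow> s (inv x) = s x"
  using homogeneous[of x "-1"] by (simp add: int_pow_neg)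

lemma seminorm_nonneg: "x \<in> carrier M \<Longrightarrow> 0 \<le> s x"
  using triangle[of x "inv x"] by simp

lemma triangle_diff: "\<lbrakk>x \<in> carrier M; y \<in> carrier M\<rbrakk> \<Longrightarrow> s (x \<otimes> inv y) \<le> s x + s y"
  using triangle[of x "inv y"] by simp

lemma cauchy_seqsI:
  assumes "\<And>n. X n \<in> carrier M"
    and "\<And>\<epsilon>. 0 < \<epsilon> \<Longrightarrow> \<exists>N. \<forall>m\<ge>N. \<forall>n\<ge>N. s (X m \<otimes> inv (X n)) < \<epsilon>"
  shows "X \<in> cauchy_seqs M s"
  using assms by (auto simp: cauchy_seqs_def)

lemma cauchy_seqsD:
  "\<lbrakk>X \<in> cauchy_seqs M s; 0 < \<epsilon>\<rbrakk> \<Longrightarrow> \<exists>N. \<forall>m\<ge>N. \<forall>n\<ge>N. s (X m \<otimes> inv (X n)) < \<epsilon>"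
  by (simp add: cauchy_seqs_def)

lemma cauchy_seqs_closed: "X \<in> cauchy_seqs M s \<Longrightarrow> X n \<in> carrier M"
  by (auto simp: cauchy_seqs_def)

lemma cauchy_seqs_mult:
  assumes X: "X \<in> cauchy_seqs M s" and Y: "Y \<in> cauchy_seqs M s"
  shows "(\<lambda>n. X n \<otimes> Y n) \<in> cauchy_seqs M s"
proof (rule cauchy_seqsI)
  note c = cauchy_seqs_closed[OF X] cauchy_seqs_closed[OF Y]
  show "X n \<otimes> Y n \<in> carrier M" for n using c by simp
  fix \<epsilon> :: real assume "0 < \<epsilon>"
  then have \<epsilon>: "0 < \<epsilon> / 2" by simp
  obtain A where A: "\<And>m n. \<lbrakk>m \<ge> A; n \<ge> A\<rbrakk> \<Longrightarrow> s (X m \<otimes> inv (X n)) < \<epsilon> / 2"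
    using cauchy_seqsD[OF X \<epsilon>] by blast
  obtain B where B: "\<And>m n. \<lbrakk>m \<ge> B; n \<ge> B\<rbrakk> \<Longrightarrow> s (Y m \<otimes> inv (Y n)) < \<epsilon> / 2"
    using cauchy_seqsD[OF Y \<epsilon>] by blast
  have "s (X m \<otimes> Y m \<otimes> inv (X n \<otimes> Y n)) < \<epsilon>" if "m \<ge> max A B" "n \<ge> max A B" for m n
  proof -
    have "X m \<otimes> Y m \<otimes> inv (X n \<otimes> Y n) = (X m \<otimes> inv (X n)) \<otimes> (Y m \<otimes> inv (Y n))"
      using c by (simp add: inv_mult m_ac)
    then show ?thesis
      using triangle[of "X m \<otimes> inv (X n)" "Y m \<otimes> inv (Y n)"] c A[of m n] B[of m n] that by simp
  qed
  then show "\<exists>N. \<forall>m\<ge>N. \<forall>n\<ge>N. s (X m \<otimes> Y m \<otimes> inv (X n \<otimes> Y n)) < \<epsilon>" by blast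
qed

lemma cauchy_seqs_inv:
  assumes X: "X \<in> cauchy_seqs M s"
  shows "(\<lambda>n. inv (X n)) \<in> cauchy_seqs M s"
proof (rule cauchy_seqsI)
  note c = cauchy_seqs_closed[OF X]
  show "inv (X n) \<in> carrier M" for n using c by simp
  have "s (inv (X m) \<otimes> inv (inv (X n))) = s (X m \<otimes> inv (X n))" for m n
    using seminorm_inv[of "X m \<otimes> inv (X n)"] c by (simp add: inv_mult)
  then show "\<exists>N. \<forall>m\<ge>N. \<forall>n\<ge>N. s (inv (X m) \<otimes> inv (inv (X n))) < \<epsilon>" if "0 < \<epsilon>" for \<epsilon>
    using X that by (simp add: cauchy_seqs_def)
qed

lemma cauchy_seqs_const: "x \<in> carrier M \<Longrightarrow> (\<lambda>_. x) \<in> cauchy_seqs M s"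
  by (rule cauchy_seqsI) auto

lemma convergent_cauchy:
  assumes "\<And>n. X n \<in> carrier M" "a \<in> carrier M" "(\<lambda>n. s (X n \<otimes> inv a)) \<longlonglongrightarrow> 0"
  shows "X \<in> cauchy_seqs M s"
proof (rule cauchy_seqsI)
  fix \<epsilon> :: real assume "0 < \<epsilon>"
  then have "\<forall>\<^sub>F n in sequentially. s (X n \<otimes> inv a) < \<epsilon> / 2"
    using order_tendstoD(2)[OF assms(3), of "\<epsilon> / 2"] by simp
  then obtain N where N: "\<And>n. n \<ge> N \<Longrightarrow> s (X n \<otimes> inv a) < \<epsilon> / 2"
    by (auto simp: eventually_sequentially)
  have "s (X m \<otimes> inv (X n)) < \<epsilon>" if "m \<ge> N" "n \<ge> N" for m n
  proof -
    have "(X m \<otimes> inv a) \<otimes> inv (X n \<otimes> inv a) = X m \<otimes> inv (X n)"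
      by (rule diff_cancel_right) (rule assms)+
    then show ?thesis
      using triangle_diff[of "X m \<otimes> inv a" "X n \<otimes> inv a"] N[of m] N[of n] that assms(1,2) by simp
  qed
  then show "\<exists>N. \<forall>m\<ge>N. \<forall>n\<ge>N. s (X m \<otimes> inv (X n)) < \<epsilon>" by blast
qed (rule assms(1))

lemma null_seqsI:
  assumes "\<And>n. X n \<in> carrier M" "(\<lambda>n. s (X n)) \<longlonglongrightarrow> 0"
  shows "X \<in> null_seqs M s"
  using convergent_cauchy[of X \<one>] assms by (simp add: null_seqs_def)

lemma null_seqsD: "X \<in> null_seqs M s \<Longrightarrow> (\<lambda>n. s (X n)) \<longlonglongrightarrow> 0"
  by (simp add: null_seqs_def)

lemma null_seqs_cauchy: "X \<in> null_seqs M s \<Longrightarrow> X \<in> cauchy_seqs M s"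
  by (simp add: null_seqs_def)

lemma cauchy_group_simps [simp]:
  "carrier (cauchy_group M s) = cauchy_seqs M s"
  "X \<otimes>\<^bsub>cauchy_group M s\<^esub> Y = (\<lambda>n. X n \<otimes> Y n)"
  "\<one>\<^bsub>cauchy_group M s\<^esub> = (\<lambda>n. \<one>)"
  by (simp_all add: cauchy_group_def)

lemma comm_group_cauchy_group: "comm_group (cauchy_group M s)"
proof (rule comm_groupI)
  fix X assume X: "X \<in> carrier (cauchy_group M s)"
  then show "\<exists>Y\<in>carrier (cauchy_group M s). Y \<otimes>\<^bsub>cauchy_group M s\<^esub> X = \<one>\<^bsub>cauchy_group M s\<^esub>"
    using cauchy_seqs_inv[of X] cauchy_seqs_closed[of X]
    by (intro bexI[of _ "\<lambda>n. inv (X n)"]) (auto simp: fun_eq_iff)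
qed (auto intro: cauchy_seqs_mult cauchy_seqs_const simp: fun_eq_iff m_ac cauchy_seqs_closed)

lemma inv_cauchy_group:
  assumes "X \<in> cauchy_seqs M s"
  shows "inv\<^bsub>cauchy_group M s\<^esub> X = (\<lambda>n. inv (X n))"
proof -
  interpret C: comm_group "cauchy_group M s" by (rule comm_group_cauchy_group)
  show ?thesis
    using assms cauchy_seqs_inv[OF assms] cauchy_seqs_closed[OF assms]
    by (intro C.inv_equality) (auto simp: fun_eq_iff)
qed

lemma null_seqs_mult:
  assumes "X \<in> null_seqs M s" "Y \<in> null_seqs M s"
  shows "(\<lambda>n. X n \<otimes> Y n) \<in> null_seqs M s"
proof (rule null_seqsI)
  note c = assms[THEN null_seqs_cauchy, THEN cauchy_seqs_closed]
  show "X n \<otimes> Y n \<in> carrier M" for n using c by simp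
  have "(\<lambda>n. s (X n) + s (Y n)) \<longlonglongrightarrow> 0"
    using tendsto_add[OF assms[THEN null_seqsD]] by simp
  then show "(\<lambda>n. s (X n \<otimes> Y n)) \<longlonglongrightarrow> 0"
    by (rule tendsto_sandwich[OF _ _ tendsto_const, rotated 2]) (auto simp: c triangle seminorm_nonneg)
qed

lemma null_seqs_inv: "X \<in> null_seqs M s \<Longrightarrow> (\<lambda>n. inv (X n)) \<in> null_seqs M s"
  by (rule null_seqsI) (auto simp: null_seqs_cauchy[THEN cauchy_seqs_closed] null_seqsD)

lemma null_seqs_one: "(\<lambda>n. \<one>) \<in> null_seqs M s"
  by (rule null_seqsI) auto

lemma subgroup_null_seqs: "subgroup (null_seqs M s) (cauchy_group M s)"
proof -
  interpret C: comm_group "cauchy_group M s" by (rule comm_group_cauchy_group)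
  show ?thesis
    by (intro C.subgroupI)
      (auto simp: inv_cauchy_group null_seqs_cauchy null_seqs_mult null_seqs_inv intro: null_seqs_one)
qed

lemma comm_group_completion: "comm_group (completion M s)"
  unfolding completion_def
  by (rule comm_group.abelian_FactGroup[OF comm_group_cauchy_group subgroup_null_seqs])

lemma carrier_completion: "carrier (completion M s) = completion_class M s ` cauchy_seqs M s"
  by (simp add: completion_def carrier_FactGroup completion_class_def[abs_def])

lemma completion_class_closed: "X \<in> cauchy_seqs M s \<Longrightarrow> completion_class M s X \<in> carrier (completion M s)"
  by (simp add: carrier_completion)

lemma completion_class_mult:
  assumes "X \<in> cauchy_seqs M s" "Y \<in> cauchy_seqs M s"
  shows "completion_class M s X \<otimes>\<^bsub>completion M s\<^esub> completion_class M s Y =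
    completion_class M s (\<lambda>n. X n \<otimes> Y n)"
proof -
  interpret C: comm_group "cauchy_group M s" by (rule comm_group_cauchy_group)
  interpret N: normal "null_seqs M s" "cauchy_group M s"
    by (rule C.subgroup_imp_normal[OF subgroup_null_seqs])
  show ?thesis using N.rcos_sum[of X Y] assms by (simp add: completion_def completion_class_def)
qed

lemma completion_class_eq_iff:
  assumes "X \<in> cauchy_seqs M s" "Y \<in> cauchy_seqs M s"
  shows "completion_class M s X = completion_class M s Y \<longleftrightarrow> (\<lambda>n. X n \<otimes> inv (Y n)) \<in> null_seqs M s"
  using comm_group.rcoset_eq_iff[OF comm_group_cauchy_group subgroup_null_seqs] assms
  by (simp add: completion_class_def inv_cauchy_group)

lemma completion_class_eq_one_iff:
  assumes "X \<in> cauchy_seqs M s"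
  shows "completion_class M s X = \<one>\<^bsub>completion M s\<^esub> \<longleftrightarrow> X \<in> null_seqs M s"
proof -
  interpret C: comm_group "cauchy_group M s" by (rule comm_group_cauchy_group)
  have "\<one>\<^bsub>completion M s\<^esub> = completion_class M s (\<lambda>n. \<one>)"
    using C.coset_join2[OF _ subgroup_null_seqs null_seqs_one] C.one_closed
    by (simp add: completion_def completion_class_def)
  then show ?thesis
    using completion_class_eq_iff[OF assms cauchy_seqs_const[OF one_closed]] cauchy_seqs_closed[OF assms]
    by simp
qed

end

lemma bounded_hom_cauchy:
  assumes "Z_seminormed M s" "Z_seminormed M' s'" "f \<in> hom M M'"
    and bound: "\<And>x. x \<in> carrier M \<Longrightarrow> s' (f x) \<le> c * s x" and X: "X \<in> cauchy_seqs M s"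
  shows "(\<lambda>n. f (X n)) \<in> cauchy_seqs M' s'"
proof -
  interpret M: Z_seminormed M s by fact
  interpret M': Z_seminormed M' s' by fact
  interpret f: group_hom M M' f using assms by unfold_locales
  note cl = M.cauchy_seqs_closed[OF X]
  show ?thesis
  proof (rule M'.cauchy_seqsI)
    show "f (X n) \<in> carrier M'" for n using cl by simp
    fix \<epsilon> :: real assume \<epsilon>: "0 < \<epsilon>"
    \<comment> \<open>The constant \<open>c\<close> may be zero or negative, while the estimate
      divides by it.\<close>
    define C where "C = max c 1"
    have C: "1 \<le> C" "c \<le> C" by (auto simp: C_def)
    have "0 < \<epsilon> / C" using \<epsilon> C by simp
    then obtain N where N: "\<And>m n. \<lbrakk>m \<ge> N; n \<ge> N\<rbrakk> \<Longrightarrow> s (X m \<otimes>\<^bsub>M\<^esub> inv\<^bsub>M\<^esub> X n) < \<epsilon> / C"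
      using M.cauchy_seqsD[OF X] by blast
    have "s' (f (X m) \<otimes>\<^bsub>M'\<^esub> inv\<^bsub>M'\<^esub> f (X n)) < \<epsilon>" if "m \<ge> N" "n \<ge> N" for m n
    proof -
      let ?x = "X m \<otimes>\<^bsub>M\<^esub> inv\<^bsub>M\<^esub> X n"
      have x: "?x \<in> carrier M" using cl by simp
      have "s' (f ?x) \<le> c * s ?x" by (rule bound[OF x])
      also have "\<dots> \<le> C * s ?x" using C M.seminorm_nonneg[OF x] by (intro mult_right_mono)
      also have "\<dots> < C * (\<epsilon> / C)" using C N[OF that] by (intro mult_strict_left_mono) auto
      finally show ?thesis using C cl by simp
    qed
    then show "\<exists>N. \<forall>m\<ge>N. \<forall>n\<ge>N. s' (f (X m) \<otimes>\<^bsub>M'\<^esub> inv\<^bsub>M'\<^esub> f (X n)) < \<epsilon>" by blast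
  qed
qed

lemma bounded_hom_null:
  assumes "Z_seminormed M s" "Z_seminormed M' s'" "f \<in> hom M M'"
    and bound: "\<And>x. x \<in> carrier M \<Longrightarrow> s' (f x) \<le> c * s x" and X: "X \<in> null_seqs M s"
  shows "(\<lambda>n. f (X n)) \<in> null_seqs M' s'"
proof -
  interpret M: Z_seminormed M s by fact
  interpret M': Z_seminormed M' s' by fact
  interpret f: group_hom M M' f using assms by unfold_locales
  note cl = M.null_seqs_cauchy[OF X, THEN M.cauchy_seqs_closed]
  show ?thesis
  proof (rule M'.null_seqsI)
    show "f (X n) \<in> carrier M'" for n using cl by simp
    have "(\<lambda>n. c * s (X n)) \<longlonglongrightarrow> 0" using tendsto_mult_right_zero[OF M.null_seqsD[OF X]] .
    then show "(\<lambda>n. s' (f (X n))) \<longlonglongrightarrow> 0"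
      by (rule tendsto_sandwich[OF _ _ tendsto_const, rotated 2])
        (auto simp: cl bound M'.seminorm_nonneg)
  qed
qed

text \<open>Bounded homomorphisms preserve Cauchy and null sequences, so the induced map acts
  termwise on any representative; maps between completions are computed through this.\<close>

lemma completion_map_class:
  assumes M: "Z_seminormed M s" and M': "Z_seminormed M' s'" and f: "f \<in> hom M M'"
    and bound: "\<And>x. x \<in> carrier M \<Longrightarrow> s' (f x) \<le> c * s x" and X: "X \<in> cauchy_seqs M s"
  shows "completion_map M' s' f (completion_class M s X) = completion_class M' s' (\<lambda>n. f (X n))"
proof -
  interpret M: Z_seminormed M s by fact
  interpret M': Z_seminormed M' s' by fact
  show ?thesis
    unfolding completion_map_def completion_class_def
  proof (rule quotient_map_rcoset)
    show "subgroup (null_seqs M' s') (cauchy_group M' s')" by (rule M'.subgroup_null_seqs)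
    show "group (cauchy_group M' s')" using M'.comm_group_cauchy_group by (rule comm_group.axioms(2))
    show "null_seqs M s \<noteq> {}" using M.null_seqs_one by blast
    show "(\<lambda>n. f (X n)) \<in> carrier (cauchy_group M' s')"
      using bounded_hom_cauchy[OF M M' f bound X] by simp
    fix Z assume Z: "Z \<in> null_seqs M s"
    then show "(\<lambda>n. f (Z n)) \<in> null_seqs M' s' \<and>
      (\<lambda>n. f ((Z \<otimes>\<^bsub>cauchy_group M s\<^esub> X) n)) = (\<lambda>n. f (Z n)) \<otimes>\<^bsub>cauchy_group M' s'\<^esub> (\<lambda>n. f (X n))"
      using bounded_hom_null[OF M M' f bound Z] f M.cauchy_seqs_closed[OF X]
        M.null_seqs_cauchy[OF Z, THEN M.cauchy_seqs_closed]
      by (auto simp: hom_def)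
  qed
qed

section \<open>Comparison maps in homology\<close>

locale chain_complex =
  fixes A :: "nat \<Rightarrow> 'a monoid" and d :: "nat \<Rightarrow> 'a \<Rightarrow> 'a"
  assumes comm_group: "\<And>n. comm_group (A n)"
    and d_hom: "\<And>n. d (Suc n) \<in> hom (A (Suc n)) (A n)"
    and d_d: "\<And>n x. x \<in> carrier (A (Suc (Suc n))) \<Longrightarrow> d (Suc n) (d (Suc (Suc n)) x) = \<one>\<^bsub>A n\<^esub>"
begin

lemma group: "group (A n)"
  using comm_group by (rule comm_group.axioms(2))

lemma d_group_hom: "group_hom (A (Suc n)) (A n) (d (Suc n))"
  by (simp add: group_hom_def group_hom_axioms_def group d_hom)

lemma in_cycles_iff:
  "x \<in> cycles A d n \<longleftrightarrow> x \<in> carrier (A n) \<and> (\<forall>m. n = Suc m \<longrightarrow> d n x = \<one>\<^bsub>A m\<^esub>)"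
  by (cases n) (auto simp: cycles_def kernel_def)

lemma subgroup_cycles: "subgroup (cycles A d n) (A n)"
proof (cases n)
  case 0
  then show ?thesis by (simp add: cycles_def group.subgroup_self group)
next
  case (Suc m)
  then show ?thesis using group_hom.subgroup_kernel[OF d_group_hom] by (simp add: cycles_def)
qed

lemma boundaries_subset: "boundaries A d n \<subseteq> cycles A d n"
  using d_d d_hom[THEN hom_in_carrier] by (auto simp: boundaries_def in_cycles_iff)

lemma subgroup_boundaries: "subgroup (boundaries A d n) (A n)"
  unfolding boundaries_def using group_hom.img_is_subgroup[OF d_group_hom] .

lemma group_cycles: "group ((A n)\<lparr>carrier := cycles A d n\<rparr>)"
  by (rule group.subgroup_imp_group[OF group subgroup_cycles])

lemma subgroup_boundaries_cycles: "subgroup (boundaries A d n) ((A n)\<lparr>carrier := cycles A d n\<rparr>)"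
  by (rule group.subgroup_incl[OF group subgroup_boundaries subgroup_cycles boundaries_subset])

lemma carrier_homology:
  "carrier (homology A d n) = (\<lambda>a. boundaries A d n #>\<^bsub>A n\<^esub> a) ` cycles A d n"
  by (simp add: homology_def carrier_FactGroup)

end

lemma homology_map_class:
  assumes "chain_complex A' d'" "chain_complex A d"
    and f: "\<And>n. f n \<in> hom (A' n) (A n)"
    and comm: "\<And>n x. x \<in> carrier (A' (Suc n)) \<Longrightarrow> f n (d' (Suc n) x) = d (Suc n) (f (Suc n) x)"
    and a: "a \<in> cycles A' d' n"
  shows "homology_map A d f n (boundaries A' d' n #>\<^bsub>A' n\<^esub> a) = boundaries A d n #>\<^bsub>A n\<^esub> f n a"
proof -
  interpret A': chain_complex A' d' by fact
  interpret A: chain_complex A d by fact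
  have f_one: "f m \<one>\<^bsub>A' m\<^esub> = \<one>\<^bsub>A m\<^esub>" for m
    using hom_one[OF f A'.group A.group] .
  have "f n a \<in> cycles A d n"
    using a f[THEN hom_in_carrier] comm f_one by (auto simp: A.in_cycles_iff A'.in_cycles_iff) metis
  moreover have "f n k \<in> boundaries A d n \<and> f n (k \<otimes>\<^bsub>A' n\<^esub> a) = f n k \<otimes>\<^bsub>A n\<^esub> f n a"
    if k: "k \<in> boundaries A' d' n" for k
  proof -
    have "k \<in> carrier (A' n)" "a \<in> carrier (A' n)"
      using subsetD[OF A'.boundaries_subset k] a by (auto simp: A'.in_cycles_iff)
    moreover have "f n k \<in> boundaries A d n"
      using k comm f[THEN hom_in_carrier] by (auto simp: boundaries_def)
    ultimately show ?thesis by (simp add: hom_mult[OF f])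
  qed
  moreover have "boundaries A' d' n \<noteq> {}"
    using A'.subgroup_boundaries[THEN subgroup.one_closed] by auto
  ultimately show ?thesis
    unfolding homology_map_def
    using quotient_map_rcoset[OF A.subgroup_boundaries_cycles[of n] A.group_cycles[of n],
      where f = "f n" and a = a and G = "A' n" and K = "boundaries A' d' n"]
    by simp
qed

lemma completion_map_hom:
  assumes M: "Z_seminormed M s" and M': "Z_seminormed M' s'" and f: "f \<in> hom M M'"
    and bound: "\<And>x. x \<in> carrier M \<Longrightarrow> s' (f x) \<le> c * s x"
  shows "completion_map M' s' f \<in> hom (completion M s) (completion M' s')"
proof (rule homI)
  interpret M: Z_seminormed M s by fact
  interpret M': Z_seminormed M' s' by fact
  note cls = completion_map_class[OF M M' f bound] and cau = bounded_hom_cauchy[OF M M' f bound]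
  fix x assume "x \<in> carrier (completion M s)"
  then obtain X where X: "X \<in> cauchy_seqs M s" "x = completion_class M s X"
    by (auto simp: M.carrier_completion)
  then show "completion_map M' s' f x \<in> carrier (completion M' s')"
    using cls cau by (simp add: M'.completion_class_closed)
  fix y assume "y \<in> carrier (completion M s)"
  then obtain Y where Y: "Y \<in> cauchy_seqs M s" "y = completion_class M s Y"
    by (auto simp: M.carrier_completion)
  have "(\<lambda>n. f (X n \<otimes>\<^bsub>M\<^esub> Y n)) = (\<lambda>n. f (X n) \<otimes>\<^bsub>M'\<^esub> f (Y n))"
    using hom_mult[OF f] M.cauchy_seqs_closed X Y by auto
  then show "completion_map M' s' f (x \<otimes>\<^bsub>completion M s\<^esub> y) =
      completion_map M' s' f x \<otimes>\<^bsub>completion M' s'\<^esub> completion_map M' s' f y"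
    using X Y cls cau by (simp add: M.completion_class_mult M'.completion_class_mult M.cauchy_seqs_mult)
qed

section \<open>The completion of a seminormed complex\<close>

locale seminormed_complex = chain_complex +
  fixes s :: "nat \<Rightarrow> 'a \<Rightarrow> real"
  assumes seminormed: "\<And>n. Z_seminormed (A n) (s n)"
    and d_bounded: "\<And>n. \<exists>c. \<forall>x\<in>carrier (A (Suc n)). s n (d (Suc n) x) \<le> c * s (Suc n) x"
begin

definition hat :: "nat \<Rightarrow> (nat \<Rightarrow> 'a) set monoid" where
  "hat n = completion (A n) (s n)"

definition hat_d :: "nat \<Rightarrow> (nat \<Rightarrow> 'a) set \<Rightarrow> (nat \<Rightarrow> 'a) set" where
  "hat_d n = completion_map (A (n - 1)) (s (n - 1)) (d n)"

abbreviation "cls n \<equiv> completion_class (A n) (s n)"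

lemma d_cauchy:
  assumes "X \<in> cauchy_seqs (A (Suc n)) (s (Suc n))"
  shows "(\<lambda>k. d (Suc n) (X k)) \<in> cauchy_seqs (A n) (s n)"
proof -
  obtain c where "\<And>x. x \<in> carrier (A (Suc n)) \<Longrightarrow> s n (d (Suc n) x) \<le> c * s (Suc n) x"
    using d_bounded[of n] by blast
  from bounded_hom_cauchy[OF seminormed seminormed d_hom this assms] show ?thesis .
qed

lemma hat_d_class:
  assumes "X \<in> cauchy_seqs (A (Suc n)) (s (Suc n))"
  shows "hat_d (Suc n) (cls (Suc n) X) = cls n (\<lambda>k. d (Suc n) (X k))"
proof -
  obtain c where "\<And>x. x \<in> carrier (A (Suc n)) \<Longrightarrow> s n (d (Suc n) x) \<le> c * s (Suc n) x"
    using d_bounded[of n] by blast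
  from completion_map_class[OF seminormed seminormed d_hom this assms] show ?thesis
    by (simp add: hat_d_def)
qed

sublocale hat: chain_complex hat hat_d
proof (rule chain_complex.intro)
  fix n
  show "comm_group (hat n)"
    unfolding hat_def by (rule Z_seminormed.comm_group_completion[OF seminormed])
  obtain c where "\<And>x. x \<in> carrier (A (Suc n)) \<Longrightarrow> s n (d (Suc n) x) \<le> c * s (Suc n) x"
    using d_bounded[of n] by blast
  from completion_map_hom[OF seminormed seminormed d_hom this]
  show "hat_d (Suc n) \<in> hom (hat (Suc n)) (hat n)" by (simp add: hat_d_def hat_def)
next
  fix n x assume "x \<in> carrier (hat (Suc (Suc n)))"
  then obtain X where X: "X \<in> cauchy_seqs (A (Suc (Suc n))) (s (Suc (Suc n)))" "x = cls (Suc (Suc n)) X"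
    by (auto simp: hat_def Z_seminormed.carrier_completion[OF seminormed])
  have "d (Suc n) (d (Suc (Suc n)) (X k)) = \<one>\<^bsub>A n\<^esub>" for k
    by (rule d_d) (rule Z_seminormed.cauchy_seqs_closed[OF seminormed X(1)])
  then have "hat_d (Suc n) (hat_d (Suc (Suc n)) x) = cls n (\<lambda>k. \<one>\<^bsub>A n\<^esub>)"
    using X by (simp add: hat_d_class d_cauchy)
  also have "\<dots> = \<one>\<^bsub>hat n\<^esub>"
    unfolding hat_def
    by (subst Z_seminormed.completion_class_eq_one_iff[OF seminormed])
      (auto intro: Z_seminormed.null_seqs_one[OF seminormed] Z_seminormed.null_seqs_cauchy[OF seminormed])
  finally show "hat_d (Suc n) (hat_d (Suc (Suc n)) x) = \<one>\<^bsub>hat n\<^esub>" .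
qed

text \<open>A cycle of the completed complex need not be represented by cycles: the boundaries of
  its representatives only tend to zero.\<close>

lemma cls_in_cycles_iff:
  assumes X: "X \<in> cauchy_seqs (A n) (s n)"
  shows "cls n X \<in> cycles hat hat_d n \<longleftrightarrow>
    (\<forall>m. n = Suc m \<longrightarrow> (\<lambda>k. d n (X k)) \<in> null_seqs (A m) (s m))"
proof -
  have "cls n X \<in> carrier (hat n)"
    unfolding hat_def by (rule Z_seminormed.completion_class_closed[OF seminormed X])
  moreover have "hat_d n (cls n X) = \<one>\<^bsub>hat m\<^esub> \<longleftrightarrow> (\<lambda>k. d n (X k)) \<in> null_seqs (A m) (s m)"
    if "n = Suc m" for m
    using X that by (simp add: hat_d_class hat_def d_cauchy Z_seminormed.completion_class_eq_one_iff[OF seminormed])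
  ultimately show ?thesis by (auto simp: hat.in_cycles_iff)
qed

lemma can_hom: "(\<lambda>x. cls n (\<lambda>_. x)) \<in> hom (A n) (hat n)"
  by (rule homI)
    (simp_all add: hat_def Z_seminormed.completion_class_closed[OF seminormed]
      Z_seminormed.completion_class_mult[OF seminormed] Z_seminormed.cauchy_seqs_const[OF seminormed])

lemma can_in_cycles:
  assumes "a \<in> cycles A d n" shows "cls n (\<lambda>_. a) \<in> cycles hat hat_d n"
  using assms Z_seminormed.null_seqs_one[OF seminormed]
  by (subst cls_in_cycles_iff) (auto simp: in_cycles_iff Z_seminormed.cauchy_seqs_const[OF seminormed])

lemma comparison_class:
  assumes "a \<in> cycles A d n"
  shows "homology_map hat hat_d (\<lambda>n x. cls n (\<lambda>_. x)) n (boundaries A d n #>\<^bsub>A n\<^esub> a) =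
    boundaries hat hat_d n #>\<^bsub>hat n\<^esub> cls n (\<lambda>_. a)"
  by (rule homology_map_class[OF chain_complex_axioms hat.chain_complex_axioms can_hom _ assms])
    (simp add: hat_d_class Z_seminormed.cauchy_seqs_const[OF seminormed])

end

text \<open>The homological reduction. One inclusion holds since a constant sequence at an algebraic
  cycle is a cycle for both completions. For the other, \<open>approx\<close> makes a cycle for
  \<open>t\<close> equal, in the completion for \<open>s\<close>, to the class of an algebraic cycle
  plus a boundary. The map \<open>j\<close> stands for the identity on carriers, which is given
  below as a tensor map.\<close>

theorem comparison_images_eq:
  assumes "seminormed_complex A d s" "seminormed_complex A d t"
    and le: "\<And>n x. x \<in> carrier (A n) \<Longrightarrow> s n x \<le> t n x"
    and j: "\<And>n x. x \<in> carrier (A n) \<Longrightarrow> j n x = x"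
    and approx: "\<And>X. \<lbrakk>X \<in> cauchy_seqs (A n) (t n);
        \<And>m. n = Suc m \<Longrightarrow> (\<lambda>k. d n (X k)) \<in> null_seqs (A m) (t m)\<rbrakk> \<Longrightarrow>
        \<exists>a\<in>cycles A d n. \<exists>Y\<in>cauchy_seqs (A (Suc n)) (s (Suc n)).
          (\<lambda>k. X k \<otimes>\<^bsub>A n\<^esub> inv\<^bsub>A n\<^esub> (d (Suc n) (Y k) \<otimes>\<^bsub>A n\<^esub> a)) \<in> null_seqs (A n) (s n)"
  defines "B \<equiv> \<lambda>n. completion (A n) (s n)" and "D \<equiv> \<lambda>n. completion_map (A (n - 1)) (s (n - 1)) (d n)"
    and "B' \<equiv> \<lambda>n. completion (A n) (t n)" and "D' \<equiv> \<lambda>n. completion_map (A (n - 1)) (t (n - 1)) (d n)"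
  shows "homology_map B D (\<lambda>n x. completion_class (A n) (s n) (\<lambda>_. x)) n ` carrier (homology A d n) =
    homology_map B D (\<lambda>n. completion_map (A n) (s n) (j n)) n ` carrier (homology B' D' n)"
proof -
  interpret S: seminormed_complex A d s by fact
  interpret T: seminormed_complex A d t by fact
  have BD: "B = S.hat" "D = S.hat_d" "B' = T.hat" "D' = T.hat_d"
    by (simp_all add: fun_eq_iff B_def D_def B'_def D'_def S.hat_def S.hat_d_def T.hat_def T.hat_d_def)
  have j_hom: "j n \<in> hom (A n) (A n)" for n
    by (rule homI) (simp_all add: j monoid.m_closed[OF group.is_monoid[OF S.group]])
  have j_bound: "s n (j n x) \<le> 1 * t n x" if "x \<in> carrier (A n)" for n x
    using le[OF that] j[OF that] by simp
  let ?\<iota> = "\<lambda>n. completion_map (A n) (s n) (j n)"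
  \<comment> \<open>On representatives the comparison map is the identity, because a Cauchy sequence
    for \<open>t\<close> is one for the smaller seminorm \<open>s\<close>.\<close>
  have \<iota>_cls: "?\<iota> n (T.cls n X) = S.cls n X" and cau: "X \<in> cauchy_seqs (A n) (s n)"
    if X: "X \<in> cauchy_seqs (A n) (t n)" for n X
  proof -
    have "(\<lambda>k. j n (X k)) = X"
      using Z_seminormed.cauchy_seqs_closed[OF T.seminormed X] j by auto
    then show "?\<iota> n (T.cls n X) = S.cls n X" "X \<in> cauchy_seqs (A n) (s n)"
      using completion_map_class[OF T.seminormed S.seminormed j_hom j_bound X]
        bounded_hom_cauchy[OF T.seminormed S.seminormed j_hom j_bound X] by simp_all
  qed
  have \<iota>_hom: "?\<iota> n \<in> hom (T.hat n) (S.hat n)" for n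
    unfolding S.hat_def T.hat_def by (rule completion_map_hom[OF T.seminormed S.seminormed j_hom j_bound])
  have \<iota>_d: "?\<iota> n (T.hat_d (Suc n) x) = S.hat_d (Suc n) (?\<iota> (Suc n) x)" if x: "x \<in> carrier (T.hat (Suc n))" for n x
  proof -
    obtain X where X: "X \<in> cauchy_seqs (A (Suc n)) (t (Suc n))" "x = T.cls (Suc n) X"
      using x by (auto simp: T.hat_def Z_seminormed.carrier_completion[OF T.seminormed])
    then show ?thesis by (simp add: T.hat_d_class S.hat_d_class \<iota>_cls T.d_cauchy cau)
  qed
  note sob = homology_map_class[where f = ?\<iota>, OF T.hat.chain_complex_axioms S.hat.chain_complex_axioms \<iota>_hom \<iota>_d]
  let ?N = "\<lambda>x. boundaries S.hat S.hat_d n #>\<^bsub>S.hat n\<^esub> x"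
  have "homology_map B D (\<lambda>n x. completion_class (A n) (s n) (\<lambda>_. x)) n ` carrier (homology A d n) =
      (\<lambda>a. ?N (S.cls n (\<lambda>_. a))) ` cycles A d n"
    unfolding BD S.carrier_homology image_image
    by (rule image_cong[OF refl S.comparison_class])
  also have "\<dots> = (\<lambda>x. ?N (?\<iota> n x)) ` cycles T.hat T.hat_d n"
  proof (intro equalityI subsetI)
    fix y assume "y \<in> (\<lambda>a. ?N (S.cls n (\<lambda>_. a))) ` cycles A d n"
    then obtain a where a: "a \<in> cycles A d n" "y = ?N (S.cls n (\<lambda>_. a))" by blast
    have "a \<in> carrier (A n)" using a(1) by (simp add: S.in_cycles_iff)
    then have "y = ?N (?\<iota> n (T.cls n (\<lambda>_. a)))"
      using a(2) \<iota>_cls[OF Z_seminormed.cauchy_seqs_const[OF T.seminormed]] by simp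
    then show "y \<in> (\<lambda>x. ?N (?\<iota> n x)) ` cycles T.hat T.hat_d n"
      using T.can_in_cycles[OF a(1)] by blast
  next
    fix y assume "y \<in> (\<lambda>x. ?N (?\<iota> n x)) ` cycles T.hat T.hat_d n"
    then obtain x where x: "x \<in> cycles T.hat T.hat_d n" "y = ?N (?\<iota> n x)" by blast
    then obtain X where X: "X \<in> cauchy_seqs (A n) (t n)" "x = T.cls n X"
      by (auto simp: T.hat.in_cycles_iff T.hat_def Z_seminormed.carrier_completion[OF T.seminormed])
    have "(\<lambda>k. d n (X k)) \<in> null_seqs (A m) (t m)" if "n = Suc m" for m
      using x(1) X that by (simp add: T.cls_in_cycles_iff)
    then obtain a Y where a: "a \<in> cycles A d n" and Y: "Y \<in> cauchy_seqs (A (Suc n)) (s (Suc n))"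
      and null: "(\<lambda>k. X k \<otimes>\<^bsub>A n\<^esub> inv\<^bsub>A n\<^esub> (d (Suc n) (Y k) \<otimes>\<^bsub>A n\<^esub> a)) \<in> null_seqs (A n) (s n)"
      using approx[OF X(1)] by blast
    interpret Sn: Z_seminormed "A n" "s n" by (rule S.seminormed)
    have aA: "(\<lambda>_. a) \<in> cauchy_seqs (A n) (s n)"
      using a by (intro Sn.cauchy_seqs_const) (simp add: S.in_cycles_iff)
    have dY: "(\<lambda>k. d (Suc n) (Y k)) \<in> cauchy_seqs (A n) (s n)" by (rule S.d_cauchy[OF Y])
    have "?\<iota> n x = S.cls n X" using X by (simp add: \<iota>_cls)
    also have "\<dots> = S.cls n (\<lambda>k. d (Suc n) (Y k) \<otimes>\<^bsub>A n\<^esub> a)"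
      using null Sn.completion_class_eq_iff[OF cau[OF X(1)] Sn.cauchy_seqs_mult[OF dY aA]] by simp
    also have "\<dots> = S.hat_d (Suc n) (S.cls (Suc n) Y) \<otimes>\<^bsub>S.hat n\<^esub> S.cls n (\<lambda>_. a)"
      using Sn.completion_class_mult[OF dY aA] by (simp add: S.hat_d_class[OF Y] S.hat_def)
    finally have "?\<iota> n x \<in> ?N (S.cls n (\<lambda>_. a))"
      using Z_seminormed.completion_class_closed[OF S.seminormed Y]
      by (auto simp: r_coset_def boundaries_def S.hat_def)
    moreover have "S.cls n (\<lambda>_. a) \<in> carrier (S.hat n)"
      unfolding S.hat_def by (rule Sn.completion_class_closed[OF aA])
    ultimately have "?N (S.cls n (\<lambda>_. a)) = ?N (?\<iota> n x)"
      using group.repr_independence[OF S.hat.group _ _ S.hat.subgroup_boundaries] by blast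
    then show "y \<in> (\<lambda>a. ?N (S.cls n (\<lambda>_. a))) ` cycles A d n" using a x(2) by blast
  qed
  also have "\<dots> = homology_map B D ?\<iota> n ` carrier (homology B' D' n)"
    unfolding BD T.hat.carrier_homology image_image
    by (rule image_cong[OF refl sob[symmetric]])
  finally show ?thesis .
qed

section \<open>Tensor products and the projective seminorm\<close>

locale tensor_pair = M: comm_group M + N: comm_group N
  for R :: "('r, 'x) ring_scheme" and M :: "('m, 'y) monoid_scheme" and ract :: "'m \<Rightarrow> 'r \<Rightarrow> 'm"
    and N :: "('n, 'z) monoid_scheme" and act :: "'r \<Rightarrow> 'n \<Rightarrow> 'n" +
  assumes ract_closed: "\<lbrakk>r \<in> carrier R; u \<in> carrier M\<rbrakk> \<Longrightarrow> ract u r \<in> carrier M"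
    and act_closed: "\<lbrakk>r \<in> carrier R; v \<in> carrier N\<rbrakk> \<Longrightarrow> act r v \<in> carrier N"
begin

abbreviation "T \<equiv> tensor R M ract N act"
abbreviation "F \<equiv> free_Abelian_group (carrier M \<times> carrier N)"
abbreviation "K \<equiv> tensor_kernel R M ract N act"
abbreviation "pt \<equiv> pure_tensor R M ract N act"
abbreviation "rel \<equiv> tensor_relations R M ract N act"

lemma comm_group_F: "comm_group F"
  by (rule abelian_free_Abelian_group)

lemma rel_closed: "rel \<subseteq> carrier F"
proof
  fix c assume "c \<in> rel"
  moreover have "frag_of p - frag_of q - frag_of r \<in> carrier F"
    if "p \<in> carrier M \<times> carrier N" "q \<in> carrier M \<times> carrier N" "r \<in> carrier M \<times> carrier N" for p q r
    using that keys_diff[of "frag_of p - frag_of q" "frag_of r"] keys_diff[of "frag_of p" "frag_of q"]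
    by (simp add: subset_iff) blast
  moreover have "frag_of p - frag_of q \<in> carrier F"
    if "p \<in> carrier M \<times> carrier N" "q \<in> carrier M \<times> carrier N" for p q
    using that keys_diff[of "frag_of p" "frag_of q"] by (simp add: subset_iff) blast
  ultimately show "c \<in> carrier F"
    unfolding tensor_relations_def by (auto simp only: ract_closed act_closed M.m_closed N.m_closed SigmaI)
qed

lemma subgroup_K: "subgroup K F"
  unfolding tensor_kernel_def by (rule group.generate_is_subgroup[OF _ rel_closed]) simp

lemma rel_subset_K: "rel \<subseteq> K"
  unfolding tensor_kernel_def by (auto intro: generate.incl)

lemma K_subset:
  assumes "subgroup H F" "rel \<subseteq> H" shows "K \<subseteq> H"
  unfolding tensor_kernel_def by (rule group.generate_subgroup_incl[OF _ assms(2,1)]) simp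

sublocale T: comm_group T
  unfolding tensor_def by (rule comm_group.abelian_FactGroup[OF comm_group_F subgroup_K])

definition cls :: "('m \<times> 'n \<Rightarrow>\<^sub>0 int) \<Rightarrow> ('m \<times> 'n \<Rightarrow>\<^sub>0 int) set" where
  "cls c = K #>\<^bsub>F\<^esub> c"

lemma carrier_T: "carrier T = cls ` carrier F"
  by (simp add: tensor_def carrier_FactGroup cls_def[abs_def])

lemma cls_hom: "cls \<in> hom F T"
proof -
  have "K \<lhd> F" by (rule comm_group.subgroup_imp_normal[OF comm_group_F subgroup_K])
  from normal.r_coset_hom_Mod[OF this] show ?thesis
    by (simp add: tensor_def cls_def[abs_def])
qed

sublocale cls: group_hom F T cls
  by (simp add: group_hom_def group_hom_axioms_def cls_hom)

lemma cls_eq_one_iff: "c \<in> carrier F \<Longrightarrow> cls c = \<one>\<^bsub>T\<^esub> \<longleftrightarrow> c \<in> K"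
  using group.coset_join1[of F K c] group.coset_join2[of F c K] subgroup_K subgroup.subset[OF subgroup_K]
  by (auto simp: cls_def tensor_def)

lemma pt_eq_cls: "pt u v = cls (frag_of (u, v))"
  by (simp add: pure_tensor_def cls_def)

lemma pt_closed [simp]: "\<lbrakk>u \<in> carrier M; v \<in> carrier N\<rbrakk> \<Longrightarrow> pt u v \<in> carrier T"
  unfolding pt_eq_cls by (rule cls.hom_closed) simp

lemma cls_minus: "c \<in> carrier F \<Longrightarrow> cls (- c) = inv\<^bsub>T\<^esub> cls c"
  using cls.hom_inv[of c] by simp

lemma cls_diff: "\<lbrakk>a \<in> carrier F; b \<in> carrier F\<rbrakk> \<Longrightarrow> cls (a - b) = cls a \<otimes>\<^bsub>T\<^esub> inv\<^bsub>T\<^esub> cls b"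
  using cls.hom_mult[of a "- b"] cls_minus[of b] by simp

lemma diff_closed: "\<lbrakk>a \<in> carrier F; b \<in> carrier F\<rbrakk> \<Longrightarrow> a - b \<in> carrier F"
  using keys_diff[of a b] by auto

lemma F_mult_closed: "\<lbrakk>a \<in> carrier F; b \<in> carrier F\<rbrakk> \<Longrightarrow> a \<otimes>\<^bsub>F\<^esub> b \<in> carrier F"
  by (rule monoid.m_closed[OF group.is_monoid[OF group_free_Abelian_group]])

lemma cls_eqI: "\<lbrakk>a \<in> carrier F; b \<in> carrier F; a - b \<in> rel\<rbrakk> \<Longrightarrow> cls a = cls b"
  using comm_group.rcoset_eq_iff[OF comm_group_F subgroup_K, of a b] subsetD[OF rel_subset_K, of "a - b"]
  by (simp add: cls_def)

lemma pt_mult_left: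
  assumes "u \<in> carrier M" "u' \<in> carrier M" "v \<in> carrier N"
  shows "pt (u \<otimes>\<^bsub>M\<^esub> u') v = pt u v \<otimes>\<^bsub>T\<^esub> pt u' v"
proof -
  let ?a = "frag_of (u, v)" and ?b = "frag_of (u', v)" and ?c = "frag_of (u \<otimes>\<^bsub>M\<^esub> u', v)"
  have F: "?a \<in> carrier F" "?b \<in> carrier F" "?c \<in> carrier F"
    using assms by auto
  have "?c - (?a + ?b) \<in> rel"
    unfolding diff_diff_eq[symmetric] tensor_relations_def using assms by blast
  then have "cls ?c = cls (?a \<otimes>\<^bsub>F\<^esub> ?b)" using F F_mult_closed[OF F(1,2)] by (intro cls_eqI) simp_all
  then show ?thesis using cls.hom_mult[OF F(1,2)] by (simp only: pt_eq_cls)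
qed

lemma pt_mult_right:
  assumes "u \<in> carrier M" "v \<in> carrier N" "v' \<in> carrier N"
  shows "pt u (v \<otimes>\<^bsub>N\<^esub> v') = pt u v \<otimes>\<^bsub>T\<^esub> pt u v'"
proof -
  let ?a = "frag_of (u, v)" and ?b = "frag_of (u, v')" and ?c = "frag_of (u, v \<otimes>\<^bsub>N\<^esub> v')"
  have F: "?a \<in> carrier F" "?b \<in> carrier F" "?c \<in> carrier F"
    using assms by auto
  have "?c - (?a + ?b) \<in> rel"
    unfolding diff_diff_eq[symmetric] tensor_relations_def using assms by blast
  then have "cls ?c = cls (?a \<otimes>\<^bsub>F\<^esub> ?b)" using F F_mult_closed[OF F(1,2)] by (intro cls_eqI) simp_all
  then show ?thesis using cls.hom_mult[OF F(1,2)] by (simp only: pt_eq_cls)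
qed

lemma pt_balanced:
  assumes "u \<in> carrier M" "r \<in> carrier R" "v \<in> carrier N"
  shows "pt (ract u r) v = pt u (act r v)"
proof -
  have "frag_of (ract u r, v) - frag_of (u, act r v) \<in> rel"
    unfolding tensor_relations_def using assms by blast
  then show ?thesis
    unfolding pt_eq_cls using assms ract_closed act_closed by (intro cls_eqI) auto
qed

lemma pt_left_hom: "v \<in> carrier N \<Longrightarrow> (\<lambda>u. pt u v) \<in> hom M T"
  by (rule homI) (simp_all add: pt_mult_left)

lemma pt_right_hom: "u \<in> carrier M \<Longrightarrow> (\<lambda>v. pt u v) \<in> hom N T"
  by (rule homI) (simp_all add: pt_mult_right)

lemma tensor_induct [consumes 1, case_names one pure diff]:
  assumes "x \<in> carrier T" and "P \<one>\<^bsub>T\<^esub>"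
    and "\<And>u v. \<lbrakk>u \<in> carrier M; v \<in> carrier N\<rbrakk> \<Longrightarrow> P (pt u v)"
    and "\<And>x y. \<lbrakk>x \<in> carrier T; y \<in> carrier T; P x; P y\<rbrakk> \<Longrightarrow> P (x \<otimes>\<^bsub>T\<^esub> inv\<^bsub>T\<^esub> y)"
  shows "P x"
proof -
  obtain c where c: "Poly_Mapping.keys c \<subseteq> carrier M \<times> carrier N" "x = cls c"
    using assms(1) by (auto simp: carrier_T)
  have "P (cls c)"
  proof (rule free_Abelian_group_induct[OF c(1), where P = "\<lambda>c. P (cls c)"])
    show "P (cls 0)" using assms(2) cls.hom_one by simp
    show "P (cls (frag_of p))" if "p \<in> carrier M \<times> carrier N" for p
      using assms(3) that by (cases p) (auto simp: pt_eq_cls)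
    show "P (cls (a - b))" if "Poly_Mapping.keys a \<subseteq> carrier M \<times> carrier N"
      "Poly_Mapping.keys b \<subseteq> carrier M \<times> carrier N" "P (cls a)" "P (cls b)" for a b
      using that assms(4)[of "cls a" "cls b"] cls.hom_closed[of a] cls.hom_closed[of b]
      by (simp add: cls_diff)
  qed
  with c show ?thesis by simp
qed

lemma tensor_hom_eqI:
  assumes "group V" "\<phi> \<in> hom T V" "\<psi> \<in> hom T V"
    and "\<And>u v. \<lbrakk>u \<in> carrier M; v \<in> carrier N\<rbrakk> \<Longrightarrow> \<phi> (pt u v) = \<psi> (pt u v)" and x: "x \<in> carrier T"
  shows "\<phi> x = \<psi> x"
proof -
  interpret \<phi>: group_hom T V \<phi> using assms(1,2) by (simp add: group_hom_def group_hom_axioms_def)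
  interpret \<psi>: group_hom T V \<psi> using assms(1,3) by (simp add: group_hom_def group_hom_axioms_def)
  from x show ?thesis by (induction rule: tensor_induct) (simp_all add: assms(4))
qed

text \<open>The linear extension of a balanced biadditive map to the free group kills the defining
  relations, so it factors through the quotient. It is used below to define coordinates with values
  in \<open>E\<close>.\<close>

lemma tensor_universal:
  assumes V: "comm_group V"
    and closed: "\<And>u v. \<lbrakk>u \<in> carrier M; v \<in> carrier N\<rbrakk> \<Longrightarrow> \<beta> u v \<in> carrier V"
    and left: "\<And>u u' v. \<lbrakk>u \<in> carrier M; u' \<in> carrier M; v \<in> carrier N\<rbrakk> \<Longrightarrow>
      \<beta> (u \<otimes>\<^bsub>M\<^esub> u') v = \<beta> u v \<otimes>\<^bsub>V\<^esub> \<beta> u' v"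
    and right: "\<And>u v v'. \<lbrakk>u \<in> carrier M; v \<in> carrier N; v' \<in> carrier N\<rbrakk> \<Longrightarrow>
      \<beta> u (v \<otimes>\<^bsub>N\<^esub> v') = \<beta> u v \<otimes>\<^bsub>V\<^esub> \<beta> u v'"
    and bal: "\<And>u r v. \<lbrakk>u \<in> carrier M; r \<in> carrier R; v \<in> carrier N\<rbrakk> \<Longrightarrow> \<beta> (ract u r) v = \<beta> u (act r v)"
  shows "\<exists>\<psi>. \<psi> \<in> hom T V \<and> (\<forall>u\<in>carrier M. \<forall>v\<in>carrier N. \<psi> (pt u v) = \<beta> u v)"
proof -
  interpret V: comm_group V by fact
  have "(\<lambda>(u, v). \<beta> u v) ` (carrier M \<times> carrier N) \<subseteq> carrier V" using closed by auto
  then obtain h where h: "h \<in> hom F V" "\<And>p. p \<in> carrier M \<times> carrier N \<Longrightarrow> h (frag_of p) = (\<lambda>(u, v). \<beta> u v) p"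
    by (rule V.free_Abelian_group_universal) blast
  interpret h: group_hom F V h using h(1) by (simp add: group_hom_def group_hom_axioms_def V.is_group)
  have h_diff: "h (a - b) = h a \<otimes>\<^bsub>V\<^esub> inv\<^bsub>V\<^esub> h b" if "a \<in> carrier F" "b \<in> carrier F" for a b
    using h.hom_mult[of a "- b"] h.hom_inv[of b] that by simp
  have hp: "h (frag_of (u, v)) = \<beta> u v" "frag_of (u, v) \<in> carrier F" if "u \<in> carrier M" "v \<in> carrier N" for u v
    using h(2)[of "(u, v)"] that by auto
  have 3: "h (a - b - c) = h a \<otimes>\<^bsub>V\<^esub> inv\<^bsub>V\<^esub> h b \<otimes>\<^bsub>V\<^esub> inv\<^bsub>V\<^esub> h c"
    if "a \<in> carrier F" "b \<in> carrier F" "c \<in> carrier F" for a b c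
    using that diff_closed[OF that(1,2)] by (simp only: h_diff)
  have cancel: "x \<otimes>\<^bsub>V\<^esub> y \<otimes>\<^bsub>V\<^esub> inv\<^bsub>V\<^esub> x \<otimes>\<^bsub>V\<^esub> inv\<^bsub>V\<^esub> y = \<one>\<^bsub>V\<^esub>" if "x \<in> carrier V" "y \<in> carrier V" for x y
    using that V.m_comm[of x y] by (simp add: V.m_assoc)
  have "rel \<subseteq> kernel F V h"
  proof
    fix c assume c: "c \<in> rel"
    then have "h c = \<one>\<^bsub>V\<^esub>"
      unfolding tensor_relations_def
    proof (elim UnE CollectE exE conjE)
      fix u u' v assume *: "u \<in> carrier M" "u' \<in> carrier M" "v \<in> carrier N"
        "c = frag_of (u \<otimes>\<^bsub>M\<^esub> u', v) - frag_of (u, v) - frag_of (u', v)"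
      then show ?thesis using 3[OF hp(2) hp(2) hp(2), of "u \<otimes>\<^bsub>M\<^esub> u'" v u v u' v]
        by (simp add: hp left cancel closed)
    next
      fix u v v' assume *: "u \<in> carrier M" "v \<in> carrier N" "v' \<in> carrier N"
        "c = frag_of (u, v \<otimes>\<^bsub>N\<^esub> v') - frag_of (u, v) - frag_of (u, v')"
      then show ?thesis using 3[OF hp(2) hp(2) hp(2), of u "v \<otimes>\<^bsub>N\<^esub> v'" u v u v']
        by (simp add: hp right cancel closed)
    next
      fix u r v assume *: "u \<in> carrier M" "r \<in> carrier R" "v \<in> carrier N"
        "c = frag_of (ract u r, v) - frag_of (u, act r v)"
      then show ?thesis using h_diff[OF hp(2) hp(2), of "ract u r" v u "act r v"]
        by (simp add: hp bal closed ract_closed act_closed)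
    qed
    with subsetD[OF rel_closed c] show "c \<in> kernel F V h" by (simp add: kernel_def)
  qed
  then have kills: "K \<subseteq> kernel F V h" by (rule K_subset[OF h.subgroup_kernel])
  have "\<exists>g. g \<in> hom (F Mod K) V \<and> (\<forall>x\<in>carrier F. g (K #>\<^bsub>F\<^esub> x) = h x)"
  proof (rule FactGroup_universal[OF h(1)])
    show "K \<lhd> F" by (rule comm_group.subgroup_imp_normal[OF comm_group_F subgroup_K])
    fix x y assume xy: "x \<in> carrier F" "y \<in> carrier F" "K #>\<^bsub>F\<^esub> x = K #>\<^bsub>F\<^esub> y"
    then have "x - y \<in> K"
      using comm_group.rcoset_eq_iff[OF comm_group_F subgroup_K xy(1,2)] by simp
    then have "h (x - y) = \<one>\<^bsub>V\<^esub>" using kills by (auto simp: kernel_def)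
    then show "h x = h y"
      using h_diff[OF xy(1,2)] xy h.hom_closed V.inv_solve_right'[of "\<one>\<^bsub>V\<^esub>" "h x" "h y"] by simp
  qed blast
  then obtain g where g: "g \<in> hom T V" "\<And>x. x \<in> carrier F \<Longrightarrow> g (cls x) = h x"
    by (auto simp: tensor_def cls_def)
  then show ?thesis using hp by (intro exI[of _ g]) (simp add: pt_eq_cls)
qed

end

text \<open>Linearity over \<open>R\<close> makes the extension to free groups send defining
  relations to defining relations. It therefore maps kernel to kernel, which makes the quotient map
  well defined.\<close>

lemma tensor_map:
  fixes \<phi> :: "'k \<Rightarrow> 'm" and N :: "('n, 'z) monoid_scheme"
  assumes "tensor_pair R M ract N act" "tensor_pair R M' ract' N act"
    and \<phi>: "\<phi> \<in> hom M M'" and lin: "\<And>u r. \<lbrakk>u \<in> carrier M; r \<in> carrier R\<rbrakk> \<Longrightarrow> \<phi> (ract u r) = ract' (\<phi> u) r"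
  shows "tensor_map R M' ract' N act \<phi> id \<in> hom (tensor R M ract N act) (tensor R M' ract' N act)"
    and "\<And>u v. \<lbrakk>u \<in> carrier M; v \<in> carrier N\<rbrakk> \<Longrightarrow>
      tensor_map R M' ract' N act \<phi> id (pure_tensor R M ract N act u v) = pure_tensor R M' ract' N act (\<phi> u) v"
proof -
  interpret A: tensor_pair R M ract N act by fact
  interpret B: tensor_pair R M' ract' N act by fact
  define g where "g = frag_extend (\<lambda>(u, v). frag_of (\<phi> u, id v :: 'n))"
  have \<phi>c: "\<phi> u \<in> carrier M'" if "u \<in> carrier M" for u using that \<phi> by (rule hom_in_carrier[rotated])
  have g_closed: "g c \<in> carrier B.F" if "c \<in> carrier A.F" for c
  proof -
    have "Poly_Mapping.keys (g c) \<subseteq> (\<lambda>(u, v). (\<phi> u, v)) ` Poly_Mapping.keys c"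
      using keys_frag_extend[of "\<lambda>(u, v). frag_of (\<phi> u, id v)" c] by (auto simp: g_def split_beta)
    also have "\<dots> \<subseteq> carrier M' \<times> carrier N" using that \<phi>c by auto
    finally show ?thesis by simp
  qed
  have g_hom: "g \<in> hom A.F B.F"
    by (rule homI) (use g_closed in \<open>simp_all add: g_def frag_extend_add\<close>)
  have gB_hom: "(\<lambda>c. B.cls (g c)) \<in> hom A.F B.T"
    using hom_compose[OF g_hom B.cls_hom] by (simp add: o_def)
  interpret gB: group_hom A.F B.T "\<lambda>c. B.cls (g c)"
    using gB_hom by (simp add: group_hom_def group_hom_axioms_def)
  have "A.rel \<subseteq> kernel A.F B.T (\<lambda>c. B.cls (g c))"
  proof
    fix c assume c: "c \<in> A.rel"
    from c[unfolded tensor_relations_def] have "g c \<in> B.rel"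
    proof (elim UnE CollectE exE conjE)
      fix u u' v assume *: "u \<in> carrier M" "u' \<in> carrier M" "v \<in> carrier N"
        "c = frag_of (u \<otimes>\<^bsub>M\<^esub> u', v) - frag_of (u, v) - frag_of (u', v)"
      then have "g c = frag_of (\<phi> u \<otimes>\<^bsub>M'\<^esub> \<phi> u', v) - frag_of (\<phi> u, v) - frag_of (\<phi> u', v)"
        by (simp add: g_def frag_extend_diff hom_mult[OF \<phi>])
      then show ?thesis unfolding tensor_relations_def using * \<phi>c by blast
    next
      fix u v v' assume *: "u \<in> carrier M" "v \<in> carrier N" "v' \<in> carrier N"
        "c = frag_of (u, v \<otimes>\<^bsub>N\<^esub> v') - frag_of (u, v) - frag_of (u, v')"
      then have "g c = frag_of (\<phi> u, v \<otimes>\<^bsub>N\<^esub> v') - frag_of (\<phi> u, v) - frag_of (\<phi> u, v')"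
        by (simp add: g_def frag_extend_diff)
      then show ?thesis unfolding tensor_relations_def using * \<phi>c by blast
    next
      fix u r v assume *: "u \<in> carrier M" "r \<in> carrier R" "v \<in> carrier N"
        "c = frag_of (ract u r, v) - frag_of (u, act r v)"
      then have "g c = frag_of (ract' (\<phi> u) r, v) - frag_of (\<phi> u, act r v)"
        by (simp add: g_def frag_extend_diff lin)
      then show ?thesis unfolding tensor_relations_def using * \<phi>c by blast
    qed
    then have "B.cls (g c) = \<one>\<^bsub>B.T\<^esub>"
      using B.rel_subset_K B.rel_closed B.cls_eq_one_iff[of "g c"] by blast
    then show "c \<in> kernel A.F B.T (\<lambda>c. B.cls (g c))"
      using subsetD[OF A.rel_closed c] by (simp add: kernel_def)
  qed
  then have ker: "A.K \<subseteq> kernel A.F B.T (\<lambda>c. B.cls (g c))" by (rule A.K_subset[OF gB.subgroup_kernel])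
  have tm: "tensor_map R M' ract' N act \<phi> id (A.cls c) = B.cls (g c)" if c: "c \<in> carrier A.F" for c
    unfolding tensor_map_def A.cls_def B.cls_def g_def[symmetric]
  proof (rule quotient_map_rcoset[OF B.subgroup_K])
    show "A.K \<noteq> {}" using subgroup.one_closed[OF A.subgroup_K] by blast
    show "g c \<in> carrier B.F" by (rule g_closed[OF c])
    fix k assume k: "k \<in> A.K"
    then have kF: "k \<in> carrier A.F" using subgroup.subset[OF A.subgroup_K] by blast
    have "g k \<in> B.K"
      using ker k B.cls_eq_one_iff[OF g_closed[OF kF]] by (auto simp: kernel_def)
    then show "g k \<in> B.K \<and> g (k \<otimes>\<^bsub>A.F\<^esub> c) = g k \<otimes>\<^bsub>B.F\<^esub> g c"
      using hom_mult[OF g_hom kF c] by blast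
  qed simp
  show "tensor_map R M' ract' N act \<phi> id \<in> hom A.T B.T"
  proof (rule homI)
    fix x assume "x \<in> carrier A.T"
    then obtain a where a: "a \<in> carrier A.F" "x = A.cls a" by (auto simp: A.carrier_T)
    then show "tensor_map R M' ract' N act \<phi> id x \<in> carrier B.T" using tm gB.hom_closed by simp
    fix y assume "y \<in> carrier A.T"
    then obtain b where b: "b \<in> carrier A.F" "y = A.cls b" by (auto simp: A.carrier_T)
    have ab: "a \<otimes>\<^bsub>A.F\<^esub> b \<in> carrier A.F"
      using a(1) b(1) by (rule A.F_mult_closed)
    show "tensor_map R M' ract' N act \<phi> id (x \<otimes>\<^bsub>A.T\<^esub> y) =
        tensor_map R M' ract' N act \<phi> id x \<otimes>\<^bsub>B.T\<^esub> tensor_map R M' ract' N act \<phi> id y"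
      using A.cls.hom_mult[OF a(1) b(1)] gB.hom_mult[OF a(1) b(1)] tm[OF ab] tm[OF a(1)] tm[OF b(1)] a(2) b(2)
      by simp
  qed
  show "tensor_map R M' ract' N act \<phi> id (A.pt u v) = B.pt (\<phi> u) v" if "u \<in> carrier M" "v \<in> carrier N" for u v
    using tm[of "frag_of (u, v)"] that by (simp add: A.pt_eq_cls B.pt_eq_cls g_def)
qed

section \<open>The projective seminorm as the largest admissible seminorm\<close>

locale normed_tensor_pair = tensor_pair R M ract N act
  for R :: "('r, 'x) ring_scheme" and M :: "('m, 'y) monoid_scheme" and ract
    and N :: "('n, 'z) monoid_scheme" and act +
  fixes mn :: "'m \<Rightarrow> real" and nn :: "'n \<Rightarrow> real"
  assumes mn_nonneg: "u \<in> carrier M \<Longrightarrow> 0 \<le> mn u" and nn_nonneg: "v \<in> carrier N \<Longrightarrow> 0 \<le> nn v"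
begin

definition admissible :: "(('m \<times> 'n \<Rightarrow>\<^sub>0 int) set \<Rightarrow> real) \<Rightarrow> bool" where
  "admissible s \<longleftrightarrow> Z_seminormed T s \<and> (\<forall>u\<in>carrier M. \<forall>v\<in>carrier N. s (pt u v) \<le> mn u * nn v)"

abbreviation "pn \<equiv> projective_seminorm R M ract mn N act nn"

lemma pn_eq: "pn x = (SUP s\<in>{s. admissible s}. s x)"
  by (simp add: projective_seminorm_def admissible_def)

text \<open>A real supremum is informative only over a set bounded above. Every tensor is built from
  pure tensors by finitely many differences, and admissible seminorms have a common bound on pure
  tensors.\<close>

lemma admissible_bdd: "x \<in> carrier T \<Longrightarrow> bdd_above ((\<lambda>s. s x) ` {s. admissible s})"
proof (induction rule: tensor_induct)
  case one
  have "s \<one>\<^bsub>T\<^esub> \<le> 0" if "admissible s" for s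
    using that Z_seminormed.seminorm_one[of T s] by (simp add: admissible_def)
  then show ?case by (intro bdd_aboveI[of _ 0]) blast
next
  case (pure u v)
  then have "s (pt u v) \<le> mn u * nn v" if "admissible s" for s
    using that by (simp add: admissible_def)
  then show ?case by (intro bdd_aboveI[of _ "mn u * nn v"]) blast
next
  case (diff x y)
  obtain a where a: "\<And>s. admissible s \<Longrightarrow> s x \<le> a"
    using diff(3) unfolding bdd_above_def by blast
  obtain b where b: "\<And>s. admissible s \<Longrightarrow> s y \<le> b"
    using diff(4) unfolding bdd_above_def by blast
  have "s (x \<otimes>\<^bsub>T\<^esub> inv\<^bsub>T\<^esub> y) \<le> a + b" if "admissible s" for s
    using that a[OF that] b[OF that] Z_seminormed.triangle_diff[of T s x y] diff(1,2)
    by (simp add: admissible_def)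
  then show ?case by (intro bdd_aboveI[of _ "a + b"]) blast
qed

lemma admissible_zero: "admissible (\<lambda>_. 0)"
  by (auto simp: admissible_def mn_nonneg nn_nonneg Z_seminormed_def Z_seminormed_axioms_def T.comm_group_axioms)

lemma admissible_le: "\<lbrakk>admissible s; x \<in> carrier T\<rbrakk> \<Longrightarrow> s x \<le> pn x"
  unfolding pn_eq by (rule cSUP_upper[OF _ admissible_bdd]) auto

lemma pn_leI: "(\<And>s. admissible s \<Longrightarrow> s x \<le> c) \<Longrightarrow> pn x \<le> c"
  unfolding pn_eq by (rule cSUP_least) (use admissible_zero in auto)

lemma Z_seminormed_pn: "Z_seminormed T pn"
proof (intro Z_seminormed.intro Z_seminormed_axioms.intro)
  fix x y assume x: "x \<in> carrier T" and y: "y \<in> carrier T"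
  show "pn (x \<otimes>\<^bsub>T\<^esub> y) \<le> pn x + pn y"
  proof (rule pn_leI)
    fix s assume s: "admissible s"
    have "s (x \<otimes>\<^bsub>T\<^esub> y) \<le> s x + s y"
      using s x y Z_seminormed.triangle by (auto simp: admissible_def)
    also have "\<dots> \<le> pn x + pn y" using admissible_le[OF s] x y by (intro add_mono)
    finally show "s (x \<otimes>\<^bsub>T\<^esub> y) \<le> pn x + pn y" .
  qed
next
  fix x and n :: int assume x: "x \<in> carrier T"
  have hom: "s (x [^]\<^bsub>T\<^esub> n) = \<bar>real_of_int n\<bar> * s x" if "admissible s" for s
    using that x Z_seminormed.homogeneous by (auto simp: admissible_def)
  have xn: "x [^]\<^bsub>T\<^esub> n \<in> carrier T" using x by simp
  show "pn (x [^]\<^bsub>T\<^esub> n) = \<bar>real_of_int n\<bar> * pn x"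
  proof (rule antisym)
    show "pn (x [^]\<^bsub>T\<^esub> n) \<le> \<bar>real_of_int n\<bar> * pn x"
      by (rule pn_leI) (simp add: hom admissible_le x mult_left_mono)
    show "\<bar>real_of_int n\<bar> * pn x \<le> pn (x [^]\<^bsub>T\<^esub> n)"
    proof (cases "n = 0")
      case True
      then show ?thesis using admissible_le[OF admissible_zero xn] by simp
    next
      case False
      have "pn x \<le> pn (x [^]\<^bsub>T\<^esub> n) / \<bar>real_of_int n\<bar>"
      proof (rule pn_leI)
        fix s assume s: "admissible s"
        show "s x \<le> pn (x [^]\<^bsub>T\<^esub> n) / \<bar>real_of_int n\<bar>"
          using admissible_le[OF s xn] hom[OF s] False by (simp add: pos_le_divide_eq mult.commute)
      qed
      then show ?thesis using False by (simp add: pos_le_divide_eq mult.commute)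
    qed
  qed
qed (rule T.comm_group_axioms)

lemma pn_pt_le: "\<lbrakk>u \<in> carrier M; v \<in> carrier N\<rbrakk> \<Longrightarrow> pn (pt u v) \<le> mn u * nn v"
  by (rule pn_leI) (simp add: admissible_def)

text \<open>Pulling \<open>t\<close> back along \<open>\<psi>\<close> and dividing by
  \<open>c\<close> gives an admissible seminorm, which lies below the largest one. Boundedness on a
  tensor product can thus be checked on pure tensors.\<close>

lemma seminorm_le_pn:
  assumes V: "Z_seminormed V t" and \<psi>: "\<psi> \<in> hom T V" and c: "0 < c"
    and bound: "\<And>u v. \<lbrakk>u \<in> carrier M; v \<in> carrier N\<rbrakk> \<Longrightarrow> t (\<psi> (pt u v)) \<le> c * (mn u * nn v)"
    and x: "x \<in> carrier T"
  shows "t (\<psi> x) \<le> c * pn x"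
proof -
  interpret V: Z_seminormed V t by fact
  interpret \<psi>: group_hom T V \<psi> using \<psi> by (simp add: group_hom_def group_hom_axioms_def V.is_group)
  have "admissible (\<lambda>x. t (\<psi> x) / c)"
    unfolding admissible_def
  proof (intro conjI ballI Z_seminormed.intro Z_seminormed_axioms.intro)
    show "comm_group T" by (rule T.comm_group_axioms)
    fix x y assume "x \<in> carrier T" "y \<in> carrier T"
    then show "t (\<psi> (x \<otimes>\<^bsub>T\<^esub> y)) / c \<le> t (\<psi> x) / c + t (\<psi> y) / c"
      using c V.triangle[of "\<psi> x" "\<psi> y"] by (simp add: add_divide_distrib[symmetric] divide_right_mono)
  next
    fix x and n :: int assume "x \<in> carrier T"
    then show "t (\<psi> (x [^]\<^bsub>T\<^esub> n)) / c = \<bar>real_of_int n\<bar> * (t (\<psi> x) / c)"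
      using V.homogeneous[of "\<psi> x" n] \<psi>.hom_closed by (simp add: \<psi>.hom_int_pow)
  next
    fix u v assume "u \<in> carrier M" "v \<in> carrier N"
    then show "t (\<psi> (pt u v)) / c \<le> mn u * nn v"
      using bound c by (simp add: pos_divide_le_eq mult.commute)
  qed
  from admissible_le[OF this x] c show ?thesis by (simp add: pos_divide_le_eq mult.commute)
qed

end

section \<open>Coordinates on chains with coefficients\<close>

lemma group_ring_simps [simp]:
  "r \<in> carrier (group_ring G) \<longleftrightarrow> Poly_Mapping.keys r \<subseteq> carrier G"
  "\<one>\<^bsub>group_ring G\<^esub> = frag_of \<one>\<^bsub>G\<^esub>" "\<zero>\<^bsub>group_ring G\<^esub> = 0"
  "r \<oplus>\<^bsub>group_ring G\<^esub> r' = r + r'"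
  "r \<otimes>\<^bsub>group_ring G\<^esub> r' = bilinear_extend (\<lambda>g h. g \<otimes>\<^bsub>G\<^esub> h) r r'"
  by (simp_all add: group_ring_def)

lemma chain_group_eq: "chain_group G n = free_Abelian_group (tuples G (Suc n))"
  by (simp add: chain_group_def tuples_def)

lemma chain_ract_eq: "chain_ract G c r = frag_extend (\<lambda>g. translate G (inv\<^bsub>G\<^esub> g) c) r"
  by (simp add: chain_ract_def chain_act_def antipode_def bilinear_extend_def frag_extend_frag_extend
      translate_def)

lemma extend_chain_ract:
  assumes "group G" "equivariant G (Suc m) (Suc n) \<phi>"
    and c: "Poly_Mapping.keys c \<subseteq> tuples G (Suc m)" and r: "Poly_Mapping.keys r \<subseteq> carrier G"
  shows "frag_extend \<phi> (chain_ract G c r) = chain_ract G (frag_extend \<phi> c) r"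
  unfolding chain_ract_eq frag_extend_frag_extend
proof (rule frag_extend_eq)
  fix g assume "g \<in> Poly_Mapping.keys r"
  then have "inv\<^bsub>G\<^esub> g \<in> carrier G" using r group.inv_closed[OF assms(1)] by blast
  then show "frag_extend \<phi> (translate G (inv\<^bsub>G\<^esub> g) c) = translate G (inv\<^bsub>G\<^esub> g) (frag_extend \<phi> c)"
    unfolding extend_translate translate_extend
    by (intro frag_extend_eq) (use assms(2) c in \<open>auto simp: equivariant_def\<close>)
qed

text \<open>
  As \<open>\<sigma> = t \<cdot> (hd \<sigma>)\<^sup>-\<^sup>1\<close> for \<open>t = root_tuple G \<sigma>\<close>, these are the coordinates of a chain with
  respect to the basis of the right module of chains given by the tuples starting at the unit.
\<close>

definition root_coeff :: "('g, 'x) monoid_scheme \<Rightarrow> 'g list \<Rightarrow> ('g list \<Rightarrow>\<^sub>0 int) \<Rightarrow> ('g \<Rightarrow>\<^sub>0 int)" where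
  "root_coeff G t = frag_extend (\<lambda>\<sigma>. if root_tuple G \<sigma> = t then frag_of (inv\<^bsub>G\<^esub> hd \<sigma>) else 0)"

lemma root_coeff_add: "root_coeff G t (a + b) = root_coeff G t a + root_coeff G t b"
  by (simp add: root_coeff_def frag_extend_add)

lemma root_coeff_frag_of:
  "root_coeff G t (frag_of \<sigma>) = (if root_tuple G \<sigma> = t then frag_of (inv\<^bsub>G\<^esub> hd \<sigma>) else 0)"
  by (simp add: root_coeff_def)

lemma keys_root_coeff:
  assumes "group G" "Poly_Mapping.keys c \<subseteq> tuples G (Suc n)"
  shows "Poly_Mapping.keys (root_coeff G t c) \<subseteq> carrier G"
proof -
  have "Poly_Mapping.keys (if root_tuple G \<sigma> = t then frag_of (inv\<^bsub>G\<^esub> hd \<sigma>) else 0) \<subseteq> carrier G"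
    if "\<sigma> \<in> Poly_Mapping.keys c" for \<sigma>
    using hd_tuples[of \<sigma> G n] that assms group.inv_closed[OF assms(1)] by auto
  then show ?thesis
    unfolding root_coeff_def by (intro subset_trans[OF keys_frag_extend] UN_least)
qed

lemma l1_norm_root_coeff_le: "l1_norm (root_coeff G t c) \<le> l1_norm c"
  using l1_norm_extend_le_const[of c "\<lambda>\<sigma>. if root_tuple G \<sigma> = t then frag_of (inv\<^bsub>G\<^esub> hd \<sigma>) else 0" 1]
  by (simp add: root_coeff_def)

text \<open>Acting by \<open>g\<close> on the right keeps the root tuple and replaces the first
  vertex by its product with the inverse of \<open>g\<close> from the left; the inverse of the first
  vertex is then multiplied by \<open>g\<close> from the right.\<close>

lemma root_coeff_ract:
  assumes G: "group G" and c: "Poly_Mapping.keys c \<subseteq> tuples G (Suc n)" and r: "Poly_Mapping.keys r \<subseteq> carrier G"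
  shows "root_coeff G t (chain_ract G c r) = root_coeff G t c \<otimes>\<^bsub>group_ring G\<^esub> r"
proof -
  interpret group G by fact
  let ?\<rho> = "\<lambda>\<sigma>. if root_tuple G \<sigma> = t then frag_of (inv\<^bsub>G\<^esub> hd \<sigma>) else 0"
  have "root_coeff G t (chain_ract G c r) =
      frag_extend (\<lambda>g. frag_extend (\<lambda>\<sigma>. ?\<rho> (map ((\<otimes>\<^bsub>G\<^esub>) (inv\<^bsub>G\<^esub> g)) \<sigma>)) c) r"
    unfolding root_coeff_def chain_ract_eq frag_extend_frag_extend extend_translate ..
  also have "\<dots> = frag_extend (\<lambda>g. frag_extend (\<lambda>\<sigma>. frag_extend (\<lambda>h. frag_of (h \<otimes>\<^bsub>G\<^esub> g)) (?\<rho> \<sigma>)) c) r"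
  proof (intro frag_extend_eq)
    fix g \<sigma> assume g: "g \<in> Poly_Mapping.keys r" and \<sigma>: "\<sigma> \<in> Poly_Mapping.keys c"
    have g: "g \<in> carrier G" and \<sigma>: "\<sigma> \<in> tuples G (Suc n)" using g \<sigma> c r by auto
    have "hd (map ((\<otimes>\<^bsub>G\<^esub>) (inv\<^bsub>G\<^esub> g)) \<sigma>) = inv\<^bsub>G\<^esub> g \<otimes>\<^bsub>G\<^esub> hd \<sigma>"
      using \<sigma> by (intro hd_map) (auto simp: tuples_def)
    then show "?\<rho> (map ((\<otimes>\<^bsub>G\<^esub>) (inv\<^bsub>G\<^esub> g)) \<sigma>) = frag_extend (\<lambda>h. frag_of (h \<otimes>\<^bsub>G\<^esub> g)) (?\<rho> \<sigma>)"
      using root_tuple_map[OF \<sigma> inv_closed[OF g]] hd_tuples[OF \<sigma>] g by (simp add: inv_mult_group)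
  qed
  also have "\<dots> = frag_extend (\<lambda>g. frag_extend (\<lambda>h. frag_of (h \<otimes>\<^bsub>G\<^esub> g)) (root_coeff G t c)) r"
    by (simp only: root_coeff_def frag_extend_frag_extend)
  also have "\<dots> = root_coeff G t c \<otimes>\<^bsub>group_ring G\<^esub> r"
    \<comment> \<open>The product in the group ring sums over the left factor on the outside, so the
      two sums are exchanged.\<close>
    unfolding group_ring_simps bilinear_extend_def
    by (simp add: frag_extend_def frag_cmul_sum sum.swap[of _ "Poly_Mapping.keys r"] mult.commute)
  finally show ?thesis .
qed

locale group_coefficients = G: group G + E: complete_normed_left_module "group_ring G" l1_norm E act en
  for G :: "('g, 'x) monoid_scheme" and E :: "('e, 'y) monoid_scheme" and act and en
begin

abbreviation "A n \<equiv> tensor (group_ring G) (chain_group G n) (chain_ract G) E act"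
abbreviation "pt n \<equiv> pure_tensor (group_ring G) (chain_group G n) (chain_ract G) E act"
abbreviation "sn cn n \<equiv> projective_seminorm (group_ring G) (chain_group G n) (chain_ract G) cn E act en"
abbreviation "tm n \<phi> \<equiv> tensor_map (group_ring G) (chain_group G n) (chain_ract G) E act (frag_extend \<phi>) id"
abbreviation "bd \<equiv> coeff_boundary G E act"

lemma tensor_pair: "tensor_pair (group_ring G) (chain_group G n) (chain_ract G) E act"
proof (intro tensor_pair.intro tensor_pair_axioms.intro)
  show "comm_group (chain_group G n)" unfolding chain_group_eq by (rule abelian_free_Abelian_group)
  show "comm_group E" by (rule E.M.comm_group_axioms)
  fix r u assume r: "r \<in> carrier (group_ring G)" and u: "u \<in> carrier (chain_group G n)"
  have "Poly_Mapping.keys (translate G (inv\<^bsub>G\<^esub> g) u) \<subseteq> tuples G (Suc n)" if "g \<in> Poly_Mapping.keys r" for g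
  proof -
    have "inv\<^bsub>G\<^esub> g \<in> carrier G" using that r by auto
    then have "map ((\<otimes>\<^bsub>G\<^esub>) (inv\<^bsub>G\<^esub> g)) ` Poly_Mapping.keys u \<subseteq> tuples G (Suc n)"
      using u by (intro image_subsetI tuples_map[OF G.is_group]) (auto simp: chain_group_eq)
    with keys_translate show ?thesis by (rule subset_trans)
  qed
  then have "Poly_Mapping.keys (chain_ract G u r) \<subseteq> tuples G (Suc n)"
    unfolding chain_ract_eq by (intro subset_trans[OF keys_frag_extend] UN_least)
  then show "chain_ract G u r \<in> carrier (chain_group G n)" by (simp add: chain_group_eq)
qed (rule E.act_closed)

sublocale P: tensor_pair "group_ring G" "chain_group G n" "chain_ract G" E act for n
  by (rule tensor_pair)

lemma en_nonneg: "e \<in> carrier E \<Longrightarrow> 0 \<le> en e"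
  by (rule E.seminorm_nonneg)

lemma l1_pair: "normed_tensor_pair (group_ring G) (chain_group G n) (chain_ract G) E act l1_norm en"
  by (intro normed_tensor_pair.intro tensor_pair normed_tensor_pair_axioms.intro l1_norm_nonneg en_nonneg)

lemma extend_hom:
  assumes "equivariant G (Suc m) (Suc n) \<phi>"
  shows "frag_extend \<phi> \<in> hom (chain_group G m) (chain_group G n)"
proof (rule homI)
  fix c assume "c \<in> carrier (chain_group G m)"
  then have "Poly_Mapping.keys (\<phi> \<sigma>) \<subseteq> tuples G (Suc n)" if "\<sigma> \<in> Poly_Mapping.keys c" for \<sigma>
    using that assms by (auto simp: chain_group_eq equivariant_def)
  then show "frag_extend \<phi> c \<in> carrier (chain_group G n)"
    unfolding chain_group_eq carrier_free_Abelian_group_iff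
    by (intro subset_trans[OF keys_frag_extend] UN_least)
qed (simp add: chain_group_eq frag_extend_add)

lemma tm:
  assumes "equivariant G (Suc m) (Suc n) \<phi>"
  shows "tm n \<phi> \<in> hom (A m) (A n)"
    and "\<And>c e. \<lbrakk>c \<in> carrier (chain_group G m); e \<in> carrier E\<rbrakk> \<Longrightarrow> tm n \<phi> (pt m c e) = pt n (frag_extend \<phi> c) e"
proof -
  have lin: "frag_extend \<phi> (chain_ract G u r) = chain_ract G (frag_extend \<phi> u) r"
    if "u \<in> carrier (chain_group G m)" "r \<in> carrier (group_ring G)" for u r
    using extend_chain_ract[OF G.is_group assms] that by (simp add: chain_group_eq)
  show "tm n \<phi> \<in> hom (A m) (A n)"
    by (rule tensor_map(1)[OF tensor_pair tensor_pair extend_hom[OF assms]]) (rule lin)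
  show "tm n \<phi> (pt m c e) = pt n (frag_extend \<phi> c) e"
    if "c \<in> carrier (chain_group G m)" "e \<in> carrier E" for c e
    using that by (rule tensor_map(2)[OF tensor_pair tensor_pair extend_hom[OF assms], rotated]) (rule lin)
qed

lemma tm_closed: "\<lbrakk>equivariant G (Suc m) (Suc n) \<phi>; x \<in> carrier (A m)\<rbrakk> \<Longrightarrow> tm n \<phi> x \<in> carrier (A n)"
  using tm(1) by (rule hom_in_carrier)

lemma tm_bound:
  assumes "equivariant G (Suc m) (Suc n) \<phi>" "0 < C"
    and pair: "normed_tensor_pair (group_ring G) (chain_group G m) (chain_ract G) E act mn en"
    and pair': "normed_tensor_pair (group_ring G) (chain_group G n) (chain_ract G) E act mn' en"
    and bound: "\<And>c. c \<in> carrier (chain_group G m) \<Longrightarrow> mn' (frag_extend \<phi> c) \<le> C * mn c"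
    and x: "x \<in> carrier (A m)"
  shows "sn mn' n (tm n \<phi> x) \<le> C * sn mn m x"
proof (rule normed_tensor_pair.seminorm_le_pn[OF pair normed_tensor_pair.Z_seminormed_pn[OF pair'] tm(1)[OF assms(1)] assms(2) _ x])
  fix c e assume ce: "c \<in> carrier (chain_group G m)" "e \<in> carrier E"
  have "frag_extend \<phi> c \<in> carrier (chain_group G n)" using extend_hom[OF assms(1)] ce(1) by (rule hom_in_carrier)
  then have "sn mn' n (tm n \<phi> (pt m c e)) \<le> mn' (frag_extend \<phi> c) * en e"
    unfolding tm(2)[OF assms(1) ce] using ce(2) by (rule normed_tensor_pair.pn_pt_le[OF pair'])
  also have "\<dots> \<le> (C * mn c) * en e"
    using bound[OF ce(1)] en_nonneg[OF ce(2)] by (rule mult_right_mono)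
  finally show "sn mn' n (tm n \<phi> (pt m c e)) \<le> C * (mn c * en e)" by (simp add: mult.assoc)
qed

lemma bd_eq_tm: "bd (Suc n) = tm n (\<lambda>\<sigma>. chain_boundary (frag_of \<sigma>))"
  by (simp add: coeff_boundary_def flip: chain_boundary_eq_extend)

lemma equivariant_bd: "equivariant G (Suc (Suc n)) (Suc n) (\<lambda>\<sigma>. chain_boundary (frag_of \<sigma>))"
  by (rule equivariant_chain_boundary[OF G.is_group])

lemma bd_hom: "bd (Suc n) \<in> hom (A (Suc n)) (A n)"
  unfolding bd_eq_tm by (rule tm(1)[OF equivariant_bd])

lemma pt_zero: "e \<in> carrier E \<Longrightarrow> pt n 0 e = \<one>\<^bsub>A n\<^esub>"
  using hom_one[OF P.pt_left_hom, of e n] P.M.is_group P.T.is_group by (simp add: chain_group_eq)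

lemma tm_tm:
  assumes "equivariant G (Suc l) (Suc m) \<psi>" "equivariant G (Suc m) (Suc n) \<phi>" and x: "x \<in> carrier (A l)"
  shows "tm n \<phi> (tm m \<psi> x) = tm n (\<lambda>\<sigma>. frag_extend \<phi> (\<psi> \<sigma>)) x"
proof (rule P.tensor_hom_eqI[OF P.T.is_group _ _ _ x])
  show "(\<lambda>x. tm n \<phi> (tm m \<psi> x)) \<in> hom (A l) (A n)"
    using hom_compose[OF tm(1)[OF assms(1)] tm(1)[OF assms(2)]] by (simp add: o_def)
  show "tm n (\<lambda>\<sigma>. frag_extend \<phi> (\<psi> \<sigma>)) \<in> hom (A l) (A n)"
    by (rule tm(1)[OF equivariant_extend[OF assms(2,1)]])
  fix c e assume ce: "c \<in> carrier (chain_group G l)" "e \<in> carrier E"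
  have "frag_extend \<psi> c \<in> carrier (chain_group G m)" using extend_hom[OF assms(1)] ce(1) by (rule hom_in_carrier)
  then show "tm n \<phi> (tm m \<psi> (pt l c e)) = tm n (\<lambda>\<sigma>. frag_extend \<phi> (\<psi> \<sigma>)) (pt l c e)"
    using ce by (simp add: tm(2)[OF assms(1)] tm(2)[OF assms(2)] tm(2)[OF equivariant_extend[OF assms(2,1)]]
        frag_extend_frag_extend)
qed

lemma tm_zero:
  assumes "\<And>\<sigma>. \<sigma> \<in> tuples G (Suc m) \<Longrightarrow> \<phi> \<sigma> = 0" "equivariant G (Suc m) (Suc n) \<phi>" and x: "x \<in> carrier (A m)"
  shows "tm n \<phi> x = \<one>\<^bsub>A n\<^esub>"
proof (rule P.tensor_hom_eqI[OF P.T.is_group tm(1)[OF assms(2)] _ _ x])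
  show "(\<lambda>x. \<one>\<^bsub>A n\<^esub>) \<in> hom (A m) (A n)" by (rule homI) simp_all
  fix c e assume ce: "c \<in> carrier (chain_group G m)" "e \<in> carrier E"
  have "frag_extend \<phi> c = 0"
    using ce(1) assms(1) by (intro frag_extend_eq_0) (auto simp: chain_group_eq)
  then show "tm n \<phi> (pt m c e) = \<one>\<^bsub>A n\<^esub>" using ce by (simp add: tm(2)[OF assms(2)] pt_zero)
qed

lemma bd_bd:
  assumes "x \<in> carrier (A (Suc (Suc n)))" shows "bd (Suc n) (bd (Suc (Suc n)) x) = \<one>\<^bsub>A n\<^esub>"
proof -
  have eq: "frag_extend (\<lambda>\<sigma>. chain_boundary (frag_of \<sigma>)) (chain_boundary (frag_of \<sigma>)) = 0" for \<sigma> :: "'g list"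
    by (simp flip: chain_boundary_eq_extend)
  show ?thesis
    unfolding bd_eq_tm tm_tm[OF equivariant_bd equivariant_bd assms]
    by (rule tm_zero[OF eq equivariant_extend[OF equivariant_bd equivariant_bd] assms])
qed

text \<open>The condition on \<open>w\<close>, monotonicity under nonempty sets of vertices, holds
  for constant weights and for diameters, so one estimate serves both norms; the factor is the
  number of faces.\<close>

lemma boundary_weight_bound:
  assumes w: "\<And>\<sigma>. 0 \<le> w \<sigma>" and mono: "\<And>\<sigma> \<eta>. \<lbrakk>\<eta> \<noteq> []; set \<eta> \<subseteq> set \<sigma>\<rbrakk> \<Longrightarrow> w \<eta> \<le> w \<sigma>"
    and c: "Poly_Mapping.keys c \<subseteq> tuples G (Suc (Suc n))"
  shows "weighted_norm w (chain_boundary c) \<le> real (Suc (Suc n)) * weighted_norm w c"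
proof -
  have "weighted_norm w (frag_extend (\<lambda>\<sigma>. chain_boundary (frag_of \<sigma>)) c) \<le>
      weighted_norm (\<lambda>\<sigma>. real (Suc (Suc n)) * w \<sigma>) c"
  proof (rule weighted_norm_extend_le[OF w])
    fix \<sigma> assume "\<sigma> \<in> Poly_Mapping.keys c"
    then have \<sigma>: "length \<sigma> = Suc (Suc n)" using c by (auto simp: tuples_def)
    have "weighted_norm w (chain_boundary (frag_of \<sigma>)) \<le> weighted_norm (\<lambda>_. w \<sigma> * 1) (chain_boundary (frag_of \<sigma>))"
    proof (rule weighted_norm_mono)
      fix \<eta> assume "\<eta> \<in> Poly_Mapping.keys (chain_boundary (frag_of \<sigma>))"
      from keys_chain_boundary_frag_of[OF this] \<sigma> show "w \<eta> \<le> w \<sigma> * 1" by (auto intro: mono)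
    qed
    also have "\<dots> = w \<sigma> * l1_norm (chain_boundary (frag_of \<sigma>))"
      by (simp only: weighted_norm_scale l1_norm_eq_weighted)
    also have "\<dots> \<le> w \<sigma> * real (Suc (Suc n))"
      using l1_norm_chain_boundary_frag_of[of \<sigma>] w \<sigma> by (intro mult_left_mono) auto
    finally show "weighted_norm w (chain_boundary (frag_of \<sigma>)) \<le> real (Suc (Suc n)) * w \<sigma>"
      by (simp add: mult.commute)
  qed
  then show ?thesis by (simp add: weighted_norm_scale flip: chain_boundary_eq_extend)
qed

lemma seminormed_complex:
  assumes pair: "\<And>n. normed_tensor_pair (group_ring G) (chain_group G n) (chain_ract G) E act mn en"
    and bound: "\<And>n c. c \<in> carrier (chain_group G (Suc n)) \<Longrightarrow> mn (chain_boundary c) \<le> real (Suc (Suc n)) * mn c"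
  shows "seminormed_complex A bd (sn mn)"
proof (intro seminormed_complex.intro chain_complex.intro seminormed_complex_axioms.intro)
  fix n
  show "comm_group (A n)" by (rule P.T.comm_group_axioms)
  show "bd (Suc n) \<in> hom (A (Suc n)) (A n)" by (rule bd_hom)
  show "Z_seminormed (A n) (sn mn n)" by (rule normed_tensor_pair.Z_seminormed_pn[OF pair])
  show "\<exists>c. \<forall>x\<in>carrier (A (Suc n)). sn mn n (bd (Suc n) x) \<le> c * sn mn (Suc n) x"
  proof (intro exI ballI)
    fix x assume x: "x \<in> carrier (A (Suc n))"
    have "0 < real (Suc (Suc n))" by simp
    from tm_bound[OF equivariant_bd this pair pair _ x]
    show "sn mn n (bd (Suc n) x) \<le> real (Suc (Suc n)) * sn mn (Suc n) x"
      using bound unfolding bd_eq_tm chain_boundary_eq_extend[symmetric] by blast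
  qed
qed (rule bd_bd)

lemma l1_complex: "seminormed_complex A bd (sn l1_norm)"
proof (rule seminormed_complex[OF l1_pair])
  fix n c assume "c \<in> carrier (chain_group G (Suc n))"
  then show "l1_norm (chain_boundary c) \<le> real (Suc (Suc n)) * l1_norm c"
    unfolding l1_norm_eq_weighted by (intro boundary_weight_bound) (auto simp: chain_group_eq)
qed

lemma act_zero: "e \<in> carrier E \<Longrightarrow> act 0 e = \<one>\<^bsub>E\<^esub>"
  using E.act_add_distrib[of 0 0 e] E.act_closed[of 0 e] by simp

text \<open>The coefficient of a chain at a root tuple is right linear over the group ring, so
  applying it to the module element is balanced. The map \<open>\<Theta> t\<close> is the projection
  to the copy of \<open>E\<close> indexed by \<open>t\<close>.\<close>

lemma coordinates_exist:
  obtains \<Theta> where "\<And>t. \<Theta> t \<in> hom (A n) E"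
    "\<And>t c e. \<lbrakk>c \<in> carrier (chain_group G n); e \<in> carrier E\<rbrakk> \<Longrightarrow> \<Theta> t (pt n c e) = act (root_coeff G t c) e"
proof -
  have rc: "root_coeff G t c \<in> carrier (group_ring G)" if "c \<in> carrier (chain_group G n)" for t c
    using keys_root_coeff[OF G.is_group] that by (simp add: chain_group_eq)
  have "\<exists>\<psi>. \<psi> \<in> hom (A n) E \<and> (\<forall>c\<in>carrier (chain_group G n). \<forall>e\<in>carrier E.
      \<psi> (pt n c e) = act (root_coeff G t c) e)" for t
  proof (rule P.tensor_universal)
    show "comm_group E" by (rule E.M.comm_group_axioms)
    show "act (root_coeff G t c) e \<in> carrier E" if "c \<in> carrier (chain_group G n)" "e \<in> carrier E" for c e
      using E.act_closed rc that by blast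
    show "act (root_coeff G t (c \<otimes>\<^bsub>chain_group G n\<^esub> c')) e =
        act (root_coeff G t c) e \<otimes>\<^bsub>E\<^esub> act (root_coeff G t c') e"
      if "c \<in> carrier (chain_group G n)" "c' \<in> carrier (chain_group G n)" "e \<in> carrier E" for c c' e
      using E.act_add_distrib[OF rc rc, of c c' e t t] that by (simp add: chain_group_eq root_coeff_add)
    show "act (root_coeff G t c) (e \<otimes>\<^bsub>E\<^esub> e') = act (root_coeff G t c) e \<otimes>\<^bsub>E\<^esub> act (root_coeff G t c) e'"
      if "c \<in> carrier (chain_group G n)" "e \<in> carrier E" "e' \<in> carrier E" for c e e'
      using E.act_mult_distrib rc that by blast
    show "act (root_coeff G t (chain_ract G c r)) e = act (root_coeff G t c) (act r e)"
      if "c \<in> carrier (chain_group G n)" "r \<in> carrier (group_ring G)" "e \<in> carrier E" for c r e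
    proof -
      have "root_coeff G t (chain_ract G c r) = root_coeff G t c \<otimes>\<^bsub>group_ring G\<^esub> r"
        using that by (intro root_coeff_ract[OF G.is_group]) (auto simp: chain_group_eq)
      then show ?thesis using E.act_assoc[OF rc[OF that(1)] that(2,3), of t] by (simp only:)
    qed
  qed
  then have "\<forall>t. \<exists>\<psi>. \<psi> \<in> hom (A n) E \<and> (\<forall>c\<in>carrier (chain_group G n). \<forall>e\<in>carrier E.
      \<psi> (pt n c e) = act (root_coeff G t c) e)" by blast
  from choice[OF this] obtain \<Theta> where "\<forall>t. \<Theta> t \<in> hom (A n) E \<and> (\<forall>c\<in>carrier (chain_group G n). \<forall>e\<in>carrier E.
      \<Theta> t (pt n c e) = act (root_coeff G t c) e)" ..
  then show thesis by (intro that[of \<Theta>]) auto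
qed

section \<open>Chains with coefficients as finite sums of copies of the module\<close>

context
  fixes n and \<Theta>
  assumes \<Theta>_hom: "\<And>t. \<Theta> t \<in> hom (A n) E"
    and \<Theta>_pt: "\<And>t c e. \<lbrakk>c \<in> carrier (chain_group G n); e \<in> carrier E\<rbrakk> \<Longrightarrow>
      \<Theta> t (pt n c e) = act (root_coeff G t c) e"
begin

lemma \<Theta>_closed: "x \<in> carrier (A n) \<Longrightarrow> \<Theta> t x \<in> carrier E"
  using \<Theta>_hom by (rule hom_in_carrier)

text \<open>Taking a coefficient does not increase the l1 norm, and the module norm is
  submultiplicative. So coordinates have norm at most 1 on pure tensors, hence for the projective
  seminorm.\<close>

lemma \<Theta>_bound:
  assumes "x \<in> carrier (A n)" shows "en (\<Theta> t x) \<le> sn l1_norm n x"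
proof -
  have "en (\<Theta> t x) \<le> 1 * sn l1_norm n x"
  proof (rule normed_tensor_pair.seminorm_le_pn[OF l1_pair E.Z_seminormed_axioms \<Theta>_hom _ _ assms])
    fix c e assume ce: "c \<in> carrier (chain_group G n)" "e \<in> carrier E"
    have "root_coeff G t c \<in> carrier (group_ring G)"
      using keys_root_coeff[OF G.is_group] ce by (simp add: chain_group_eq)
    then have "en (act (root_coeff G t c) e) \<le> l1_norm (root_coeff G t c) * en e"
      using ce(2) by (rule E.act_norm)
    also have "\<dots> \<le> l1_norm c * en e"
      using l1_norm_root_coeff_le en_nonneg[OF ce(2)] by (rule mult_right_mono)
    finally show "en (\<Theta> t (pt n c e)) \<le> 1 * (l1_norm c * en e)" by (simp add: \<Theta>_pt[OF ce])
  qed simp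
  then show ?thesis by simp
qed

text \<open>The map back from coordinates to tensors, restricted to a finite set of indices.\<close>

definition comb :: "'g list set \<Rightarrow> ('g list \<Rightarrow> 'e) \<Rightarrow> ((('g list \<Rightarrow>\<^sub>0 int) \<times> 'e) \<Rightarrow>\<^sub>0 int) set" where
  "comb B y = finprod (A n) (\<lambda>t. pt n (frag_of t) (y t)) B"

lemma tuple_closed: "t \<in> tuples G (Suc n) \<Longrightarrow> frag_of t \<in> carrier (chain_group G n)"
  by (simp add: chain_group_eq)

lemma comb_terms_closed:
  "\<lbrakk>B \<subseteq> tuples G (Suc n); y ` B \<subseteq> carrier E\<rbrakk> \<Longrightarrow> (\<lambda>t. pt n (frag_of t) (y t)) \<in> B \<rightarrow> carrier (A n)"
  by (intro funcsetI P.pt_closed tuple_closed) auto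

lemma comb_closed: "\<lbrakk>B \<subseteq> tuples G (Suc n); y ` B \<subseteq> carrier E\<rbrakk> \<Longrightarrow> comb B y \<in> carrier (A n)"
  unfolding comb_def by (intro P.T.finprod_closed comb_terms_closed)

lemma comb_cong: "(\<And>t. t \<in> B \<Longrightarrow> y t = z t) \<Longrightarrow> B \<subseteq> tuples G (Suc n) \<Longrightarrow> z ` B \<subseteq> carrier E \<Longrightarrow> comb B y = comb B z"
  unfolding comb_def by (rule P.T.finprod_cong'[OF refl comb_terms_closed]) auto

lemma comb_mult:
  assumes "B \<subseteq> tuples G (Suc n)" "y ` B \<subseteq> carrier E" "z ` B \<subseteq> carrier E"
  shows "comb B (\<lambda>t. y t \<otimes>\<^bsub>E\<^esub> z t) = comb B y \<otimes>\<^bsub>A n\<^esub> comb B z"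
proof -
  have "comb B (\<lambda>t. y t \<otimes>\<^bsub>E\<^esub> z t) =
      finprod (A n) (\<lambda>t. pt n (frag_of t) (y t) \<otimes>\<^bsub>A n\<^esub> pt n (frag_of t) (z t)) B"
    unfolding comb_def
  proof (rule P.T.finprod_cong'[OF refl])
    show "(\<lambda>t. pt n (frag_of t) (y t) \<otimes>\<^bsub>A n\<^esub> pt n (frag_of t) (z t)) \<in> B \<rightarrow> carrier (A n)"
      using comb_terms_closed[OF assms(1,2)] comb_terms_closed[OF assms(1,3)] by (auto simp: Pi_iff)
    fix t assume "t \<in> B"
    then show "pt n (frag_of t) (y t \<otimes>\<^bsub>E\<^esub> z t) = pt n (frag_of t) (y t) \<otimes>\<^bsub>A n\<^esub> pt n (frag_of t) (z t)"
      using assms by (intro P.pt_mult_right tuple_closed) auto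
  qed
  then show ?thesis
    unfolding comb_def using P.T.finprod_multf[OF comb_terms_closed[OF assms(1,2)] comb_terms_closed[OF assms(1,3)]]
    by simp
qed

lemma pt_one_right: "c \<in> carrier (chain_group G n) \<Longrightarrow> pt n c \<one>\<^bsub>E\<^esub> = \<one>\<^bsub>A n\<^esub>"
  using hom_one[OF P.pt_right_hom, of c n] E.M.is_group P.T.is_group by simp

lemma comb_extend:
  assumes "finite B'" "B \<subseteq> B'" "B' \<subseteq> tuples G (Suc n)" "y ` B' \<subseteq> carrier E"
    and "\<And>t. t \<in> B' - B \<Longrightarrow> y t = \<one>\<^bsub>E\<^esub>"
  shows "comb B y = comb B' y"
  unfolding comb_def
  using assms comb_terms_closed[OF assms(3,4)]
  by (intro P.T.finprod_mono_neutral_cong_left) (auto simp: pt_one_right tuple_closed)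

lemma comb_hom:
  assumes "B \<subseteq> tuples G (Suc n)"
  shows "(\<lambda>x. comb B (\<lambda>t. \<Theta> t x)) \<in> hom (A n) (A n)"
proof (rule homI)
  have c: "(\<lambda>t. \<Theta> t x) ` B \<subseteq> carrier E" if "x \<in> carrier (A n)" for x
    using \<Theta>_closed[OF that] by auto
  fix x assume x: "x \<in> carrier (A n)"
  show "comb B (\<lambda>t. \<Theta> t x) \<in> carrier (A n)" by (rule comb_closed[OF assms c[OF x]])
  fix y assume y: "y \<in> carrier (A n)"
  show "comb B (\<lambda>t. \<Theta> t (x \<otimes>\<^bsub>A n\<^esub> y)) = comb B (\<lambda>t. \<Theta> t x) \<otimes>\<^bsub>A n\<^esub> comb B (\<lambda>t. \<Theta> t y)"
    using comb_mult[OF assms c[OF x] c[OF y]] hom_mult[OF \<Theta>_hom x y] by simp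
qed

lemma comb_group_hom: "B \<subseteq> tuples G (Suc n) \<Longrightarrow> group_hom (A n) (A n) (\<lambda>x. comb B (\<lambda>t. \<Theta> t x))"
  by (simp add: group_hom_def group_hom_axioms_def comb_hom)

definition spanned :: "((('g list \<Rightarrow>\<^sub>0 int) \<times> 'e) \<Rightarrow>\<^sub>0 int) set \<Rightarrow> bool" where
  "spanned x \<longleftrightarrow> (\<exists>B. finite B \<and> B \<subseteq> tuples G (Suc n) \<and>
     (\<forall>B'. finite B' \<longrightarrow> B \<subseteq> B' \<longrightarrow> B' \<subseteq> tuples G (Suc n) \<longrightarrow> comb B' (\<lambda>t. \<Theta> t x) = x))"

lemma spanned_one: "spanned \<one>\<^bsub>A n\<^esub>"
  unfolding spanned_def
proof (intro exI[of _ "{}"] conjI allI impI)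
  fix B' assume "B' \<subseteq> tuples G (Suc n)"
  then show "comb B' (\<lambda>t. \<Theta> t \<one>\<^bsub>A n\<^esub>) = \<one>\<^bsub>A n\<^esub>" by (rule group_hom.hom_one[OF comb_group_hom])
qed auto

lemma spanned_diff:
  assumes x: "x \<in> carrier (A n)" "spanned x" and y: "y \<in> carrier (A n)" "spanned y"
  shows "spanned (x \<otimes>\<^bsub>A n\<^esub> inv\<^bsub>A n\<^esub> y)"
proof -
  obtain B where B: "finite B" "B \<subseteq> tuples G (Suc n)"
      "\<And>B'. \<lbrakk>finite B'; B \<subseteq> B'; B' \<subseteq> tuples G (Suc n)\<rbrakk> \<Longrightarrow> comb B' (\<lambda>t. \<Theta> t x) = x"
    using x(2) unfolding spanned_def by blast
  obtain D where D: "finite D" "D \<subseteq> tuples G (Suc n)"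
      "\<And>B'. \<lbrakk>finite B'; D \<subseteq> B'; B' \<subseteq> tuples G (Suc n)\<rbrakk> \<Longrightarrow> comb B' (\<lambda>t. \<Theta> t y) = y"
    using y(2) unfolding spanned_def by blast
  show ?thesis
    unfolding spanned_def
  proof (intro exI[of _ "B \<union> D"] conjI allI impI)
    fix B' assume B': "finite B'" "B \<union> D \<subseteq> B'" "B' \<subseteq> tuples G (Suc n)"
    interpret c: group_hom "A n" "A n" "\<lambda>x. comb B' (\<lambda>t. \<Theta> t x)" by (rule comb_group_hom[OF B'(3)])
    have "comb B' (\<lambda>t. \<Theta> t (x \<otimes>\<^bsub>A n\<^esub> inv\<^bsub>A n\<^esub> y)) =
        comb B' (\<lambda>t. \<Theta> t x) \<otimes>\<^bsub>A n\<^esub> inv\<^bsub>A n\<^esub> comb B' (\<lambda>t. \<Theta> t y)"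
      using c.hom_mult[OF x(1) P.T.inv_closed[OF y(1)]] c.hom_inv[OF y(1)] by (simp only:)
    then show "comb B' (\<lambda>t. \<Theta> t (x \<otimes>\<^bsub>A n\<^esub> inv\<^bsub>A n\<^esub> y)) = x \<otimes>\<^bsub>A n\<^esub> inv\<^bsub>A n\<^esub> y"
      using B(3)[OF B'(1) _ B'(3)] D(3)[OF B'(1) _ B'(3)] B'(2) by simp
  qed (use B D in auto)
qed

text \<open>Balancing moves the group element across the tensor sign: \<open>\<sigma>\<close> is its
  root tuple acted on from the right by the inverse of its first vertex, and this inverse is let act
  on \<open>e\<close> instead.\<close>

lemma spanned_simplex:
  assumes \<sigma>: "\<sigma> \<in> tuples G (Suc n)" and e: "e \<in> carrier E"
  shows "spanned (pt n (frag_of \<sigma>) e)"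
  unfolding spanned_def
proof (intro exI[of _ "{root_tuple G \<sigma>}"] conjI allI impI)
  let ?t = "root_tuple G \<sigma>" and ?r = "frag_of (inv\<^bsub>G\<^esub> hd \<sigma>)"
  show t: "{?t} \<subseteq> tuples G (Suc n)" using G.root_tuple_in[OF \<sigma>] by simp
  have hd: "hd \<sigma> \<in> carrier G" by (rule hd_tuples[OF \<sigma>])
  then have r: "?r \<in> carrier (group_ring G)" by simp
  have \<Theta>\<sigma>: "\<Theta> t (pt n (frag_of \<sigma>) e) = (if t = ?t then act ?r e else \<one>\<^bsub>E\<^esub>)" for t
    using \<Theta>_pt[OF tuple_closed[OF \<sigma>] e] act_zero[OF e] by (simp add: root_coeff_frag_of)
  fix B' assume B': "finite B'" "{?t} \<subseteq> B'" "B' \<subseteq> tuples G (Suc n)"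
  have "comb B' (\<lambda>t. \<Theta> t (pt n (frag_of \<sigma>) e)) = comb {?t} (\<lambda>t. \<Theta> t (pt n (frag_of \<sigma>) e))"
    using B' E.act_closed[OF r e]
    by (intro comb_extend[symmetric]) (auto simp: \<Theta>\<sigma>)
  also have "\<dots> = pt n (frag_of ?t) (act ?r e)"
    using t P.pt_closed[OF tuple_closed E.act_closed[OF r e], of ?t] by (simp add: comb_def \<Theta>\<sigma>)
  also have "\<dots> = pt n (chain_ract G (frag_of ?t) ?r) e"
    using t by (intro P.pt_balanced[symmetric] tuple_closed r e) simp
  also have "chain_ract G (frag_of ?t) ?r = frag_of \<sigma>"
    using G.map_root_tuple[OF \<sigma>] hd by (simp add: chain_ract_eq)
  finally show "comb B' (\<lambda>t. \<Theta> t (pt n (frag_of \<sigma>) e)) = pt n (frag_of \<sigma>) e" .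
qed simp

lemma spanned: "x \<in> carrier (A n) \<Longrightarrow> spanned x"
proof (induction rule: P.tensor_induct)
  case (pure c e)
  have "Poly_Mapping.keys c \<subseteq> tuples G (Suc n)" using pure by (simp add: chain_group_eq)
  then show ?case
  proof (rule free_Abelian_group_induct[where P = "\<lambda>c. spanned (pt n c e)"])
    show "spanned (pt n 0 e)" using spanned_one pt_zero[OF pure(2)] by simp
    show "spanned (pt n (frag_of \<sigma>) e)" if "\<sigma> \<in> tuples G (Suc n)" for \<sigma>
      by (rule spanned_simplex[OF that pure(2)])
    fix a b assume ab: "Poly_Mapping.keys a \<subseteq> tuples G (Suc n)" "Poly_Mapping.keys b \<subseteq> tuples G (Suc n)"
      "spanned (pt n a e)" "spanned (pt n b e)"
    have C: "a \<in> carrier (chain_group G n)" "b \<in> carrier (chain_group G n)"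
      using ab by (simp_all add: chain_group_eq)
    interpret p: group_hom "chain_group G n" "A n" "\<lambda>u. pt n u e"
      using P.pt_left_hom[OF pure(2)] by (simp add: group_hom_def group_hom_axioms_def P.M.is_group)
    have "pt n (a - b) e = pt n a e \<otimes>\<^bsub>A n\<^esub> inv\<^bsub>A n\<^esub> pt n b e"
      using p.hom_mult[OF C(1) P.M.inv_closed[OF C(2)]] p.hom_inv[OF C(2)] ab by (simp add: chain_group_eq)
    then show "spanned (pt n (a - b) e)"
      using spanned_diff[OF P.pt_closed[OF C(1) pure(2)] ab(3) P.pt_closed[OF C(2) pure(2)] ab(4)] by simp
  qed
qed (auto intro: spanned_one spanned_diff)

text \<open>The finite set over which \<open>x\<close> is recovered is not known in advance;
  adjoining it to \<open>B\<close> only adds terms with trivial coordinates.\<close>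

lemma eq_comb:
  assumes x: "x \<in> carrier (A n)" and B: "finite B" "B \<subseteq> tuples G (Suc n)"
    and zero: "\<And>t. \<lbrakk>t \<in> tuples G (Suc n); t \<notin> B\<rbrakk> \<Longrightarrow> \<Theta> t x = \<one>\<^bsub>E\<^esub>"
  shows "x = comb B (\<lambda>t. \<Theta> t x)"
proof -
  obtain D where D: "finite D" "D \<subseteq> tuples G (Suc n)"
      "\<And>B'. \<lbrakk>finite B'; D \<subseteq> B'; B' \<subseteq> tuples G (Suc n)\<rbrakk> \<Longrightarrow> comb B' (\<lambda>t. \<Theta> t x) = x"
    using spanned[OF x] unfolding spanned_def by blast
  have "comb B (\<lambda>t. \<Theta> t x) = comb (B \<union> D) (\<lambda>t. \<Theta> t x)"
    using B D(1,2) \<Theta>_closed[OF x] zero by (intro comb_extend) auto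
  also have "\<dots> = x" using B D by simp
  finally show ?thesis ..
qed

text \<open>If the seminorm vanishes, so do all coordinates, as they are bounded and the norm of
  \<open>E\<close> is definite; and coordinates determine the element. This turns a vanishing
  seminorm into an algebraic identity.\<close>

lemma l1_seminorm_definite:
  assumes x: "x \<in> carrier (A n)" and "sn l1_norm n x \<le> 0"
  shows "x = \<one>\<^bsub>A n\<^esub>"
proof -
  have "\<Theta> t x = \<one>\<^bsub>E\<^esub>" for t
    using \<Theta>_bound[OF x, of t] assms(2) en_nonneg[OF \<Theta>_closed[OF x, of t]] E.definite[OF \<Theta>_closed[OF x, of t]]
    by linarith
  then have "x = comb {} (\<lambda>t. \<Theta> t x)" by (intro eq_comb x) auto
  then show ?thesis by (simp add: comb_def)
qed

lemma comb_norm_le: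
  assumes "finite B" "B \<subseteq> tuples G (Suc n)" "y ` B \<subseteq> carrier E"
  shows "sn l1_norm n (comb B y) \<le> (\<Sum>t\<in>B. en (y t))"
  using assms
proof (induction B)
  case empty
  interpret s: Z_seminormed "A n" "sn l1_norm n" by (rule normed_tensor_pair.Z_seminormed_pn[OF l1_pair])
  show ?case by (simp add: comb_def)
next
  case (insert t B)
  interpret s: Z_seminormed "A n" "sn l1_norm n" by (rule normed_tensor_pair.Z_seminormed_pn[OF l1_pair])
  have c: "pt n (frag_of t) (y t) \<in> carrier (A n)" "comb B y \<in> carrier (A n)"
    using insert by (auto intro!: P.pt_closed tuple_closed comb_closed)
  have "comb (insert t B) y = pt n (frag_of t) (y t) \<otimes>\<^bsub>A n\<^esub> comb B y"
    unfolding comb_def using insert comb_terms_closed[of B y] c(1) by (intro P.T.finprod_insert) auto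
  then have "sn l1_norm n (comb (insert t B) y) \<le> sn l1_norm n (pt n (frag_of t) (y t)) + sn l1_norm n (comb B y)"
    using s.triangle[OF c] by simp
  also have "sn l1_norm n (pt n (frag_of t) (y t)) \<le> l1_norm (frag_of t) * en (y t)"
    using insert by (intro normed_tensor_pair.pn_pt_le[OF l1_pair] tuple_closed) auto
  finally show ?case using insert by simp
qed

text \<open>On tensors with coordinates in a finite set \<open>B\<close>, convergence in the
  seminorm is convergence of coordinates in \<open>E\<close>, which is complete. The limit is thus
  found in the algebraic tensor product itself.\<close>

lemma finite_rank_complete:
  assumes X: "X \<in> cauchy_seqs (A n) (sn l1_norm n)" and B: "finite B" "B \<subseteq> tuples G (Suc n)"
    and zero: "\<And>k t. t \<notin> B \<Longrightarrow> \<Theta> t (X k) = \<one>\<^bsub>E\<^esub>"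
  shows "\<exists>a\<in>carrier (A n). (\<lambda>k. X k \<otimes>\<^bsub>A n\<^esub> inv\<^bsub>A n\<^esub> a) \<in> null_seqs (A n) (sn l1_norm n)"
proof -
  interpret s: Z_seminormed "A n" "sn l1_norm n" by (rule normed_tensor_pair.Z_seminormed_pn[OF l1_pair])
  note Xc = s.cauchy_seqs_closed[OF X]
  have "(\<lambda>k. \<Theta> t (X k)) \<in> cauchy_seqs E en" for t
    by (rule bounded_hom_cauchy[OF s.Z_seminormed_axioms E.Z_seminormed_axioms \<Theta>_hom _ X, of _ 1])
      (simp add: \<Theta>_bound)
  then have "\<forall>t. \<exists>e\<in>carrier E. (\<lambda>k. en (\<Theta> t (X k) \<otimes>\<^bsub>E\<^esub> inv\<^bsub>E\<^esub> e)) \<longlonglongrightarrow> 0"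
    using E.complete by (auto simp: norm_complete_def)
  then have "\<exists>y. \<forall>t. y t \<in> carrier E \<and> (\<lambda>k. en (\<Theta> t (X k) \<otimes>\<^bsub>E\<^esub> inv\<^bsub>E\<^esub> y t)) \<longlonglongrightarrow> 0"
    by (intro choice) blast
  then obtain y where y: "\<And>t. y t \<in> carrier E" "\<And>t. (\<lambda>k. en (\<Theta> t (X k) \<otimes>\<^bsub>E\<^esub> inv\<^bsub>E\<^esub> y t)) \<longlonglongrightarrow> 0"
    by blast
  let ?a = "comb B y" and ?w = "\<lambda>k t. \<Theta> t (X k) \<otimes>\<^bsub>E\<^esub> inv\<^bsub>E\<^esub> y t"
  have yB: "y ` B \<subseteq> carrier E" and wB: "?w k ` B \<subseteq> carrier E" for k
    using y(1) \<Theta>_closed[OF Xc] by auto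
  have a: "?a \<in> carrier (A n)" by (rule comb_closed[OF B(2) yB])
  have diff: "X k \<otimes>\<^bsub>A n\<^esub> inv\<^bsub>A n\<^esub> ?a = comb B (?w k)" for k
  proof -
    have "X k = comb B (\<lambda>t. \<Theta> t (X k))" using B zero by (intro eq_comb Xc)
    also have "\<dots> = comb B (\<lambda>t. ?w k t \<otimes>\<^bsub>E\<^esub> y t)"
      using y(1) \<Theta>_closed[OF Xc] B(2) by (intro comb_cong) (auto simp: E.M.m_assoc)
    also have "\<dots> = comb B (?w k) \<otimes>\<^bsub>A n\<^esub> ?a" by (rule comb_mult[OF B(2) wB yB])
    finally show ?thesis
      using a comb_closed[OF B(2) wB, of k] Xc[of k] by (simp add: P.T.inv_solve_right')
  qed
  have "(\<lambda>k. \<Sum>t\<in>B. en (?w k t)) \<longlonglongrightarrow> (\<Sum>t\<in>B. 0)" by (rule tendsto_sum) (rule y(2))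
  then have lim: "(\<lambda>k. \<Sum>t\<in>B. en (?w k t)) \<longlonglongrightarrow> 0" by simp
  have "(\<lambda>k. sn l1_norm n (X k \<otimes>\<^bsub>A n\<^esub> inv\<^bsub>A n\<^esub> ?a)) \<longlonglongrightarrow> 0"
  proof (rule tendsto_sandwich[OF always_eventually always_eventually tendsto_const])
    show "\<forall>k. 0 \<le> sn l1_norm n (X k \<otimes>\<^bsub>A n\<^esub> inv\<^bsub>A n\<^esub> ?a)"
      using a Xc by (intro allI s.seminorm_nonneg) simp
    show "\<forall>k. sn l1_norm n (X k \<otimes>\<^bsub>A n\<^esub> inv\<^bsub>A n\<^esub> ?a) \<le> (\<Sum>t\<in>B. en (?w k t))"
      unfolding diff using comb_norm_le[OF B wB] by blast
  qed (rule lim)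
  then show ?thesis using a Xc by (intro bexI[of _ ?a] s.null_seqsI) auto
qed

end

end

section \<open>The comparison maps\<close>

context group_coefficients
begin

text \<open>The homotopy formula tensored with \<open>E\<close>. Its last term stays a single map
  instead of a composite with \<open>bd n\<close>, so that the identity makes sense in degree 0,
  where the complex ends.\<close>

lemma homotopy_identity:
  assumes f: "equivariant G (Suc n) (Suc n) f" and h: "equivariant G (Suc n) (Suc (Suc n)) h"
    and h': "equivariant G n (Suc n) h'"
    and hom: "\<And>\<sigma>. \<sigma> \<in> tuples G (Suc n) \<Longrightarrow>
      chain_boundary (h \<sigma>) + frag_extend h' (chain_boundary (frag_of \<sigma>)) = f \<sigma> - frag_of \<sigma>"
    and x: "x \<in> carrier (A n)"
  shows "tm n f x = x \<otimes>\<^bsub>A n\<^esub> bd (Suc n) (tm (Suc n) h x) \<otimes>\<^bsub>A n\<^esub>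
    tm n (\<lambda>\<sigma>. frag_extend h' (chain_boundary (frag_of \<sigma>))) x"
proof -
  let ?g = "\<lambda>\<sigma>. frag_extend h' (chain_boundary (frag_of \<sigma>))"
  have g: "equivariant G (Suc n) (Suc n) ?g"
    by (rule equivariant_extend[OF h' equivariant_chain_boundary[OF G.is_group]])
  have bh: "(\<lambda>x. bd (Suc n) (tm (Suc n) h x)) \<in> hom (A n) (A n)"
    using hom_compose[OF tm(1)[OF h] bd_hom] by (simp add: o_def)
  note homs = hom_mult[OF bh] hom_mult[OF tm(1)[OF g]] hom_in_carrier[OF bh] hom_in_carrier[OF tm(1)[OF g]]
  show ?thesis
  proof (rule P.tensor_hom_eqI[OF P.T.is_group tm(1)[OF f] _ _ x])
    show "(\<lambda>x. x \<otimes>\<^bsub>A n\<^esub> bd (Suc n) (tm (Suc n) h x) \<otimes>\<^bsub>A n\<^esub> tm n ?g x) \<in> hom (A n) (A n)"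
      by (rule homI) (simp_all add: homs P.T.m_ac)
    fix c e assume c: "c \<in> carrier (chain_group G n)" and e: "e \<in> carrier E"
    have keys: "Poly_Mapping.keys c \<subseteq> tuples G (Suc n)" using c by (simp add: chain_group_eq)
    have hc: "frag_extend h c \<in> carrier (chain_group G (Suc n))" using extend_hom[OF h] c by (rule hom_in_carrier)
    have gc: "frag_extend ?g c \<in> carrier (chain_group G n)" using extend_hom[OF g] c by (rule hom_in_carrier)
    have bhc: "chain_boundary (frag_extend h c) \<in> carrier (chain_group G n)"
      using hom_in_carrier[OF extend_hom[OF equivariant_bd] hc] by (simp flip: chain_boundary_eq_extend)
    have "frag_extend f c = frag_extend (\<lambda>\<sigma>. frag_of \<sigma> + chain_boundary (h \<sigma>) + ?g \<sigma>) c"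
    proof (rule frag_extend_eq)
      fix \<sigma> assume "\<sigma> \<in> Poly_Mapping.keys c"
      from hom[OF subsetD[OF keys this]] show "f \<sigma> = frag_of \<sigma> + chain_boundary (h \<sigma>) + ?g \<sigma>"
        by (simp add: algebra_simps)
    qed
    then have fc: "frag_extend f c = c + chain_boundary (frag_extend h c) + frag_extend ?g c"
      by (simp add: frag_extend_fun_add chain_boundary_extend)
    have add: "pt n (a + b) e = pt n a e \<otimes>\<^bsub>A n\<^esub> pt n b e" "a + b \<in> carrier (chain_group G n)"
      if "a \<in> carrier (chain_group G n)" "b \<in> carrier (chain_group G n)" for a b
      using P.pt_mult_left[OF that e] P.M.m_closed[OF that] by (simp_all add: chain_group_eq)
    have "tm n f (pt n c e) = pt n c e \<otimes>\<^bsub>A n\<^esub> pt n (chain_boundary (frag_extend h c)) e \<otimes>\<^bsub>A n\<^esub> pt n (frag_extend ?g c) e"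
      unfolding tm(2)[OF f c e] fc by (simp only: add c bhc gc)
    moreover have "bd (Suc n) (tm (Suc n) h (pt n c e)) = pt n (chain_boundary (frag_extend h c)) e"
      unfolding bd_eq_tm tm(2)[OF h c e] tm(2)[OF equivariant_bd hc e] by (simp flip: chain_boundary_eq_extend)
    ultimately show "tm n f (pt n c e) = pt n c e \<otimes>\<^bsub>A n\<^esub> bd (Suc n) (tm (Suc n) h (pt n c e)) \<otimes>\<^bsub>A n\<^esub> tm n ?g (pt n c e)"
      by (simp only: tm(2)[OF g c e])
  qed
qed

section \<open>The Sobolev norm and the approximation of its cycles\<close>

context
  fixes S
  assumes S: "finite_generating_set G S"
begin

interpretation W: word_metric_group G S
  by unfold_locales (rule S)

text \<open>The diameter of the empty tuple is an unspecified \<^const>\<open>Max\<close>, so it is given weight zero.\<close>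

definition sobolev_weight :: "'g list \<Rightarrow> real" where
  "sobolev_weight \<sigma> = (if \<sigma> = [] then 0 else 1 + tuple_diam G S \<sigma>)"

lemma sobolev_weight_nonneg: "0 \<le> sobolev_weight \<sigma>"
  using W.diam_nonneg[of \<sigma>] by (simp add: sobolev_weight_def)

lemma sobolev_norm_eq:
  "Poly_Mapping.keys c \<subseteq> tuples G (Suc n) \<Longrightarrow> sobolev_norm G S c = weighted_norm sobolev_weight c"
  unfolding sobolev_norm_def weighted_norm_def
  by (intro sum.cong) (auto simp: sobolev_weight_def tuples_def)

lemma sobolev_norm_chain:
  "c \<in> carrier (chain_group G n) \<Longrightarrow> sobolev_norm G S c = weighted_norm sobolev_weight c"
  using sobolev_norm_eq by (simp add: chain_group_eq)

lemma sobolev_pair: "normed_tensor_pair (group_ring G) (chain_group G n) (chain_ract G) E act (sobolev_norm G S) en"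
  by (intro normed_tensor_pair.intro tensor_pair normed_tensor_pair_axioms.intro en_nonneg)
    (simp_all add: sobolev_norm_chain weighted_norm_nonneg sobolev_weight_nonneg)

lemma sobolev_complex: "seminormed_complex A bd (sn (sobolev_norm G S))"
proof (rule seminormed_complex[OF sobolev_pair])
  fix n c assume c: "c \<in> carrier (chain_group G (Suc n))"
  have bc: "chain_boundary c \<in> carrier (chain_group G n)"
    using hom_in_carrier[OF extend_hom[OF equivariant_bd] c] by (simp flip: chain_boundary_eq_extend)
  show "sobolev_norm G S (chain_boundary c) \<le> real (Suc (Suc n)) * sobolev_norm G S c"
    unfolding sobolev_norm_chain[OF c] sobolev_norm_chain[OF bc]
  proof (rule boundary_weight_bound)
    show "sobolev_weight \<eta> \<le> sobolev_weight \<sigma>" if "\<eta> \<noteq> []" "set \<eta> \<subseteq> set \<sigma>" for \<eta> \<sigma>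
      using W.diam_mono[OF that] that by (auto simp: sobolev_weight_def)
  qed (use c in \<open>auto simp: chain_group_eq sobolev_weight_nonneg\<close>)
qed

lemma tm_sobolev_bounded:
  assumes \<phi>: "equivariant G (Suc m) (Suc n) \<phi>"
    and bound: "\<exists>C\<ge>0. \<forall>\<sigma>\<in>tuples G (Suc m). l1_norm (\<phi> \<sigma>) \<le> C * (1 + tuple_diam G S \<sigma>)"
  shows "\<exists>C. \<forall>x\<in>carrier (A m). sn l1_norm n (tm n \<phi> x) \<le> C * sn (sobolev_norm G S) m x"
proof -
  obtain C where C: "0 \<le> C" "\<And>\<sigma>. \<sigma> \<in> tuples G (Suc m) \<Longrightarrow> l1_norm (\<phi> \<sigma>) \<le> C * (1 + tuple_diam G S \<sigma>)"
    using bound by blast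
  \<comment> \<open>The constant is raised to \<open>C + 1\<close> because the comparison of
    seminorms asks for a positive one.\<close>
  have "l1_norm (frag_extend \<phi> c) \<le> (C + 1) * sobolev_norm G S c" if c: "c \<in> carrier (chain_group G m)" for c
  proof -
    have "l1_norm (frag_extend \<phi> c) \<le> weighted_norm (\<lambda>\<sigma>. (C + 1) * sobolev_weight \<sigma>) c"
    proof (rule l1_norm_extend_le)
      fix \<sigma> assume "\<sigma> \<in> Poly_Mapping.keys c"
      then have \<sigma>: "\<sigma> \<in> tuples G (Suc m)" using c by (auto simp: chain_group_eq)
      then have "sobolev_weight \<sigma> = 1 + tuple_diam G S \<sigma>" by (auto simp: sobolev_weight_def tuples_def)
      then show "l1_norm (\<phi> \<sigma>) \<le> (C + 1) * sobolev_weight \<sigma>"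
        using C(2)[OF \<sigma>] sobolev_weight_nonneg[of \<sigma>] by (simp add: distrib_right)
    qed
    then show ?thesis by (simp add: weighted_norm_scale sobolev_norm_chain[OF c])
  qed
  moreover have "0 < C + 1" using C by simp
  ultimately show ?thesis
    using tm_bound[OF \<phi> _ sobolev_pair l1_pair] by blast
qed

lemma l1_le_sobolev:
  assumes "x \<in> carrier (A n)"
  shows "sn l1_norm n x \<le> sn (sobolev_norm G S) n x"
proof -
  have "sn l1_norm n x \<le> 1 * sn (sobolev_norm G S) n x"
  proof (rule normed_tensor_pair.seminorm_le_pn[OF sobolev_pair normed_tensor_pair.Z_seminormed_pn[OF l1_pair], where \<psi> = "\<lambda>x. x"])
    show "(\<lambda>x. x) \<in> hom (A n) (A n)" by (simp add: hom_def)
    fix c e assume ce: "c \<in> carrier (chain_group G n)" "e \<in> carrier E"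
    have "l1_norm c \<le> sobolev_norm G S c"
      unfolding sobolev_norm_chain[OF ce(1)] l1_norm_eq_weighted
      using ce(1) W.diam_nonneg by (intro weighted_norm_mono) (auto simp: sobolev_weight_def chain_group_eq tuples_def)
    then have "l1_norm c * en e \<le> 1 * (sobolev_norm G S c * en e)"
      using en_nonneg[OF ce(2)] by (simp add: mult_right_mono)
    with normed_tensor_pair.pn_pt_le[OF l1_pair ce]
    show "sn l1_norm n (pt n c e) \<le> 1 * (sobolev_norm G S c * en e)" by (rule order_trans)
  qed (use assms in auto)
  then show ?thesis by simp
qed

lemma tm_id: "x \<in> carrier (A n) \<Longrightarrow>
  tensor_map (group_ring G) (chain_group G n) (chain_ract G) E act id id x = x"
proof -
  assume x: "x \<in> carrier (A n)"
  have id: "frag_extend frag_of = (id :: ('g list \<Rightarrow>\<^sub>0 int) \<Rightarrow> _)" by (simp add: fun_eq_iff)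
  note t = tm[where m = n and n = n, OF equivariant_frag_of, unfolded id]
  show ?thesis
    by (rule P.tensor_hom_eqI[OF P.T.is_group t(1) _ _ x, where \<psi> = "\<lambda>x. x"])
      (simp_all add: t(2) hom_def)
qed

text \<open>By the homotopy, fX equals X plus the boundary of hX plus an error gX that tends to
  zero. The sequence fX is Cauchy with finitely many coordinates, so it converges to an algebraic
  chain \<open>a\<close>, which turns out to be a cycle. Hence X is, up to null sequences in the l1
  seminorm, the boundary of -hX plus \<open>a\<close>.\<close>

lemma sobolev_approximation:
  assumes hyp: "hyperbolic_group G"
    and X: "X \<in> cauchy_seqs (A n) (sn (sobolev_norm G S) n)"
    and cyc: "\<And>m. n = Suc m \<Longrightarrow> (\<lambda>k. bd n (X k)) \<in> null_seqs (A m) (sn (sobolev_norm G S) m)"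
  shows "\<exists>a\<in>cycles A bd n. \<exists>Y\<in>cauchy_seqs (A (Suc n)) (sn l1_norm (Suc n)).
    (\<lambda>k. X k \<otimes>\<^bsub>A n\<^esub> inv\<^bsub>A n\<^esub> (bd (Suc n) (Y k) \<otimes>\<^bsub>A n\<^esub> a)) \<in> null_seqs (A n) (sn l1_norm n)"
proof -
  interpret L: seminormed_complex A bd "sn l1_norm" by (rule l1_complex)
  interpret T: seminormed_complex A bd "sn (sobolev_norm G S)" by (rule sobolev_complex)
  interpret s: Z_seminormed "A n" "sn l1_norm n" by (rule L.seminormed)
  obtain f h where
    f: "\<And>n. equivariant G (Suc n) (Suc n) (f n)" and h: "\<And>n. equivariant G n (Suc n) (h n)"
    and hom: "\<And>n \<sigma>. \<sigma> \<in> tuples G (Suc n) \<Longrightarrow>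
       chain_boundary (h (Suc n) \<sigma>) + frag_extend (h n) (chain_boundary (frag_of \<sigma>)) = f n \<sigma> - frag_of \<sigma>"
    and fb: "\<And>n. \<exists>C\<ge>0. \<forall>\<sigma>\<in>tuples G (Suc n). l1_norm (f n \<sigma>) \<le> C * (1 + tuple_diam G S \<sigma>)"
    and hb: "\<And>n. \<exists>C\<ge>0. \<forall>\<sigma>\<in>tuples G (Suc n). l1_norm (h (Suc n) \<sigma>) \<le> C * (1 + tuple_diam G S \<sigma>)"
    and fin: "\<And>n. \<exists>B. finite B \<and> (\<forall>\<sigma>\<in>tuples G (Suc n). \<forall>\<tau>\<in>Poly_Mapping.keys (f n \<sigma>). root_tuple G \<tau> \<in> B)"
    and h0: "h 0 = (\<lambda>\<sigma>. 0)"
    by (rule hyperbolic_controlled_homotopy[OF hyp S]) blast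
  note Xc = Z_seminormed.cauchy_seqs_closed[OF T.seminormed X]
  let ?g = "\<lambda>\<sigma>. frag_extend (h n) (chain_boundary (frag_of \<sigma>))"
  have geq: "equivariant G (Suc n) (Suc n) ?g"
    by (rule equivariant_extend[OF h equivariant_chain_boundary[OF G.is_group]])
  define fX where "fX k = tm n (f n) (X k)" for k
  define hX where "hX k = tm (Suc n) (h (Suc n)) (X k)" for k
  define gX where "gX k = tm n ?g (X k)" for k
  have fXc: "fX k \<in> carrier (A n)" and hXc: "hX k \<in> carrier (A (Suc n))" and gXc: "gX k \<in> carrier (A n)" for k
    unfolding fX_def hX_def gX_def by (rule tm_closed f h geq Xc)+
  have dhXc: "bd (Suc n) (hX k) \<in> carrier (A n)" for k using bd_hom hXc by (rule hom_in_carrier)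
  have identity: "fX k = X k \<otimes>\<^bsub>A n\<^esub> bd (Suc n) (hX k) \<otimes>\<^bsub>A n\<^esub> gX k" for k
    unfolding fX_def hX_def gX_def by (rule homotopy_identity[OF f h h hom Xc])
  have bounded_cauchy: "(\<lambda>k. tm l \<phi> (X k)) \<in> cauchy_seqs (A l) (sn l1_norm l)"
    if \<phi>: "equivariant G (Suc n) (Suc l) \<phi>"
      and b: "\<exists>C\<ge>0. \<forall>\<sigma>\<in>tuples G (Suc n). l1_norm (\<phi> \<sigma>) \<le> C * (1 + tuple_diam G S \<sigma>)" for l \<phi>
  proof -
    obtain C where "\<forall>x\<in>carrier (A n). sn l1_norm l (tm l \<phi> x) \<le> C * sn (sobolev_norm G S) n x"
      using tm_sobolev_bounded[OF \<phi> b] by blast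
    then show ?thesis
      by (intro bounded_hom_cauchy[OF T.seminormed L.seminormed tm(1)[OF \<phi>] _ X]) blast
  qed
  have fX: "fX \<in> cauchy_seqs (A n) (sn l1_norm n)" and hX: "hX \<in> cauchy_seqs (A (Suc n)) (sn l1_norm (Suc n))"
    using bounded_cauchy[OF f fb] bounded_cauchy[OF h hb] by (simp_all add: fX_def[abs_def] hX_def[abs_def])
  \<comment> \<open>In degree 0 the homotopy on the empty tuple is zero. In positive degree gX is
    the homotopy applied to the boundaries of X, which tend to zero in the Sobolev seminorm, the one
    from which the homotopy is bounded.\<close>
  have gX: "gX \<in> null_seqs (A n) (sn l1_norm n)"
  proof (cases n)
    case 0
    have "gX k = \<one>\<^bsub>A n\<^esub>" for k
      unfolding gX_def
    proof (rule tm_zero[OF _ geq Xc])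
      show "?g \<sigma> = 0" for \<sigma> using 0 h0 by (simp add: frag_extend_eq_0)
    qed
    then have "gX = (\<lambda>k. \<one>\<^bsub>A n\<^esub>)" by (simp add: fun_eq_iff)
    then show ?thesis using s.null_seqs_one by simp
  next
    case (Suc m)
    have g_eq: "gX k = tm n (h n) (bd n (X k))" for k
      unfolding gX_def Suc bd_eq_tm
      by (rule tm_tm[OF equivariant_bd h, symmetric]) (use Xc Suc in simp)
    obtain C where "\<forall>x\<in>carrier (A m). sn l1_norm n (tm n (h n) x) \<le> C * sn (sobolev_norm G S) m x"
      using tm_sobolev_bounded[OF h hb, of m] Suc by auto
    then have "(\<lambda>k. tm n (h n) (bd n (X k))) \<in> null_seqs (A n) (sn l1_norm n)"
      using h[of n] Suc
      by (intro bounded_hom_null[OF T.seminormed L.seminormed tm(1) _ cyc[OF Suc]]) auto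
    then show ?thesis by (simp flip: g_eq)
  qed
  obtain B where B: "finite B" "\<And>\<sigma> \<tau>. \<lbrakk>\<sigma> \<in> tuples G (Suc n); \<tau> \<in> Poly_Mapping.keys (f n \<sigma>)\<rbrakk> \<Longrightarrow> root_tuple G \<tau> \<in> B"
    using fin[of n] by blast
  obtain \<Theta> where \<Theta>: "\<And>t. \<Theta> t \<in> hom (A n) E"
      "\<And>t c e. \<lbrakk>c \<in> carrier (chain_group G n); e \<in> carrier E\<rbrakk> \<Longrightarrow> \<Theta> t (pt n c e) = act (root_coeff G t c) e"
    using coordinates_exist[of n] by blast
  \<comment> \<open>Root tuples occurring in the image of \<open>f\<close> lie in the finite set
    \<open>B\<close>, so all other coordinates vanish; it is enough to see this on pure
    tensors.\<close>
  have \<Theta>f: "\<Theta> t (tm n (f n) x) = \<one>\<^bsub>E\<^esub>" if x: "x \<in> carrier (A n)" and t: "t \<notin> B \<inter> tuples G (Suc n)" for t x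
  proof (rule P.tensor_hom_eqI[OF E.M.is_group _ _ _ x])
    show "(\<lambda>x. \<Theta> t (tm n (f n) x)) \<in> hom (A n) E"
      using hom_compose[OF tm(1)[OF f] \<Theta>(1)] by (simp add: o_def)
    show "(\<lambda>x. \<one>\<^bsub>E\<^esub>) \<in> hom (A n) E" by (rule homI) simp_all
    fix c e assume c: "c \<in> carrier (chain_group G n)" and e: "e \<in> carrier E"
    have fc: "frag_extend (f n) c \<in> carrier (chain_group G n)" using extend_hom[OF f] c by (rule hom_in_carrier)
    have "root_coeff G t (frag_extend (f n) c) = 0"
      unfolding root_coeff_def
    proof (rule frag_extend_eq_0)
      fix \<tau> assume \<tau>: "\<tau> \<in> Poly_Mapping.keys (frag_extend (f n) c)"
      then obtain \<sigma> where "\<sigma> \<in> Poly_Mapping.keys c" "\<tau> \<in> Poly_Mapping.keys (f n \<sigma>)"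
        using keys_frag_extend by fast
      then have "root_tuple G \<tau> \<in> B" using B(2) c by (auto simp: chain_group_eq)
      moreover have "root_tuple G \<tau> \<in> tuples G (Suc n)"
        using G.root_tuple_in \<tau> fc by (auto simp: chain_group_eq)
      ultimately show "(if root_tuple G \<tau> = t then frag_of (inv\<^bsub>G\<^esub> hd \<tau>) else 0) = 0" using t by auto
    qed
    then show "\<Theta> t (tm n (f n) (pt n c e)) = \<one>\<^bsub>E\<^esub>"
      by (simp add: tm(2)[OF f c e] \<Theta>(2)[OF fc e] act_zero[OF e])
  qed
  have "\<exists>a\<in>carrier (A n). (\<lambda>k. fX k \<otimes>\<^bsub>A n\<^esub> inv\<^bsub>A n\<^esub> a) \<in> null_seqs (A n) (sn l1_norm n)"
    by (rule finite_rank_complete[OF \<Theta> fX, of "B \<inter> tuples G (Suc n)"]) (use B(1) \<Theta>f[OF Xc] in \<open>auto simp: fX_def\<close>)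
  then obtain a where a: "a \<in> carrier (A n)" and lim: "(\<lambda>k. fX k \<otimes>\<^bsub>A n\<^esub> inv\<^bsub>A n\<^esub> a) \<in> null_seqs (A n) (sn l1_norm n)"
    by blast
  \<comment> \<open>The boundary of \<open>a\<close> has seminorm zero as a limit; definiteness of
    the l1 seminorm on the algebraic tensor product makes it trivial.\<close>
  have "bd n a = \<one>\<^bsub>A m\<^esub>" if n: "n = Suc m" for m
  proof -
    interpret sm: Z_seminormed "A m" "sn l1_norm m" by (rule L.seminormed)
    interpret d: group_hom "A n" "A m" "bd n"
      using bd_hom[of m] n by (simp add: group_hom_def group_hom_axioms_def)
    obtain c where c: "\<forall>x\<in>carrier (A n). sn l1_norm m (bd n x) \<le> c * sn l1_norm n x"
      using L.d_bounded[of m] n by auto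
    have bnull: "(\<lambda>k. bd n (Z k)) \<in> null_seqs (A m) (sn l1_norm m)" if "Z \<in> null_seqs (A n) (sn l1_norm n)" for Z
      by (rule bounded_hom_null[OF s.Z_seminormed_axioms sm.Z_seminormed_axioms d.homh _ that]) (use c in blast)
    have dX: "(\<lambda>k. bd n (X k)) \<in> null_seqs (A m) (sn l1_norm m)"
    proof -
      have "(\<lambda>x. x) \<in> hom (A m) (A m)" by (simp add: hom_def)
      from bounded_hom_null[OF T.seminormed L.seminormed this _ cyc[OF n], of 1] show ?thesis
        by (simp add: l1_le_sobolev)
    qed
    \<comment> \<open>The boundary term in the homotopy identity is killed by a second boundary, so
      what remains is a product of two null sequences.\<close>
    have "bd n (fX k) = bd n (X k) \<otimes>\<^bsub>A m\<^esub> bd n (gX k)" for k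
    proof -
      have "bd n (bd (Suc n) (hX k)) = \<one>\<^bsub>A m\<^esub>" using bd_bd[of "hX k" m] hXc n by simp
      then show ?thesis
        unfolding identity using d.hom_mult[OF P.T.m_closed[OF Xc dhXc] gXc] d.hom_mult[OF Xc dhXc]
          d.hom_closed[OF Xc] by simp
    qed
    then have "(\<lambda>k. bd n (fX k)) \<in> null_seqs (A m) (sn l1_norm m)"
      using sm.null_seqs_mult[OF dX bnull[OF gX]] by simp
    from sm.null_seqs_mult[OF this sm.null_seqs_inv[OF bnull[OF lim]]]
    have "(\<lambda>k. bd n (fX k) \<otimes>\<^bsub>A m\<^esub> inv\<^bsub>A m\<^esub> bd n (fX k \<otimes>\<^bsub>A n\<^esub> inv\<^bsub>A n\<^esub> a)) \<in> null_seqs (A m) (sn l1_norm m)" .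
    \<comment> \<open>The difference of two null sequences is the constant sequence at the boundary
      of \<open>a\<close>.\<close>
    moreover have "bd n (fX k) \<otimes>\<^bsub>A m\<^esub> inv\<^bsub>A m\<^esub> bd n (fX k \<otimes>\<^bsub>A n\<^esub> inv\<^bsub>A n\<^esub> a) = bd n a" for k
      using d.hom_closed[OF fXc[of k]] d.hom_closed[OF a] fXc[of k] a
      by (simp add: P.T.inv_mult_group P.T.m_lcomm)
    ultimately have "(\<lambda>k. bd n a) \<in> null_seqs (A m) (sn l1_norm m)" by simp
    from sm.null_seqsD[OF this] have "sn l1_norm m (bd n a) = 0" by (simp add: LIMSEQ_const_iff)
    moreover obtain \<Psi> where \<Psi>: "\<And>t. \<Psi> t \<in> hom (A m) E"
      "\<And>t c e. \<lbrakk>c \<in> carrier (chain_group G m); e \<in> carrier E\<rbrakk> \<Longrightarrow> \<Psi> t (pt m c e) = act (root_coeff G t c) e"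
      using coordinates_exist[of m] by blast
    ultimately show ?thesis using a by (intro l1_seminorm_definite[OF \<Psi>]) auto
  qed
  then have "a \<in> cycles A bd n" using a by (simp add: L.in_cycles_iff)
  \<comment> \<open>The inverse accounts for the sign: the homotopy identity has the boundary of hX
    on the side of X.\<close>
  moreover define Y where "Y k = inv\<^bsub>A (Suc n)\<^esub> hX k" for k
  moreover have "Y \<in> cauchy_seqs (A (Suc n)) (sn l1_norm (Suc n))"
    unfolding Y_def[abs_def] by (rule Z_seminormed.cauchy_seqs_inv[OF L.seminormed hX])
  moreover have "X k \<otimes>\<^bsub>A n\<^esub> inv\<^bsub>A n\<^esub> (bd (Suc n) (Y k) \<otimes>\<^bsub>A n\<^esub> a) =
      (fX k \<otimes>\<^bsub>A n\<^esub> inv\<^bsub>A n\<^esub> a) \<otimes>\<^bsub>A n\<^esub> inv\<^bsub>A n\<^esub> gX k" for k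
  proof -
    interpret d: group_hom "A (Suc n)" "A n" "bd (Suc n)"
      using bd_hom[of n] by (simp add: group_hom_def group_hom_axioms_def)
    let ?x = "X k" and ?d = "bd (Suc n) (hX k)" and ?g = "gX k"
    have "?x \<otimes>\<^bsub>A n\<^esub> inv\<^bsub>A n\<^esub> (bd (Suc n) (Y k) \<otimes>\<^bsub>A n\<^esub> a) = ?x \<otimes>\<^bsub>A n\<^esub> ?d \<otimes>\<^bsub>A n\<^esub> inv\<^bsub>A n\<^esub> a"
      using Xc[of k] a hXc[of k] dhXc[of k] by (simp add: Y_def P.T.inv_mult P.T.m_assoc)
    also have "?x \<otimes>\<^bsub>A n\<^esub> ?d = fX k \<otimes>\<^bsub>A n\<^esub> inv\<^bsub>A n\<^esub> ?g"
      unfolding identity using Xc[of k] dhXc[of k] gXc[of k] by (simp add: P.T.m_assoc)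
    finally show ?thesis using fXc[of k] gXc[of k] a by (simp add: P.T.m_ac)
  qed
  moreover have "(\<lambda>k. (fX k \<otimes>\<^bsub>A n\<^esub> inv\<^bsub>A n\<^esub> a) \<otimes>\<^bsub>A n\<^esub> inv\<^bsub>A n\<^esub> gX k) \<in> null_seqs (A n) (sn l1_norm n)"
    by (rule s.null_seqs_mult[OF lim s.null_seqs_inv[OF gX]])
  ultimately show ?thesis by (intro bexI[of _ a] bexI[of _ Y]) simp_all
qed

lemma comparison_images:
  assumes "hyperbolic_group G"
  shows "comparison_map G E act en n ` carrier (group_homology G E act n) =
    sobolev_comparison_map G E act en n ` carrier (sobolev_homology G S E act en n)"
proof -
  have d: "hat_boundary G cn E act en = (\<lambda>n. completion_map (A (n - 1)) (sn cn (n - 1)) (bd n))" for cn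
    by (simp add: fun_eq_iff hat_boundary_def projective_map_def coeff_boundary_def)
  have c: "hat_chains G cn E act en = (\<lambda>n. completion (A n) (sn cn n))" for cn
    by (simp add: fun_eq_iff hat_chains_def projective_tensor_def)
  have cc: "coeff_chains G E act = A" by (simp add: fun_eq_iff coeff_chains_def)
  have can: "(\<lambda>n. projective_can (group_ring G) (chain_group G n) (chain_ract G) l1_norm E act en) =
      (\<lambda>n x. completion_class (A n) (sn l1_norm n) (\<lambda>_. x))"
    by (simp add: fun_eq_iff projective_can_def)
  show ?thesis
    unfolding comparison_map_def sobolev_comparison_map_def group_homology_def sobolev_homology_def
      d c cc can projective_map_def
    by (rule comparison_images_eq[OF l1_complex sobolev_complex l1_le_sobolev tm_id
          sobolev_approximation[OF assms]])
qed

end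

end

theorem theorem1p6:
  fixes G :: "('g, 'x) monoid_scheme" and S :: "'g set"
    and E :: "('e, 'y) monoid_scheme" and act :: "('g \<Rightarrow>\<^sub>0 int) \<Rightarrow> 'e \<Rightarrow> 'e" and en :: "'e \<Rightarrow> real"
    and n :: nat
  assumes "hyperbolic_group G"
    and "finite_generating_set G S"
    and "complete_normed_left_module (group_ring G) l1_norm E act en"
  shows "comparison_map G E act en n ` carrier (group_homology G E act n) =
         sobolev_comparison_map G E act en n ` carrier (sobolev_homology G S E act en n)"
proof -
  interpret group_coefficients G E act en
    using assms(1,3) by (simp add: group_coefficients_def hyperbolic_group_def)
  show ?thesis by (rule comparison_images[OF assms(2,1)])
qed

end
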